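(* Let $B:=\frac{\sqrt{3}}{\pi}$ and let $(t_n)$ be a sequence of positive integers with $t_n=o(n^{1/4})$. For each $n$ let $v_0\in\mathbb{R}$ and $\{v_t^{[j]}\}_{1 \leq t \leq t_n,\, j \in \{L,R\}} \subset \mathbb{R}$ be given. Then, as $n\to\infty$, the difference \begin{multline*} \mathbf{P}_{n}\left(\frac{{\rm PK}-B\sqrt{n}\log\left(2B\sqrt{n}\right)}{B\sqrt{n}} \leq v_0, \ \frac{Y_{t}^{[j]}-B\sqrt{n}\log\left(2B\sqrt{n}\right)}{B\sqrt{n}} \leq v_{t}^{[j]} \ \text{ for } j \in \{L,R\},\ 1 \leq t \leq t_n\right) \\ - \int_{-\infty}^{v_0} \int_{-\infty}^{v_{1}^{[L]}} \int_{-\infty}^{v_{1}^{[R]}} \cdots \int_{-\infty}^{v_{t_n}^{[L]}} \int_{-\infty}^{v_{t_n}^{[R]}} F\left(u_0,u_{1}^{[L]},u_{1}^{[R]}, \dots, u_{t_n}^{[L]},u_{t_n}^{[R]}\right) du_{t_n}^{[R]}\, du_{t_n}^{[L]} \cdots du_1^{[R]}\,du_1^{[L]}\, du_0 \end{multline*} tends to $0$, where $$ F\left(u_0,u_{1}^{[L]},u_{1}^{[R]}, \dots, u_{t_n}^{[L]},u_{t_n}^{[R]}\right) := \begin{cases}\frac{1}{2^{2t_n}}e^{-u_0-\sum_{1 \leq t \leq t_n} \left(u_t^{[L]}+u_t^{[R]}\right) - \frac{e^{-u_{t_n}^{[L]}}}{2} - \frac{e^{-u_{t_n}^{[R]}}}{2}}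 & \text{if } u_0 \geq u_1^{[j]} \geq \dots \geq u_{t_n}^{[j]} \text{ for } j \in \{L,R\}, \\ 0 & \text{otherwise.} \end{cases} $$
   Context: A unimodal sequence $\lambda$ of size $n$ is a finite sequence of positive integers $\lambda_{1}^{[L]} \leq \dots \leq \lambda_{r}^{[L]} \leq \lambda_{\mathrm{PK}} \geq \lambda_{s}^{[R]} \geq \dots \geq \lambda_{1}^{[R]}$ ($r,s\ge 0$) with a distinguished entry $\lambda_{\mathrm{PK}}$ (the peak), such that $\lambda_{\mathrm{PK}}+\sum_{k=1}^r\lambda_k^{[L]}+\sum_{k=1}^s\lambda_k^{[R]}=n$; the parts $\lambda_k^{[L]}$ are the parts to the left of the peak and the $\lambda_k^{[R]}$ the parts to the right of the peak. Let $\mathcal{U}_n$ be the set of unimodal sequences of size $n$ and $\mathbf{P}_n$ the uniform probability measure on $\mathcal{U}_n$. ${\rm PK}(\lambda):=\lambda_{\mathrm{PK}}$, and $Y_t^{[L]}(\lambda)$ (resp. $Y_t^{[R]}(\lambda)$) denotes the $t$-th largest part of $\lambda$ to the left (resp. right) of the peak (counted with multiplicity). *)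

theory Defs
  imports "HOL-Probability.Probability" "HOL-Library.Landau_Symbols"
begin

datatype side = L | R

text \<open>
  Both lists are in order of appearance in the sequence. The peak is a distinguished position:
  the same integer sequence with another occurrence of its maximum marked is a different object.
\<close>
datatype peaked_seq = Peaked_Seq (left_parts: "nat list") (PK: nat) (right_parts: "nat list")

definition unimodal :: "peaked_seq \<Rightarrow> bool" where
  "unimodal s \<longleftrightarrow>
     (\<forall>x \<in> set (left_parts s @ PK s # right_parts s). 0 < x) \<and>
     sorted_wrt (\<le>) (left_parts s @ [PK s]) \<and>
     sorted_wrt (\<ge>) (PK s # right_parts s)"

definition seq_size :: "peaked_seq \<Rightarrow> nat" where
  "seq_size s = PK s + sum_list (left_parts s) + sum_list (right_parts s)"

definition unimodal_seqs :: "nat \<Rightarrow> peaked_seq set" where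
  "unimodal_seqs n = {s. unimodal s \<and> seq_size s = n}"

lemma finite_unimodal_seqs: "finite (unimodal_seqs n)"
proof (rule finite_subset)
  let ?X = "{xs :: nat list. set xs \<subseteq> {..n} \<and> length xs \<le> n}"
  have len: "length xs \<le> sum_list xs" if "\<forall>x\<in>set xs. 0 < x" for xs :: "nat list"
    using that by (induction xs) (auto simp: Suc_le_eq)
  show "unimodal_seqs n \<subseteq> (\<lambda>(l, p, r). Peaked_Seq l p r) ` (?X \<times> {..n} \<times> ?X)"
  proof
    fix s assume s: "s \<in> unimodal_seqs n"
    obtain l p r where eq: "s = Peaked_Seq l p r" by (cases s)
    have pos: "\<forall>x\<in>set l. 0 < x" "\<forall>x\<in>set r. 0 < x" and sz: "p + sum_list l + sum_list r = n"
      using s by (auto simp: eq unimodal_seqs_def unimodal_def seq_size_def)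
    have le: "p \<le> n" "sum_list l \<le> n" "sum_list r \<le> n"
      using sz by linarith+
    have "set l \<subseteq> {..n}" "set r \<subseteq> {..n}"
      using le member_le_sum_list order_trans by (blast intro: atMost_iff[THEN iffD2])+
    moreover have "length l \<le> n" "length r \<le> n"
      using len[OF pos(1)] len[OF pos(2)] le by linarith+
    ultimately have "(l, p, r) \<in> ?X \<times> {..n} \<times> ?X"
      using le(1) by simp
    then show "s \<in> (\<lambda>(l, p, r). Peaked_Seq l p r) ` (?X \<times> {..n} \<times> ?X)"
      unfolding eq by (rule rev_image_eqI) simp
  qed
  show "finite ((\<lambda>(l, p, r). Peaked_Seq l p r) ` (?X \<times> {..n} \<times> ?X))"
    by (intro finite_imageI finite_cartesian_product finite_lists_length_le) auto
qed

lemma unimodal_seqs_nonempty: "unimodal_seqs n \<noteq> {}" if "0 < n"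
proof -
  have "Peaked_Seq [] n [] \<in> unimodal_seqs n"
    using that by (simp add: unimodal_seqs_def unimodal_def seq_size_def)
  then show ?thesis by blast
qed

text \<open>
  Uniform measure; \<open>pmf_of_set\<close> is meaningful here only for \<open>n > 0\<close>, as there is no unimodal
  sequence of size 0.
\<close>
definition P :: "nat \<Rightarrow> peaked_seq pmf" where
  "P n = pmf_of_set (unimodal_seqs n)"

fun parts :: "side \<Rightarrow> peaked_seq \<Rightarrow> nat list" where
  "parts L s = left_parts s"
| "parts R s = right_parts s"

text \<open>The \<open>k\<close>-th largest part, counted from 1; a missing part counts as 0.\<close>
definition Y :: "side \<Rightarrow> nat \<Rightarrow> peaked_seq \<Rightarrow> nat" where
  "Y j k s = (if 1 \<le> k \<and> k \<le> length (parts j s) then rev (sort (parts j s)) ! (k - 1) else 0)"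

definition B :: real where
  "B = sqrt 3 / pi"

definition rescale :: "nat \<Rightarrow> real \<Rightarrow> real" where
  "rescale n y = (y - B * sqrt (real n) * ln (2 * B * sqrt (real n))) / (B * sqrt (real n))"

text \<open>
  Names for the real coordinates: \<open>U0\<close> stands for \<open>u\<^sub>0\<close> and \<open>U j k\<close> for the \<open>k\<close>-th coordinate on side \<open>j\<close>.
  As \<open>t\<close> varies with \<open>n\<close>, points of the \<open>(2t+1)\<close>-dimensional space are functions
  on the finite set \<open>coords t\<close>.
\<close>
datatype coord = U0 | U side nat

definition coords :: "nat \<Rightarrow> coord set" where
  "coords t = insert U0 {U j k | j k. 1 \<le> k \<and> k \<le> t}"

definition F :: "nat \<Rightarrow> (coord \<Rightarrow> real) \<Rightarrow> real" where
  "F t u =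
    (if \<forall>j. u U0 \<ge> u (U j 1) \<and> (\<forall>k. 1 \<le> k \<and> k < t \<longrightarrow> u (U j k) \<ge> u (U j (k + 1)))
     then 1 / 2 ^ (2 * t) *
       exp (- u U0 - (\<Sum>k = 1..t. u (U L k) + u (U R k))
            - exp (- u (U L t)) / 2 - exp (- u (U R t)) / 2)
     else 0)"

text \<open>
  The integrand \<open>F t\<close> is nonnegative, so the integral against the product of the Lebesgue measures
  is the iterated integral, in any order.
\<close>
definition F_integral :: "nat \<Rightarrow> real \<Rightarrow> (side \<Rightarrow> nat \<Rightarrow> real) \<Rightarrow> real" where
  "F_integral t v0 v =
    (LINT u : (\<Pi>\<^sub>E i \<in> coords t. {..case i of U0 \<Rightarrow> v0 | U j k \<Rightarrow> v j k})
       | (\<Pi>\<^sub>M i \<in> coords t. lborel). F t u)"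

end

theory Submission
  imports Defs "HOL-Real_Asymp.Real_Asymp"
begin

text \<open>
  Weight a unimodal sequence of size \<open>m\<close> by \<open>exp (- \<alpha> * m)\<close>, with \<open>\<alpha> = 1 / (B * sqrt n)\<close> chosen such
  that the expected size is close to \<open>n\<close>. Then the multiplicities of the parts are independent and
  geometric, and fixing the peak and the \<open>t\<close> largest parts on both sides leaves two independent
  partitions with bounded parts. So the probability under \<open>P n\<close> of a given pattern of large parts is
  an explicit product times the probability that these two partitions have the right total size,
  divided by the probability that a weighted sequence has size \<open>n\<close>. A local limit theorem, uniform in
  the bounds on the parts, evaluates both, as long as the sum of the large parts deviates from its
  mean by less than \<open>n powr (3/4)\<close>.

  In the variables \<open>exp (- u) / 2\<close> the limiting density describes an exponential variable of mean
  \<open>1/2\<close> followed by two independent Poisson processes of rate 1; the condition \<open>t = o(n powr (1/4))\<close>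
  is what makes the sum of the large parts concentrated enough. It suffices to bound the discrete
  probabilities from below by the density on a typical set, because both measures have total mass 1;
  ties between parts then need no separate treatment.
\<close>

section \<open>Counting bounded partitions and fibres\<close>

text \<open>The size of a weighted sequence fluctuates on the scale \<alpha>^(-3/2), that is
  n^(3/4), and errors in the size are measured in this unit. Fixing the large parts shifts the mean
  by O(t / \<alpha>) plus O(sqrt t * log n / \<alpha>), and the square of t * sqrt \<alpha> is the
  second-order error in the product of the factors 1 - exp (- \<alpha> * k). The growth of t is used
  only through t * sqrt \<alpha> tending to 0. The cutoff for parts, where exp (- \<alpha> * k) is
  of order sqrt \<alpha>, fits between two demands: the t-th largest part has exp (- \<alpha> * k)
  of order \<alpha> * t, much less than sqrt \<alpha>, so typical patterns lie above the cutoff; and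
  \<alpha> * cutoff tends to infinity, so partitions bounded there keep asymptotically the full
  variance. All counting is one-sided: a fibre is bounded from below, the number of all sequences
  from above. The peak contributes the integral of exp (- 2 * x), that is 1/2, to the latter; this
  cancels the 2 left over when the 2t + 1 coordinates, each giving \<alpha> / 2, meet the 2t factors
  1/2 in \<open>F\<close>.\<close>

definition bounded_partitions :: "nat \<Rightarrow> nat \<Rightarrow> nat list set" where
  "bounded_partitions a m = {xs. sorted xs \<and> set xs \<subseteq> {1..a} \<and> sum_list xs = m}"

definition num_parts :: "nat \<Rightarrow> nat \<Rightarrow> nat" where
  "num_parts a m = card (bounded_partitions a m)"

definition num_pairs :: "nat \<Rightarrow> nat \<Rightarrow> nat \<Rightarrow> nat" where
  "num_pairs a b m = (\<Sum>i\<le>m. num_parts a i * num_parts b (m - i))"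

lemma finite_bounded_partitions: "finite (bounded_partitions a m)"
proof (rule finite_subset)
  have len: "length xs \<le> sum_list xs" if "\<forall>x\<in>set xs. 0 < x" for xs :: "nat list"
    using that by (induction xs) (auto simp: Suc_le_eq)
  show "bounded_partitions a m \<subseteq> {xs. set xs \<subseteq> {1..a} \<and> length xs \<le> m}"
    using len by (fastforce simp: bounded_partitions_def)
qed (rule finite_lists_length_le, simp)

lemma num_parts_0: "num_parts 0 m = (if m = 0 then 1 else 0)"
proof -
  have "bounded_partitions 0 m = (if m = 0 then {[]} else {})"
    by (auto simp: bounded_partitions_def)
  then show ?thesis by (simp add: num_parts_def)
qed

text \<open>Either the largest admissible part \<open>Suc a\<close> does not occur, or it is the
  last entry of the sorted list and can be removed. This recursion produces the factor 1 / (1 -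
  z^(a+1)) of the generating function.\<close>

lemma num_parts_Suc:
  "num_parts (Suc a) m =
     num_parts a m + (if Suc a \<le> m then num_parts (Suc a) (m - Suc a) else 0)"
proof -
  let ?f = "\<lambda>xs. xs @ [Suc a]"
  let ?T = "if Suc a \<le> m then ?f ` bounded_partitions (Suc a) (m - Suc a) else {}"
  have eq: "bounded_partitions (Suc a) m = bounded_partitions a m \<union> ?T" (is "?A = ?B")
  proof
    show "?A \<subseteq> ?B"
    proof
      fix xs assume xs: "xs \<in> ?A"
      show "xs \<in> ?B"
      proof (cases "Suc a \<in> set xs")
        case False
        have "set xs \<subseteq> {1..a}"
        proof
          fix x assume x: "x \<in> set xs"
          then have "x \<in> {1..Suc a}" using xs by (auto simp: bounded_partitions_def)
          moreover have "x \<noteq> Suc a" using x False by auto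
          ultimately show "x \<in> {1..a}" by auto
        qed
        then show ?thesis using xs by (auto simp: bounded_partitions_def)
      next
        case True
        then have ne: "xs \<noteq> []" by auto
        define ys where "ys = butlast xs"
        have eq: "xs = ys @ [last xs]" using ne by (simp add: ys_def)
        have s: "sorted (ys @ [last xs])" using xs eq by (simp add: bounded_partitions_def)
        have "last xs \<in> {1..Suc a}" using xs last_in_set[OF ne]
          unfolding bounded_partitions_def by blast
        then have "last xs \<le> Suc a" by simp
        moreover have "Suc a \<le> last xs"
        proof -
          have "Suc a \<in> set (ys @ [last xs])" using True eq by simp
          then show ?thesis using s by (auto simp: sorted_append)
        qed
        ultimately have l: "last xs = Suc a" by simp
        have e2: "xs = ys @ [Suc a]" using eq l by simp
        have "ys \<in> bounded_partitions (Suc a) (m - Suc a)" "Suc a \<le> m"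
          using xs unfolding e2 by (auto simp: bounded_partitions_def sorted_append)
        then show ?thesis using e2 by auto
      qed
    qed
    show "?B \<subseteq> ?A"
    proof
      fix xs assume "xs \<in> ?B"
      then consider "xs \<in> bounded_partitions a m"
        | ys where "Suc a \<le> m" "ys \<in> bounded_partitions (Suc a) (m - Suc a)" "xs = ys @ [Suc a]"
        by (auto split: if_splits)
      then show "xs \<in> ?A"
      proof cases
        case 1
        then show ?thesis by (auto simp: bounded_partitions_def)
      next
        case 2
        then have "\<forall>x\<in>set ys. x \<le> Suc a" by (auto simp: bounded_partitions_def)
        then show ?thesis using 2 by (simp add: bounded_partitions_def sorted_append)
      qed
    qed
  qed
  have "Suc a \<notin> set xs" if "xs \<in> bounded_partitions a m" for xs
    using that by (auto simp: bounded_partitions_def)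
  moreover have "Suc a \<in> set xs" if "xs \<in> ?T" for xs
    using that by (cases "Suc a \<le> m") auto
  ultimately have "bounded_partitions a m \<inter> ?T = {}" by blast
  then have "card (bounded_partitions a m \<union> ?T) = card (bounded_partitions a m) + card ?T"
    by (intro card_Un_disjoint) (auto simp: finite_bounded_partitions)
  moreover have ct: "card ?T = (if Suc a \<le> m then num_parts (Suc a) (m - Suc a) else 0)"
    unfolding num_parts_def by (simp add: card_image inj_on_def)
  ultimately show ?thesis
    unfolding num_parts_def[of "Suc a" m] num_parts_def[of a m] eq by (simp only: ct)
qed

section \<open>Pairs of bounded partitions and the decomposition of a unimodal sequence\<close>

lemma card_partition_pairs:
  "card (\<Union>i\<in>{..m}. bounded_partitions a i \<times> bounded_partitions b (m - i)) = num_pairs a b m"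
proof -
  have "card (\<Union>i\<in>{..m}. bounded_partitions a i \<times> bounded_partitions b (m - i))
      = (\<Sum>i\<le>m. card (bounded_partitions a i \<times> bounded_partitions b (m - i)))"
    by (rule card_UN_disjoint) (auto simp: finite_bounded_partitions, auto simp: bounded_partitions_def)
  then show ?thesis by (simp add: num_pairs_def num_parts_def card_cartesian_product)
qed

lemma finite_partition_pairs:
  "finite (\<Union>i\<in>{..m}. bounded_partitions a i \<times> bounded_partitions b (m - i))"
  by (simp add: finite_bounded_partitions)

text \<open>The left parts and the reversed right parts are partitions with parts at most the peak.
  An upper bound is the right direction, because this count enters as a denominator.\<close>

lemma card_unimodal_seqs_le:
  "card (unimodal_seqs n) \<le> (\<Sum>p=1..n. num_pairs p p (n - p))"
proof -
  let ?D = "\<lambda>p. \<Union>i\<in>{..n-p}. bounded_partitions p i \<times> bounded_partitions p (n - p - i)"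
  let ?f = "\<lambda>p (l, r). Peaked_Seq l p (rev r)"
  have "unimodal_seqs n \<subseteq> (\<Union>p\<in>{1..n}. ?f p ` ?D p)"
  proof
    fix s assume s: "s \<in> unimodal_seqs n"
    obtain l p r where eq: "s = Peaked_Seq l p r" by (cases s)
    have u: "\<forall>x\<in>set l. 0 < x" "\<forall>x\<in>set r. 0 < x" "0 < p" "sorted l" "\<forall>x\<in>set l. x \<le> p"
      "sorted_wrt (\<ge>) r" "\<forall>x\<in>set r. x \<le> p" "p + sum_list l + sum_list r = n"
      using s by (auto simp: eq unimodal_seqs_def unimodal_def seq_size_def sorted_wrt_append)
    have sr: "sorted (rev r)" using u(6) by (simp add: sorted_wrt_rev)
    have "(l, rev r) \<in> ?D p"
      using u sr by (auto simp: bounded_partitions_def Suc_le_eq sum_list_rev intro!: bexI[of _ "sum_list l"])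
    moreover have "p \<in> {1..n}" using u by auto
    moreover have "s = ?f p (l, rev r)" by (simp add: eq)
    ultimately show "s \<in> (\<Union>p\<in>{1..n}. ?f p ` ?D p)" by blast
  qed
  then have "card (unimodal_seqs n) \<le> card (\<Union>p\<in>{1..n}. ?f p ` ?D p)"
    by (intro card_mono finite_UN_I finite_imageI finite_partition_pairs) auto
  also have "\<dots> \<le> (\<Sum>p=1..n. card (?f p ` ?D p))" by (rule card_UN_le) simp
  also have "\<dots> \<le> (\<Sum>p=1..n. num_pairs p p (n - p))"
  proof (rule sum_mono)
    fix p
    have "card (?f p ` ?D p) \<le> card (?D p)" by (rule card_image_le[OF finite_partition_pairs])
    then show "card (?f p ` ?D p) \<le> num_pairs p p (n - p)" by (simp only: card_partition_pairs)
  qed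
  finally show ?thesis .
qed

text \<open>Once the peak and the \<open>t\<close> largest parts of both sides are prescribed, any
  two partitions bounded by \<open>x t\<close> and \<open>y t\<close> may fill the rest. Their parts
  may equal \<open>x t\<close> or \<open>y t\<close>: the \<open>t\<close> largest values stay the
  same, so ties need no care.\<close>

lemma num_pairs_le_card_fibre:
  fixes x y :: "nat \<Rightarrow> nat" and t :: nat
  assumes t: "0 < t" and pos: "0 < x t" "0 < y t"
    and mx: "\<And>i j. 1 \<le> i \<Longrightarrow> i \<le> j \<Longrightarrow> j \<le> t \<Longrightarrow> x j \<le> x i"
    and my: "\<And>i j. 1 \<le> i \<Longrightarrow> i \<le> j \<Longrightarrow> j \<le> t \<Longrightarrow> y j \<le> y i"
    and px: "x 1 \<le> p" and py: "y 1 \<le> p"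
    and n: "n = m + p + (\<Sum>k=1..t. x k + y k)"
  shows "num_pairs (x t) (y t) m \<le> card {s \<in> unimodal_seqs n. PK s = p \<and>
           (\<forall>k\<in>{1..t}. Y L k s = x k \<and> Y R k s = y k)}"
proof -
  let ?D = "\<Union>i\<in>{..m}. bounded_partitions (x t) i \<times> bounded_partitions (y t) (m - i)"
  define xs where "xs = map x [1..<t+1]"
  define ys where "ys = map y [1..<t+1]"
  \<comment> \<open>\<open>xs\<close> and \<open>ys\<close> are decreasing, so \<open>rev xs\<close>
    closes the increasing left side and \<open>ys\<close> opens the decreasing right side, both next
    to the peak.\<close>
  let ?f = "\<lambda>(l, r). Peaked_Seq (l @ rev xs) p (ys @ rev r)"
  have lxs: "length xs = t" "length ys = t" by (auto simp: xs_def ys_def)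
  have dx: "sorted_wrt (\<ge>) xs" "sorted_wrt (\<ge>) ys"
    unfolding xs_def ys_def sorted_wrt_iff_nth_less
    by (auto simp del: upt_Suc intro!: mx my)
  have setx: "x t \<le> z \<and> z \<le> p" if "z \<in> set xs" for z
  proof -
    obtain k where "1 \<le> k" "k \<le> t" "z = x k" using \<open>z \<in> set xs\<close> by (auto simp: xs_def)
    then show ?thesis using mx[of k t] mx[of 1 k] px by auto
  qed
  have sety: "y t \<le> z \<and> z \<le> p" if "z \<in> set ys" for z
  proof -
    obtain k where "1 \<le> k" "k \<le> t" "z = y k" using \<open>z \<in> set ys\<close> by (auto simp: ys_def)
    then show ?thesis using my[of k t] my[of 1 k] py by auto
  qed
  have sums: "sum_list xs = (\<Sum>k=1..t. x k)" "sum_list ys = (\<Sum>k=1..t. y k)"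
    unfolding xs_def ys_def interv_sum_list_conv_sum_set_nat set_upt
    by (simp_all add: atLeastLessThanSuc_atLeastAtMost)
  have "inj_on ?f ?D" by (rule inj_onI) (clarsimp split: prod.splits)
  moreover have "?f ` ?D \<subseteq> {s \<in> unimodal_seqs n. PK s = p \<and>
           (\<forall>k\<in>{1..t}. Y L k s = x k \<and> Y R k s = y k)}"
  proof
    fix s assume "s \<in> ?f ` ?D"
    then obtain l r i where i: "i \<le> m" and l: "l \<in> bounded_partitions (x t) i"
      and r: "r \<in> bounded_partitions (y t) (m - i)" and s: "s = Peaked_Seq (l @ rev xs) p (ys @ rev r)"
      by auto
    have xtp: "x t \<le> p" "y t \<le> p" using mx[of 1 t] my[of 1 t] px py t by auto
    have sub: "set l \<subseteq> {1..x t}" "set r \<subseteq> {1..y t}" "sorted l" "sorted r"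
      using l r by (auto simp: bounded_partitions_def)
    have sl: "sorted (l @ rev xs)"
      unfolding sorted_append sorted_wrt_rev
    proof (intro conjI ballI)
      fix z w assume "z \<in> set l" "w \<in> set (rev xs)"
      then show "z \<le> w" using sub(1) setx[of w] by fastforce
    qed (simp_all add: sub dx)
    have sr: "sorted (r @ rev ys)"
      unfolding sorted_append sorted_wrt_rev
    proof (intro conjI ballI)
      fix z w assume "z \<in> set r" "w \<in> set (rev ys)"
      then show "z \<le> w" using sub(2) sety[of w] by fastforce
    qed (simp_all add: sub dx)
    have sr': "sorted_wrt (\<ge>) (ys @ rev r)"
      using sr by (simp add: sorted_wrt_append sorted_wrt_rev)
    have bl: "0 < z \<and> z \<le> p" if "z \<in> set (l @ rev xs)" for z
    proof -
      have "z \<in> {1..x t} \<or> z \<in> set xs" using that sub(1) by auto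
      then show ?thesis using setx[of z] xtp pos by auto
    qed
    have br: "0 < z \<and> z \<le> p" if "z \<in> set (ys @ rev r)" for z
    proof -
      have "z \<in> {1..y t} \<or> z \<in> set ys" using that sub(2) by auto
      then show ?thesis using sety[of z] xtp pos by auto
    qed
    have "sorted_wrt (\<le>) ((l @ rev xs) @ [p])"
      using sl bl unfolding sorted_wrt_append[of _ "l @ rev xs"] by (simp del: set_append)
    moreover have "sorted_wrt (\<ge>) (p # ys @ rev r)"
      using sr' br by (simp del: set_append)
    moreover have "0 < p" using xtp pos by simp
    ultimately have "unimodal s"
      unfolding unimodal_def s peaked_seq.sel set_append set_simps
      using bl br by auto
    moreover have "seq_size s = n"
      using l r i by (simp add: s seq_size_def n bounded_partitions_def sum_list_rev sums sum.distrib)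
    moreover have "Y L k s = x k \<and> Y R k s = y k" if k: "k \<in> {1..t}" for k
    proof -
      have 1: "sort (l @ rev xs) = l @ rev xs" using sl by (rule sorted_sort_id)
      \<comment> \<open>\<open>Y\<close> sorts increasingly and then reverses, so the right side is
        replaced by its reversal, which is already sorted.\<close>
      have "sort (ys @ rev r) = sort (r @ rev ys)"
        by (rule properties_for_sort[OF _ sorted_sort]) simp
      then have 2: "sort (ys @ rev r) = r @ rev ys" using sr by (simp add: sorted_sort_id)
      have kt: "k - 1 < t" "1 + (k - 1) = k" using k by auto
      have "xs ! (k - 1) = x k" "ys ! (k - 1) = y k"
        using kt by (simp_all add: xs_def ys_def del: upt_Suc)
      then have "(xs @ rev l) ! (k - 1) = x k" "(ys @ rev r) ! (k - 1) = y k"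
        using kt lxs by (simp_all add: nth_append)
      moreover have "1 \<le> k" "k \<le> length (l @ rev xs)" "k \<le> length (ys @ rev r)"
        using k lxs by auto
      ultimately show ?thesis
        unfolding Y_def s parts.simps peaked_seq.sel 1 2 rev_append rev_rev_ident by simp
    qed
    moreover have "PK s = p" by (simp add: s)
    ultimately show "s \<in> {s \<in> unimodal_seqs n. PK s = p \<and>
           (\<forall>k\<in>{1..t}. Y L k s = x k \<and> Y R k s = y k)}"
      by (simp add: unimodal_seqs_def)
  qed
  ultimately have "card ?D \<le> card {s \<in> unimodal_seqs n. PK s = p \<and>
           (\<forall>k\<in>{1..t}. Y L k s = x k \<and> Y R k s = y k)}"
    by (intro card_inj_on_le[of ?f]) (auto simp: finite_unimodal_seqs)
  then show ?thesis by (simp only: card_partition_pairs)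
qed

section \<open>Generating functions and Fourier inversion\<close>

text \<open>The recursion bounds a partial sum by D + x^N times a shorter partial sum, hence by D +
  x^N times itself; solving for it bounds all partial sums. This convergence has to be known before
  the recursion can be applied to the whole series.\<close>

lemma summable_num_parts:
  fixes x :: real
  assumes "0 \<le> x" "x < 1"
  shows "summable (\<lambda>m. real (num_parts a m) * x ^ m)"
proof (induction a)
  case 0
  have "summable (\<lambda>m. if m = 0 then 1 else 0 :: real)" by (rule summable_single)
  also have "(\<lambda>m. if m = 0 then 1 else 0 :: real) = (\<lambda>m. real (num_parts 0 m) * x ^ m)"
    by (auto simp: num_parts_0)
  finally show ?case .
next
  case (Suc a)
  define N where "N = Suc a"
  let ?c = "\<lambda>m. real (num_parts N m)" and ?d = "\<lambda>m. real (num_parts a m)"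
  let ?D = "\<Sum>m. ?d m * x ^ m"
  have xN: "x ^ N < 1" using assms power_Suc_less_one[of x a] by (cases "x = 0") (auto simp: N_def)
  have "(\<Sum>m<M. ?c m * x ^ m) \<le> ?D / (1 - x ^ N)" for M
  proof -
    have "(\<Sum>m<M. ?c m * x ^ m) = (\<Sum>m<M. ?d m * x ^ m) + (\<Sum>m<M. if N \<le> m then ?c (m - N) * x ^ m else 0)"
      by (subst sum.distrib[symmetric], rule sum.cong) (auto simp: N_def num_parts_Suc[of a] algebra_simps)
    also have "(\<Sum>m<M. if N \<le> m then ?c (m - N) * x ^ m else 0) = (\<Sum>m\<in>{N..<M}. ?c (m - N) * x ^ m)"
      by (rule sum.mono_neutral_cong_right) auto
    also have "\<dots> = (\<Sum>j<M-N. ?c j * x ^ (j + N))"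
      by (rule sum.reindex_bij_witness[of _ "\<lambda>j. j + N" "\<lambda>m. m - N"]) auto
    also have "\<dots> = x ^ N * (\<Sum>j<M-N. ?c j * x ^ j)"
      by (simp add: sum_distrib_left power_add mult_ac)
    also have "\<dots> \<le> x ^ N * (\<Sum>j<M. ?c j * x ^ j)"
      using assms by (intro mult_left_mono sum_mono2) auto
    also have "(\<Sum>m<M. ?d m * x ^ m) \<le> ?D"
      using assms by (intro sum_le_suminf Suc.IH) auto
    finally have "(\<Sum>m<M. ?c m * x ^ m) * (1 - x ^ N) \<le> ?D" by (simp add: algebra_simps)
    then show ?thesis using xN by (simp add: pos_le_divide_eq)
  qed
  then show ?case unfolding N_def[symmetric] using assms
    by (intro summableI_nonneg_bounded[of _ "?D / (1 - x ^ N)"]) auto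
qed

text \<open>With convergence known, the recursion for the coefficients becomes C = D + z^N * C for
  the series.\<close>

lemma num_parts_sums:
  fixes z :: complex
  assumes "norm z < 1"
  shows "(\<lambda>m. of_nat (num_parts a m) * z ^ m) sums (\<Prod>k=1..a. 1 / (1 - z ^ k))"
proof (induction a)
  case 0
  have "(\<lambda>m. if m = 0 then 1 else 0 :: complex) sums 1" by (rule sums_single)
  also have "(\<lambda>m. if m = 0 then 1 else 0 :: complex) = (\<lambda>m. of_nat (num_parts 0 m) * z ^ m)"
    by (auto simp: num_parts_0)
  finally show ?case by simp
next
  case (Suc a)
  define N where "N = Suc a"
  let ?c = "\<lambda>m. of_nat (num_parts N m) * z ^ m" and ?d = "\<lambda>m. of_nat (num_parts a m) * z ^ m"
  have "summable (\<lambda>m. norm (?c m))"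
    using summable_num_parts[of "norm z" N] assms by (simp add: norm_mult norm_power)
  then have c: "?c sums (\<Sum>m. ?c m)" by (rule summable_sums[OF summable_norm_cancel])
  let ?s = "\<lambda>m. if N \<le> m then of_nat (num_parts N (m - N)) * z ^ m else 0 :: complex"
  have "(\<lambda>m. ?s (m + N)) = (\<lambda>m. z ^ N * ?c m)" by (auto simp: power_add)
  then have "(\<lambda>m. ?s (m + N)) sums (z ^ N * (\<Sum>m. ?c m))" using c by (simp add: sums_mult)
  then have "?s sums (z ^ N * (\<Sum>m. ?c m))" by (subst (asm) sums_zero_iff_shift) auto
  then have "(\<lambda>m. ?d m + ?s m) sums ((\<Prod>k=1..a. 1 / (1 - z ^ k)) + z ^ N * (\<Sum>m. ?c m))"
    by (intro sums_add Suc.IH)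
  also have "(\<lambda>m. ?d m + ?s m) = ?c"
    by (auto simp: N_def num_parts_Suc[of a] algebra_simps)
  finally have "(\<Sum>m. ?c m) = (\<Prod>k=1..a. 1 / (1 - z ^ k)) + z ^ N * (\<Sum>m. ?c m)"
    using c sums_unique2 by blast
  moreover have "z ^ N \<noteq> 1"
  proof
    assume "z ^ N = 1"
    then have "norm z ^ N = 1" by (metis norm_one norm_power)
    then show False using assms power_Suc_less_one[of "norm z" a] by (cases "norm z = 0") (auto simp: N_def)
  qed
  ultimately have "(\<Sum>m. ?c m) = (\<Prod>k=1..a. 1 / (1 - z ^ k)) * (1 / (1 - z ^ N))"
    by (simp add: field_simps)
  with c show ?case by (simp add: N_def)
qed

lemma num_pairs_sums:
  fixes z :: complex
  assumes "norm z < 1"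
  shows "(\<lambda>m. of_nat (num_pairs a b m) * z ^ m) sums
           ((\<Prod>k=1..a. 1 / (1 - z ^ k)) * (\<Prod>k=1..b. 1 / (1 - z ^ k)))"
proof -
  let ?f = "\<lambda>a m. of_nat (num_parts a m) * z ^ m :: complex"
  have s: "summable (\<lambda>m. norm (?f a m))" for a
    using summable_num_parts[of "norm z" a] assms by (simp add: norm_mult norm_power)
  have "(\<lambda>m. \<Sum>i\<le>m. ?f a i * ?f b (m - i)) sums ((\<Sum>m. ?f a m) * (\<Sum>m. ?f b m))"
    by (rule Cauchy_product_sums[OF s s])
  also have "(\<lambda>m. \<Sum>i\<le>m. ?f a i * ?f b (m - i)) = (\<lambda>m. of_nat (num_pairs a b m) * z ^ m)"
  proof
    fix m
    have "?f a i * ?f b (m - i) = of_nat (num_parts a i * num_parts b (m - i)) * z ^ m" if "i \<le> m" for i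
    proof -
      have "z ^ m = z ^ i * z ^ (m - i)" using that by (simp flip: power_add)
      then show ?thesis by (simp add: mult_ac)
    qed
    then show "(\<Sum>i\<le>m. ?f a i * ?f b (m - i)) = of_nat (num_pairs a b m) * z ^ m"
      unfolding num_pairs_def of_nat_sum sum_distrib_right by (intro sum.cong) auto
  qed
  finally show ?thesis using num_parts_sums[OF assms, THEN sums_unique] by simp
qed

text \<open>Absolute summability permits termwise integration over a period, and only the term of
  frequency \<open>m\<close> survives.\<close>

lemma fourier_coefficient:
  fixes c :: "nat \<Rightarrow> complex"
  assumes "summable (\<lambda>k. norm (c k))"
  shows "(LINT \<theta>:{-pi..pi}|lborel. (\<Sum>k. c k * cis (real k * \<theta>)) * cis (- (real m * \<theta>))) = 2 * pi * c m"
proof -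
  define h where "h k \<theta> = indicator {-pi..pi} \<theta> *\<^sub>R (c k * cis ((real k - real m) * \<theta>))" for k \<theta>
  have int: "integrable lborel (h k)" for k
    unfolding h_def set_integrable_def[symmetric]
    by (intro borel_integrable_atLeastAtMost' continuous_intros)
  have val: "integral\<^sup>L lborel (h k) = (if k = m then 2 * pi * c m else 0)" for k
  proof (cases "k = m")
    case True
    have "integral\<^sup>L lborel (h k) = (LINT \<theta>:{-pi..pi}|lborel. c m)"
      by (simp add: h_def[abs_def] set_lebesgue_integral_def True)
    also have "\<dots> = measure lborel {-pi..pi} *\<^sub>R c m"
      by (rule set_integral_const) auto
    also have "measure lborel {-pi..pi} = 2 * pi" by simp
    finally have "integral\<^sup>L lborel (h k) = (2 * pi) *\<^sub>R c m" .
    then show ?thesis unfolding True by (simp add: scaleR_conv_of_real)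
  next
    case False
    define d where "d = real k - real m"
    have d: "d \<noteq> 0" "\<exists>i::int. d = of_int i" using False
      by (auto simp: d_def intro!: exI[of _ "int k - int m"])
    then obtain i :: int where i: "d = of_int i" by auto
    have "(LINT \<theta>:{-pi..pi}|lborel. c k * cis (d * \<theta>)) =
        c k * cis (d * pi) / (\<i> * d) - c k * cis (d * (-pi)) / (\<i> * d)"
      unfolding set_lebesgue_integral_def
    proof (rule integral_FTC_Icc)
      show "((\<lambda>\<theta>. c k * cis (d * \<theta>) / (\<i> * d)) has_vector_derivative c k * cis (d * \<theta>)) (at \<theta> within {-pi..pi})" for \<theta>
      proof -
        have "((\<lambda>z. c k * exp (\<i> * (d * z)) / (\<i> * d)) has_field_derivative c k * exp (\<i> * (d * of_real \<theta>))) (at (of_real \<theta>))"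
          using d(1) by (auto intro!: derivative_eq_intros simp: field_simps)
        from has_vector_derivative_real_field[OF this] show ?thesis
          by (simp add: cis_conv_exp)
      qed
    qed (auto intro!: continuous_intros)
    \<comment> \<open>The antiderivative takes the same value at both ends because \<open>d\<close>
      is an integer.\<close>
    also have "cis (d * (-pi)) = cis (d * pi)"
    proof -
      have "cis (d * pi) = cis (d * (-pi)) * cis (2 * pi * d)" by (simp add: cis_mult algebra_simps)
      also have "cis (2 * pi * d) = 1" unfolding i by (simp add: cis_multiple_2pi)
      finally show ?thesis by simp
    qed
    finally have "(LINT \<theta>:{-pi..pi}|lborel. c k * cis (d * \<theta>)) = 0" by (simp only: diff_self)
    then show ?thesis unfolding h_def[abs_def] d_def set_lebesgue_integral_def using False by (simp only: if_False)
  qed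
  have nh: "norm (h k \<theta>) = indicator {-pi..pi} \<theta> * norm (c k)" for k \<theta>
    by (simp add: h_def norm_mult)
  have "integral\<^sup>L lborel (\<lambda>\<theta>. norm (h k \<theta>)) = 2 * pi * norm (c k)" for k
    unfolding nh by simp
  then have sm: "summable (\<lambda>k. integral\<^sup>L lborel (\<lambda>\<theta>. norm (h k \<theta>)))"
    using assms by (simp add: summable_mult)
  have ae: "AE \<theta> in lborel. summable (\<lambda>k. norm (h k \<theta>))"
    unfolding nh using assms by (auto intro: summable_mult)
  have "(\<Sum>k. integral\<^sup>L lborel (h k)) = integral\<^sup>L lborel (\<lambda>\<theta>. \<Sum>k. h k \<theta>)"
    by (rule integral_suminf[symmetric, OF int ae sm])
  also have "(\<lambda>\<theta>. \<Sum>k. h k \<theta>) = (\<lambda>\<theta>. indicator {-pi..pi} \<theta> *\<^sub>R ((\<Sum>k. c k * cis (real k * \<theta>)) * cis (- (real m * \<theta>))))"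
  proof
    fix \<theta>
    have s: "summable (\<lambda>k. c k * cis (real k * \<theta>))"
      by (rule summable_norm_cancel) (use assms in \<open>simp add: norm_mult\<close>)
    have "h k \<theta> = (c k * cis (real k * \<theta>)) * (indicator {-pi..pi} \<theta> *\<^sub>R cis (- (real m * \<theta>)))" for k
      by (simp add: h_def mult.assoc cis_mult algebra_simps)
    then have "(\<Sum>k. h k \<theta>) = (\<Sum>k. c k * cis (real k * \<theta>)) * (indicator {-pi..pi} \<theta> *\<^sub>R cis (- (real m * \<theta>)))"
      unfolding suminf_mult2[OF s] by (simp only:)
    then show "(\<Sum>k. h k \<theta>) = indicator {-pi..pi} \<theta> *\<^sub>R ((\<Sum>k. c k * cis (real k * \<theta>)) * cis (- (real m * \<theta>)))"
      by simp
  qed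
  also have "(\<Sum>k. integral\<^sup>L lborel (h k)) = 2 * pi * c m"
    unfolding val using sums_single[of m "\<lambda>_. 2 * pi * c m", THEN sums_unique]
    by (simp add: if_distrib eq_commute cong: if_cong)
  finally show ?thesis by (simp add: set_lebesgue_integral_def)
qed

section \<open>The Boltzmann model\<close>

abbreviation qpow :: "real \<Rightarrow> nat \<Rightarrow> real" where
  "qpow \<alpha> k \<equiv> exp (- (\<alpha> * real k))"

text \<open>
  In the Boltzmann model with parameter \<open>exp (- \<alpha>)\<close> the multiplicity of the part \<open>k\<close> is
  geometric with mean \<open>occ \<alpha> k\<close>; \<open>cf \<alpha> k\<close> is the characteristic function of \<open>k\<close> times this
  multiplicity, and \<open>wt \<alpha> a b\<close> is the law of the total size of two independent partitions with
  parts at most \<open>a\<close> and \<open>b\<close>.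
\<close>
definition occ :: "real \<Rightarrow> nat \<Rightarrow> real" where
  "occ \<alpha> k = 1 / (exp (\<alpha> * real k) - 1)"

definition cf :: "real \<Rightarrow> nat \<Rightarrow> real \<Rightarrow> complex" where
  "cf \<alpha> k \<theta> = 1 / (1 - complex_of_real (occ \<alpha> k) * (cis (real k * \<theta>) - 1))"

definition cf2 :: "real \<Rightarrow> nat \<Rightarrow> nat \<Rightarrow> real \<Rightarrow> complex" where
  "cf2 \<alpha> a b \<theta> = (\<Prod>k=1..a. cf \<alpha> k \<theta>) * (\<Prod>k=1..b. cf \<alpha> k \<theta>)"

text \<open>The reciprocal of the generating function of partitions with parts at most
  \<open>a\<close> at exp (- \<alpha>), equally the probability that none of the parts 1, ...,
  \<open>a\<close> occurs. Ratios of its values are probabilities that a range of parts is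
  absent.\<close>

definition Zinv :: "real \<Rightarrow> nat \<Rightarrow> real" where
  "Zinv \<alpha> a = (\<Prod>k=1..a. 1 - qpow \<alpha> k)"

definition wt :: "real \<Rightarrow> nat \<Rightarrow> nat \<Rightarrow> nat \<Rightarrow> real" where
  "wt \<alpha> a b m = real (num_pairs a b m) * qpow \<alpha> m * Zinv \<alpha> a * Zinv \<alpha> b"

lemma Zinv_pos: "0 < \<alpha> \<Longrightarrow> 0 < Zinv \<alpha> a"
  unfolding Zinv_def by (intro prod_pos) auto

text \<open>The factor (1 - q) / (1 - q * z) of a geometric variable equals 1 / (1 - r * (z - 1))
  with the mean r = q / (1 - q), the form that is expanded later.\<close>

lemma Zinv_cf:
  assumes "0 < \<alpha>"
  shows "complex_of_real (Zinv \<alpha> a) * (\<Prod>k=1..a. 1 / (1 - (complex_of_real (exp (-\<alpha>)) * cis \<theta>) ^ k)) = (\<Prod>k=1..a. cf \<alpha> k \<theta>)"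
  unfolding Zinv_def of_real_prod prod.distrib[symmetric]
proof (rule prod.cong[OF refl])
  fix k assume k: "k \<in> {1..a}"
  define q where "q = qpow \<alpha> k"
  have q: "0 < q" "q < 1" using assms k by (auto simp: q_def)
  have pw: "(complex_of_real (exp (-\<alpha>)) * cis \<theta>) ^ k = of_real q * cis (real k * \<theta>)"
  proof -
    have "exp (-\<alpha>) ^ k = q" unfolding q_def exp_of_nat_mult[symmetric] by (simp add: mult_ac)
    then show ?thesis unfolding power_mult_distrib Complex.DeMoivre of_real_power[symmetric] by simp
  qed
  have o: "occ \<alpha> k = q / (1 - q)"
    unfolding occ_def q_def by (simp add: exp_minus field_simps)
  have "norm (of_real q * cis (real k * \<theta>)) < 1" using q by (simp add: norm_mult)
  then have nz: "1 - of_real q * cis (real k * \<theta>) \<noteq> 0" by auto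
  have nz2: "complex_of_real (1 - q) \<noteq> 0" using q by (simp del: of_real_diff)
  have "1 - complex_of_real (occ \<alpha> k) * (cis (real k * \<theta>) - 1) = (1 - of_real q * cis (real k * \<theta>)) / of_real (1 - q)"
    unfolding o of_real_divide using nz2 by (simp add: field_simps)
  then show "complex_of_real (1 - qpow \<alpha> k) * (1 / (1 - (complex_of_real (exp (-\<alpha>)) * cis \<theta>) ^ k)) = cf \<alpha> k \<theta>"
    unfolding cf_def pw q_def[symmetric] by simp
qed

text \<open>On the unit circle \<open>cf2\<close> is the generating function of the weights
  \<open>wt\<close>, so this is Fourier inversion.\<close>

lemma wt_fourier:
  assumes "0 < \<alpha>"
  shows "complex_of_real (2 * pi * wt \<alpha> a b m) = (LINT \<theta>:{-pi..pi}|lborel. cf2 \<alpha> a b \<theta> * cis (- (real m * \<theta>)))"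
proof -
  define q where "q = exp (- \<alpha>)"
  have q: "0 < q" "q < 1" using assms by (auto simp: q_def)
  have qm: "qpow \<alpha> m = q ^ m" for m
    unfolding q_def exp_of_nat_mult[symmetric] by (simp add: mult_ac)
  define c where "c k = complex_of_real (wt \<alpha> a b k)" for k
  have eq: "c k * cis (real k * \<theta>) = of_real (Zinv \<alpha> a) * of_real (Zinv \<alpha> b) * (of_nat (num_pairs a b k) * (of_real q * cis \<theta>) ^ k)" for k \<theta>
    unfolding c_def wt_def qm power_mult_distrib Complex.DeMoivre of_real_mult of_real_power of_real_of_nat_eq
    by (simp only: mult_ac)
  have sums: "(\<lambda>k. c k * cis (real k * \<theta>)) sums cf2 \<alpha> a b \<theta>" for \<theta>
  proof -
    have "norm (of_real q * cis \<theta>) < 1" using q by (simp add: norm_mult)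
    from sums_mult[OF num_pairs_sums[OF this, of a b], of "of_real (Zinv \<alpha> a) * of_real (Zinv \<alpha> b)"]
    show ?thesis unfolding eq cf2_def Zinv_cf[OF assms, symmetric] q_def[symmetric]
      by (simp add: mult_ac)
  qed
  have "summable (\<lambda>k. norm (c k))"
  proof -
    \<comment> \<open>At \<theta> = 0 the terms are the nonnegative weights themselves, so
      convergence there is absolute convergence.\<close>
    have "summable (\<lambda>k. c k)" using sums_summable[OF sums[of 0]] by simp
    then have "summable (\<lambda>k. Re (c k))" by (rule summable_Re)
    moreover have "0 \<le> wt \<alpha> a b k" for k
      using Zinv_pos[OF assms] by (simp add: wt_def less_imp_le)
    then have "Re (c k) = norm (c k)" for k
      by (simp add: c_def)
    ultimately show ?thesis by simp
  qed
  from fourier_coefficient[OF this, of m] show ?thesis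
    unfolding sums[THEN sums_unique, symmetric] unfolding c_def by simp
qed

lemma wt_nonneg: "0 < \<alpha> \<Longrightarrow> 0 \<le> wt \<alpha> a b m"
  by (simp add: wt_def Zinv_pos less_imp_le)

section \<open>Estimates for geometric multiplicities\<close>

lemma half_le_sin:
  fixes x :: real
  assumes "0 \<le> x" "x \<le> pi / 2"
  shows "x / 2 \<le> sin x"
proof -
  have "\<bar>sin x - (\<Sum>m<3. sin_coeff m * x ^ m)\<bar> \<le> inverse (fact 3) * \<bar>x\<bar> ^ 3"
    by (rule Maclaurin_sin_bound)
  also have "(\<Sum>m<3. sin_coeff m * x ^ m) = x"
    by (simp add: eval_nat_numeral sin_coeff_def)
  finally have "\<bar>sin x - x\<bar> \<le> x ^ 3 / 6" using assms by (simp add: eval_nat_numeral fact_numeral)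
  then have "x - x ^ 3 / 6 \<le> sin x" by linarith
  moreover have "x ^ 3 / 6 \<le> x / 2"
  proof -
    \<comment> \<open>1.6 exceeds pi / 2, and its square is below 3.\<close>
    have "x \<le> 1.6" using assms pi_approx by simp
    then have "x * x \<le> 1.6 * 1.6" using assms by (intro mult_mono) auto
    then have "x * (x * x) \<le> x * 3" using assms by (intro mult_left_mono) auto
    then show ?thesis by (simp add: power3_eq_cube)
  qed
  ultimately show ?thesis by simp
qed

lemma one_minus_cos_ge:
  fixes x :: real
  assumes "\<bar>x\<bar> \<le> 2"
  shows "x\<^sup>2 / 8 \<le> 1 - cos x"
proof -
  have "\<bar>x\<bar> / 2 / 2 \<le> sin (\<bar>x\<bar> / 2)" using assms pi_approx by (intro half_le_sin) auto
  then have "(\<bar>x\<bar> / 4)\<^sup>2 \<le> (sin (\<bar>x\<bar> / 2))\<^sup>2" by (intro power_mono) auto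
  moreover have "cos (2 * (\<bar>x\<bar> / 2)) = 1 - 2 * (sin (\<bar>x\<bar> / 2))\<^sup>2" by (rule cos_double_sin)
  ultimately show ?thesis by (simp add: power_divide)
qed

text \<open>This is y \<le> 2 * sinh (y / 2), multiplied by exp (y / 2).\<close>

lemma mult_exp_half_le:
  fixes y :: real
  assumes "0 \<le> y"
  shows "y * exp (y / 2) \<le> exp y - 1"
proof -
  have "exp 0 - exp (- 0) - 2 * 0 \<le> exp (y/2) - exp (- (y/2)) - 2 * (y/2)"
  proof (rule DERIV_nonneg_imp_nondecreasing[of 0 "y/2" "\<lambda>x. exp x - exp (- x) - 2 * x"])
    fix x :: real
    have "((\<lambda>x. exp x - exp (- x) - 2 * x) has_real_derivative exp x + exp (- x) - 2) (at x)"
      by (auto intro!: derivative_eq_intros)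
    moreover have "0 \<le> exp x + exp (- x) - 2"
    proof -
      have "0 \<le> (exp (x/2) - exp (-(x/2)))\<^sup>2" by simp
      also have "\<dots> = exp x + exp (- x) - 2"
        by (simp add: power2_diff flip: exp_add exp_double)
      finally show ?thesis .
    qed
    ultimately show "\<exists>y. ((\<lambda>x. exp x - exp (- x) - 2 * x) has_real_derivative y) (at x) \<and> 0 \<le> y" by blast
  qed (use assms in auto)
  then have "y \<le> exp (y/2) - exp (- (y/2))" by simp
  then have "y * exp (y/2) \<le> (exp (y/2) - exp (- (y/2))) * exp (y/2)" by (rule mult_right_mono) simp
  also have "\<dots> = exp y - 1" by (simp add: left_diff_distrib flip: exp_add)
  finally show ?thesis .
qed

lemma occ_nonneg: "0 < \<alpha> \<Longrightarrow> 0 \<le> occ \<alpha> k"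
  by (simp add: occ_def)

lemma occ_0 [simp]: "occ \<alpha> 0 = 0"
  by (simp add: occ_def)

text \<open>One bound for both regimes: \<open>occ\<close> is at most 1 / (\<alpha> * k) for small
  \<alpha> * k and decays exponentially for large \<alpha> * k. The moment bounds for single parts
  start from it.\<close>

lemma occ_le:
  assumes "0 < \<alpha>"
  shows "occ \<alpha> k * (\<alpha> * real k) \<le> exp (- (\<alpha> * real k / 2))"
proof (cases "k = 0")
  case False
  define y where "y = \<alpha> * real k"
  have y: "0 < y" using assms False by (simp add: y_def)
  then have "1 < exp y" by simp
  have "y * exp (y / 2) \<le> exp y - 1" using y by (intro mult_exp_half_le) auto
  then have "y \<le> (exp y - 1) * exp (- (y/2))"
    by (simp add: exp_minus field_simps)
  then show ?thesis using \<open>1 < exp y\<close> unfolding occ_def y_def[symmetric] by (simp add: field_simps)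
qed simp

text \<open>r + r^2 is the variance of a geometric variable with mean r, so the decay of its
  characteristic function can be read off without expansion.\<close>

lemma cmod_geometric_denominator:
  "(cmod (1 - complex_of_real r * (cis \<tau> - 1)))\<^sup>2 = 1 + 2 * (r + r\<^sup>2) * (1 - cos \<tau>)"
proof -
  have "(cmod (1 - complex_of_real r * (cis \<tau> - 1)))\<^sup>2 = (1 - r * (cos \<tau> - 1))\<^sup>2 + (r * sin \<tau>)\<^sup>2"
    by (simp add: cmod_power2)
  also have "\<dots> = (1 - r * (cos \<tau> - 1))\<^sup>2 + r\<^sup>2 * (1 - (cos \<tau>)\<^sup>2)"
    by (simp add: power_mult_distrib sin_squared_eq)
  also have "\<dots> = 1 + 2 * (r + r\<^sup>2) * (1 - cos \<tau>)"
    by (simp add: power2_eq_square algebra_simps)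
  finally show ?thesis .
qed

lemma one_le_cmod_geometric_denominator:
  assumes "0 \<le> r"
  shows "1 \<le> cmod (1 - complex_of_real r * (cis \<tau> - 1))"
proof -
  have "1\<^sup>2 \<le> (cmod (1 - complex_of_real r * (cis \<tau> - 1)))\<^sup>2"
    unfolding cmod_geometric_denominator using assms by simp
  then show ?thesis by (rule power2_le_imp_le) simp
qed

lemma norm_cf_le_1: "0 < \<alpha> \<Longrightarrow> norm (cf \<alpha> k \<theta>) \<le> 1"
  using one_le_cmod_geometric_denominator[OF occ_nonneg[of \<alpha> k], of "real k * \<theta>"]
  by (auto simp: cf_def norm_divide divide_le_eq_1)

text \<open>The constant \<open>c\<close> is a lower bound for \<open>occ\<close> common to many k.
  The condition \<open>c \<le> 1/4\<close> keeps \<open>y\<close> below 1, where exp (y / 2) \<le> 1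
  + y.\<close>

lemma norm_cf_le_exp:
  assumes "0 < \<alpha>" "0 \<le> c" "c \<le> 1/4" "c \<le> occ \<alpha> k"
  shows "norm (cf \<alpha> k \<theta>) \<le> exp (- (c / 2 * (1 - cos (real k * \<theta>))))"
proof -
  define z where "z = 1 - cos (real k * \<theta>)"
  have z: "0 \<le> z" "z \<le> 2" unfolding z_def using cos_ge_minus_one[of "real k * \<theta>"] by auto
  define y where "y = 2 * c * z"
  have "2 * c * z \<le> 2 * (1/4) * 2" using assms z by (intro mult_mono) auto
  then have y: "0 \<le> y" "y \<le> 1" using assms z by (auto simp: y_def)
  define N where "N = cmod (1 - complex_of_real (occ \<alpha> k) * (cis (real k * \<theta>) - 1))"
  have "exp (y / 2) \<le> 1 + y / 2 + (y / 2)\<^sup>2" using y by (intro exp_bound) auto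
  also have "\<dots> \<le> 1 + y / 2 + y / 2 * 1" unfolding power2_eq_square using y
    by (intro add_mono mult_mono) auto
  also have "\<dots> \<le> 1 + 2 * (occ \<alpha> k + (occ \<alpha> k)\<^sup>2) * z"
  proof -
    have "c \<le> occ \<alpha> k + (occ \<alpha> k)\<^sup>2" using assms(4) by (simp add: add_increasing2)
    then have "c * z \<le> (occ \<alpha> k + (occ \<alpha> k)\<^sup>2) * z" using z by (intro mult_right_mono) auto
    then have "1 + 2 * (c * z) \<le> 1 + 2 * ((occ \<alpha> k + (occ \<alpha> k)\<^sup>2) * z)" by linarith
    moreover have "1 + y / 2 + y / 2 * 1 = 1 + 2 * (c * z)" by (simp add: y_def)
    ultimately show ?thesis by (simp only: mult.assoc)
  qed
  also have "\<dots> = N\<^sup>2" unfolding N_def cmod_geometric_denominator z_def ..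
  finally have "(exp (y / 4))\<^sup>2 \<le> N\<^sup>2" by (simp flip: exp_double)
  then have "exp (y / 4) \<le> N" by (rule power2_le_imp_le) (simp add: N_def)
  then have "1 / N \<le> 1 / exp (y / 4)" by (intro divide_left_mono mult_pos_pos) (auto intro: less_le_trans[OF exp_gt_zero])
  moreover have "y / 4 = c / 2 * z" by (simp add: y_def)
  ultimately have "1 / N \<le> exp (- (c / 2 * z))" by (simp add: exp_minus inverse_eq_divide)
  then show ?thesis
    by (simp add: cf_def norm_divide N_def z_def)
qed

text \<open>The first-order remainder is bounded both quadratically and linearly: the product of the
  two bounds is cubic for every x, large or small.\<close>

lemma cis_approx:
  "norm (cis x - 1) \<le> \<bar>x\<bar>"
  "norm (cis x - 1 - \<i> * x) \<le> x\<^sup>2 / 2" "norm (cis x - 1 - \<i> * x) \<le> 2 * \<bar>x\<bar>"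
  "norm (cis x - 1 - \<i> * x + (complex_of_real x)\<^sup>2 / 2) \<le> \<bar>x\<bar> ^ 3 / 6"
  using iexp_approx1[of x 0] iexp_approx1[of x 1] iexp_approx2[of x 1] iexp_approx1[of x 2]
  by (simp_all add: cis_conv_exp eval_nat_numeral fact_numeral diff_diff_eq algebra_simps)

text \<open>Multiplying the two bounds gives y^3 for the square of the remainder, that is order 3/2
  in y for all y, large or small.\<close>

lemma exp_minus_approx:
  fixes y :: real
  assumes "0 \<le> y"
  shows "\<bar>exp (- y) - (1 - y)\<bar> \<le> y" "\<bar>exp (- y) - (1 - y)\<bar> \<le> y\<^sup>2"
proof -
  have 1: "1 - y \<le> exp (- y)" using exp_ge_add_one_self[of "-y"] by simp
  moreover have "exp (- y) \<le> 1" using assms by simp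
  ultimately show a: "\<bar>exp (- y) - (1 - y)\<bar> \<le> y" by simp
  show "\<bar>exp (- y) - (1 - y)\<bar> \<le> y\<^sup>2"
  proof (cases "y \<le> 1")
    case True
    have "exp (- y) * (1 + y) \<le> exp (- y) * exp y"
      using assms exp_ge_add_one_self[of y] by (intro mult_left_mono) auto
    also have "\<dots> = 1" by (simp flip: exp_add)
    finally have "exp (- y) \<le> 1 / (1 + y)" using assms by (simp add: field_simps)
    also have "\<dots> \<le> 1 - y + y\<^sup>2"
    proof -
      have "1 \<le> (1 - y + y\<^sup>2) * (1 + y)" using assms
        by (simp add: power2_eq_square algebra_simps)
      then show ?thesis using assms by (simp add: pos_divide_le_eq)
    qed
    finally show ?thesis using 1 by simp
  next
    case False
    then have "y * 1 \<le> y * y" by (intro mult_left_mono) auto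
    then show ?thesis using a by (simp add: power2_eq_square)
  qed
qed

text \<open>
  With \<open>w = r * (cis \<tau> - 1)\<close>, both terms agree up to third order in \<open>\<tau>\<close> with \<open>1 + w + w\<^sup>2\<close>, so no
  smallness of \<open>r * \<tau>\<close> is needed.
\<close>
lemma geometric_cf_approx:
  fixes r \<tau> :: real
  assumes r: "0 \<le> r"
  shows "norm (1 / (1 - complex_of_real r * (cis \<tau> - 1)) - cis (r * \<tau>) * exp (- ((r + r\<^sup>2) * \<tau>\<^sup>2 / 2)))
          \<le> 5 * (r + r ^ 3) * \<bar>\<tau>\<bar> ^ 3"
proof -
  define T where "T = \<bar>\<tau>\<bar>"
  have T: "0 \<le> T" by (simp add: T_def)
  define w where "w = complex_of_real r * (cis \<tau> - 1)"
  define E2 where "E2 = cis \<tau> - 1 - \<i> * \<tau>"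
  define E3 where "E3 = cis \<tau> - 1 - \<i> * \<tau> + (complex_of_real \<tau>)\<^sup>2 / 2"
  have E3: "norm E3 \<le> T ^ 3 / 6" unfolding E3_def T_def by (rule cis_approx)
  have E2: "norm E2 \<le> T\<^sup>2 / 2" "norm E2 \<le> 2 * T" unfolding E2_def T_def using cis_approx[of \<tau>] by auto
  have nw: "norm w \<le> r * T" unfolding w_def T_def norm_mult using r cis_approx(1)[of \<tau>]
    by (simp add: mult_left_mono)
  have n1: "1 \<le> norm (1 - w)" unfolding w_def by (rule one_le_cmod_geometric_denominator[OF r])
  then have ne: "1 - w \<noteq> 0" by auto
  \<comment> \<open>The common second-order expansion in \<tau> of the geometric and the Gaussian
    characteristic function; each is compared with it.\<close>
  define M where "M = 1 + \<i> * (r * \<tau>) - complex_of_real (r * \<tau>\<^sup>2 / 2) - complex_of_real (r\<^sup>2 * \<tau>\<^sup>2)"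
  have w1: "w = complex_of_real r * (\<i> * \<tau> + E2)" by (simp add: w_def E2_def)
  have id1: "1 / (1 - w) - M = w ^ 3 / (1 - w) + of_real r * E3 + (of_real r)\<^sup>2 * (2 * \<i> * \<tau> * E2 + E2\<^sup>2)"
  proof -
    have a: "1 / (1 - w) = w ^ 3 / (1 - w) + (1 + w + w\<^sup>2)" using ne
      by (simp add: field_simps power2_eq_square power3_eq_cube)
    have b: "1 + w = 1 + \<i> * (r * \<tau>) - complex_of_real (r * \<tau>\<^sup>2 / 2) + of_real r * E3"
      by (simp add: w_def E3_def algebra_simps)
    have c: "w\<^sup>2 = - complex_of_real (r\<^sup>2 * \<tau>\<^sup>2) + (of_real r)\<^sup>2 * (2 * \<i> * \<tau> * E2 + E2\<^sup>2)"
      unfolding w1 by (simp add: power2_eq_square algebra_simps)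
    show ?thesis unfolding a b c M_def by simp
  qed
  \<comment> \<open>The arithmetic-geometric mean inequality absorbs the mixed term r^2 into r +
    r^3.\<close>
  have r2: "r\<^sup>2 \<le> (r + r ^ 3) / 2"
  proof -
    have "0 \<le> r * (1 - r)\<^sup>2" using r by simp
    then show ?thesis by (simp add: power2_eq_square power3_eq_cube algebra_simps)
  qed
  have b1: "norm (w ^ 3 / (1 - w)) \<le> r ^ 3 * T ^ 3"
  proof -
    have "norm (w ^ 3 / (1 - w)) \<le> norm w ^ 3"
      using n1 by (simp add: norm_divide norm_power divide_le_eq mult_le_cancel_left1)
    also have "\<dots> \<le> (r * T) ^ 3" using nw by (intro power_mono) auto
    finally show ?thesis by (simp add: power_mult_distrib)
  qed
  have b2: "norm (of_real r * E3) \<le> r * T ^ 3 / 6"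
    unfolding norm_mult using r mult_left_mono[OF E3 r] by simp
  have "norm (2 * \<i> * \<tau> * E2 + E2\<^sup>2) \<le> 2 * T * norm E2 + norm E2 * norm E2"
    using norm_triangle_ineq[of "2 * \<i> * \<tau> * E2" "E2\<^sup>2"]
    by (simp add: norm_mult power2_eq_square T_def)
  also have "\<dots> \<le> 2 * T * (T\<^sup>2 / 2) + (T\<^sup>2 / 2) * (2 * T)"
    using E2 T by (intro add_mono mult_mono) auto
  also have "\<dots> = 2 * T ^ 3" by (simp add: power2_eq_square power3_eq_cube)
  finally have "norm ((of_real r)\<^sup>2 * (2 * \<i> * \<tau> * E2 + E2\<^sup>2)) \<le> r\<^sup>2 * (2 * T ^ 3)"
    unfolding norm_mult using r by (simp add: norm_power mult_left_mono)
  then have e1: "norm (1 / (1 - w) - M) \<le> r ^ 3 * T ^ 3 + r * T ^ 3 / 6 + r\<^sup>2 * (2 * T ^ 3)"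
    unfolding id1 using b1 b2 by (intro norm_triangle_le add_mono) auto
  define y where "y = (r + r\<^sup>2) * \<tau>\<^sup>2 / 2"
  have y: "0 \<le> y" using r by (simp add: y_def)
  define d where "d = exp (- y) - (1 - y)"
  define F2 where "F2 = cis (r * \<tau>) - 1 - \<i> * (r * \<tau>) + (complex_of_real (r * \<tau>))\<^sup>2 / 2"
  have F2: "norm F2 \<le> (r * T) ^ 3 / 6" unfolding F2_def
    using cis_approx(4)[of "r * \<tau>"] r by (simp add: abs_mult T_def)
  have id2: "cis (r * \<tau>) * complex_of_real (exp (- y)) - M =
      F2 - of_real y * (cis (r * \<tau>) - 1) + of_real d * cis (r * \<tau>)"
  proof -
    have a: "complex_of_real (exp (- y)) = 1 - of_real y + of_real d" by (simp add: d_def)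
    have b: "M = 1 + \<i> * (r * \<tau>) - (complex_of_real (r * \<tau>))\<^sup>2 / 2 - of_real y"
      unfolding M_def y_def by (simp add: power_mult_distrib field_simps)
    show ?thesis unfolding a b F2_def by (simp add: algebra_simps)
  qed
  have c2: "norm (of_real y * (cis (r * \<tau>) - 1)) \<le> (r\<^sup>2 + r ^ 3) * T ^ 3 / 2"
  proof -
    have "norm (cis (r * \<tau>) - 1) \<le> r * T" using cis_approx(1)[of "r * \<tau>"] r by (simp add: abs_mult T_def)
    then have "norm (of_real y * (cis (r * \<tau>) - 1)) \<le> y * (r * T)"
      unfolding norm_mult using y by (simp add: mult_left_mono)
    also have "y * (r * T) = (r + r\<^sup>2) * T\<^sup>2 / 2 * (r * T)" by (simp add: y_def T_def)
    also have "\<dots> = (r\<^sup>2 + r ^ 3) * T ^ 3 / 2"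
      by (simp add: power2_eq_square power3_eq_cube algebra_simps)
    finally show ?thesis .
  qed
  have c3: "norm (of_real d * cis (r * \<tau>)) \<le> (r + r ^ 3) * T ^ 3"
  proof -
    have "\<bar>d\<bar> * \<bar>d\<bar> \<le> y * y\<^sup>2" using exp_minus_approx[OF y] unfolding d_def[symmetric]
      by (intro mult_mono) (auto simp: y)
    then have "d\<^sup>2 \<le> y * y\<^sup>2" by (simp add: power2_eq_square flip: abs_mult)
    also have "\<dots> = y ^ 3" by (simp add: power2_eq_square power3_eq_cube)
    also have "\<dots> = (r + r\<^sup>2) ^ 3 / 8 * T ^ 6"
      by (simp add: y_def T_def power_divide power_mult_distrib flip: power_mult)
    \<comment> \<open>After division by r^2 this is r * (1 + r)^3 \<le> 8 * (1 + r^2)^2; for r \<le>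
      1 the left side is at most 8, and for larger r it is at most 8 * r^4.\<close>
    also have "(r + r\<^sup>2) ^ 3 / 8 \<le> (r + r ^ 3)\<^sup>2"
    proof -
      have "r * (1 + r) ^ 3 \<le> 8 * (1 + r\<^sup>2)\<^sup>2"
      proof (cases "r \<le> 1")
        case True
        then have "r * (1 + r) ^ 3 \<le> 1 * 2 ^ 3" using r by (intro mult_mono power_mono) auto
        also have "\<dots> \<le> 8 * (1 + r\<^sup>2)\<^sup>2" by simp
        finally show ?thesis .
      next
        case False
        then have "r * (1 + r) ^ 3 \<le> r * (2 * r) ^ 3" using r by (intro mult_mono power_mono) auto
        also have "\<dots> = 8 * (r\<^sup>2)\<^sup>2" by (simp add: eval_nat_numeral)
        also have "\<dots> \<le> 8 * (1 + r\<^sup>2)\<^sup>2" by (intro mult_left_mono power_mono) auto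
        finally show ?thesis .
      qed
      then have "r\<^sup>2 * (r * (1 + r) ^ 3) \<le> r\<^sup>2 * (8 * (1 + r\<^sup>2)\<^sup>2)" by (intro mult_left_mono) auto
      moreover have "r\<^sup>2 * (r * (1 + r) ^ 3) = (r + r\<^sup>2) ^ 3" "r\<^sup>2 * (8 * (1 + r\<^sup>2)\<^sup>2) = 8 * (r + r ^ 3)\<^sup>2"
        by (simp_all add: power2_eq_square power3_eq_cube algebra_simps)
      ultimately show ?thesis by simp
    qed
    then have "(r + r\<^sup>2) ^ 3 / 8 * T ^ 6 \<le> (r + r ^ 3)\<^sup>2 * T ^ 6" by (intro mult_right_mono) (auto simp: T)
    also have "(r + r ^ 3)\<^sup>2 * T ^ 6 = ((r + r ^ 3) * T ^ 3)\<^sup>2"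
      by (simp add: power_mult_distrib flip: power_mult)
    finally have "\<bar>d\<bar>\<^sup>2 \<le> ((r + r ^ 3) * T ^ 3)\<^sup>2" by simp
    then have "\<bar>d\<bar> \<le> (r + r ^ 3) * T ^ 3" by (rule power2_le_imp_le) (use r T in simp)
    then show ?thesis by (simp add: norm_mult)
  qed
  have e2: "norm (cis (r * \<tau>) * complex_of_real (exp (- y)) - M) \<le>
      (r * T) ^ 3 / 6 + (r\<^sup>2 + r ^ 3) * T ^ 3 / 2 + (r + r ^ 3) * T ^ 3"
    unfolding id2 using F2 c2 c3
    by (intro norm_triangle_le[of _ _ "_ + _ + _"] norm_triangle_le_diff add_mono) auto
  have "norm (1 / (1 - w) - cis (r * \<tau>) * complex_of_real (exp (- y))) \<le>
     (r ^ 3 * T ^ 3 + r * T ^ 3 / 6 + r\<^sup>2 * (2 * T ^ 3)) +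
     ((r * T) ^ 3 / 6 + (r\<^sup>2 + r ^ 3) * T ^ 3 / 2 + (r + r ^ 3) * T ^ 3)"
    using norm_triangle_ineq4[of "1 / (1 - w) - M" "cis (r * \<tau>) * complex_of_real (exp (- y)) - M"] e1 e2
    by simp
  also have "\<dots> = (r ^ 3 + r / 6 + r\<^sup>2 * 2 + r ^ 3 / 6 + (r\<^sup>2 + r ^ 3) / 2 + (r + r ^ 3)) * T ^ 3"
    by (simp add: power_mult_distrib algebra_simps)
  also have "\<dots> \<le> (5 * (r + r ^ 3)) * T ^ 3"
  proof (intro mult_right_mono)
    have lin: "z + r / 6 + x * 2 + z / 6 + (x + z) / 2 + (r + z) \<le> 5 * (r + z)"
      if "0 \<le> z" "x \<le> (r + z) / 2" for x z
      using that r by (simp add: field_simps)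
    show "r ^ 3 + r / 6 + r\<^sup>2 * 2 + r ^ 3 / 6 + (r\<^sup>2 + r ^ 3) / 2 + (r + r ^ 3) \<le> 5 * (r + r ^ 3)"
      by (rule lin) (use r r2 in auto)
  qed (simp add: T)
  finally show ?thesis by (simp add: w_def y_def T_def)
qed

section \<open>Moments of the size in the Boltzmann model\<close>

lemma sum_exp_le:
  fixes c :: real
  assumes "0 < c"
  shows "(\<Sum>k\<in>{a<..b}. exp (- (c * real k))) \<le> exp (- (c * real a)) / c"
proof (cases "a \<le> b")
  case True
  have "c * (\<Sum>k\<in>{a<..b}. exp (- (c * real k))) \<le> exp (- (c * real a)) - exp (- (c * real b))"
    using True
  proof (induction b rule: dec_induct)
    case (step b)
    have "{a<..Suc b} = insert (Suc b) {a<..b}" using step by auto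
    moreover have "c * exp (- (c * real (Suc b))) \<le> exp (- (c * real b)) - exp (- (c * real (Suc b)))"
    proof -
      have "exp (- (c * real b)) = exp c * exp (- (c * real (Suc b)))" by (simp add: algebra_simps flip: exp_add)
      moreover have "(1 + c) * exp (- (c * real (Suc b))) \<le> exp c * exp (- (c * real (Suc b)))"
        by (intro mult_right_mono exp_ge_add_one_self) auto
      ultimately show ?thesis by (simp add: algebra_simps)
    qed
    ultimately show ?case using step by (simp add: algebra_simps)
  qed simp
  also have "\<dots> \<le> exp (- (c * real a))" by simp
  finally show ?thesis using assms by (simp add: field_simps)
qed (use assms in simp)

definition mean_upto :: "real \<Rightarrow> nat \<Rightarrow> real" where
  "mean_upto \<alpha> a = (\<Sum>k=1..a. real k * occ \<alpha> k)"

text \<open>The variance of \<open>k\<close> times a geometric variable with mean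
  \<open>occ \<alpha> k\<close>.\<close>

definition var_term :: "real \<Rightarrow> nat \<Rightarrow> real" where
  "var_term \<alpha> k = (real k)\<^sup>2 * (occ \<alpha> k + (occ \<alpha> k)\<^sup>2)"

definition var_upto :: "real \<Rightarrow> nat \<Rightarrow> real" where
  "var_upto \<alpha> a = (\<Sum>k=1..a. var_term \<alpha> k)"

text \<open>The standard deviation without any bound on the parts; it is used as a scale for all bounds \<open>a, b\<close>.\<close>
definition sdev :: "real \<Rightarrow> real" where
  "sdev \<alpha> = sqrt (2 * (\<Sum>k. var_term \<alpha> k))"

lemma le_exp: "0 \<le> x \<Longrightarrow> x \<le> exp (x::real)"
  using exp_ge_add_one_self[of x] by linarith

text \<open>With y = \<alpha> * k, \<open>occ_le\<close> leaves y^2 * exp (- y / 2) for the linear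
  term: half of the exponential absorbs y^2 at the cost of 64, the other half remains. The cubic
  term is at most exp (- 3 * y / 2) and adds 1.\<close>

lemma third_moment_term:
  assumes "0 < \<alpha>"
  shows "(occ \<alpha> k + occ \<alpha> k ^ 3) * real k ^ 3 \<le> 65 / \<alpha> ^ 3 * exp (- (\<alpha> / 4 * real k))"
proof -
  define y where "y = \<alpha> * real k"
  define o' where "o' = occ \<alpha> k"
  have y: "0 \<le> y" using assms by (simp add: y_def)
  have o: "0 \<le> o'" using assms by (simp add: o'_def occ_nonneg)
  have 1: "o' * y \<le> exp (- (y / 2))" using occ_le[OF assms, of k] by (simp add: o'_def y_def)
  have e4: "exp (- (y / 2)) = exp (- (y / 4)) * exp (- (y / 4))" by (simp flip: exp_add)
  have e8: "exp (- (y / 4)) = exp (- (y / 8)) * exp (- (y / 8))" by (simp flip: exp_add)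
  have "y / 8 * exp (- (y / 8)) \<le> exp (y / 8) * exp (- (y / 8))"
    using le_exp[of "y / 8"] y by (intro mult_right_mono) auto
  then have ye: "y * exp (- (y / 8)) \<le> 8" by (simp flip: exp_add)
  have "o' * y ^ 3 = (o' * y) * (y * y)" by (simp add: power3_eq_cube)
  also have "\<dots> \<le> exp (- (y / 2)) * (y * y)" using 1 y by (intro mult_right_mono) auto
  also have "\<dots> = (y * exp (- (y / 8))) * (y * exp (- (y / 8))) * exp (- (y / 4))"
    unfolding e4 by (subst (2) e8) (simp add: mult_ac)
  also have "\<dots> \<le> 8 * 8 * exp (- (y / 4))" using ye y by (intro mult_mono) auto
  finally have A: "o' * y ^ 3 \<le> 64 * exp (- (y / 4))" by simp
  have "o' ^ 3 * y ^ 3 = (o' * y) ^ 3" by (simp add: power_mult_distrib)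
  also have "\<dots> \<le> exp (- (y / 2)) ^ 3" using 1 o y by (intro power_mono) auto
  also have "\<dots> = exp (3 * - (y / 2))" using exp_of_nat_mult[of 3 "- (y / 2)"] by simp
  also have "\<dots> \<le> exp (- (y / 4))" using y by simp
  finally have "(o' + o' ^ 3) * y ^ 3 \<le> 65 * exp (- (y / 4))" using A by (simp add: algebra_simps)
  then have "(o' + o' ^ 3) * real k ^ 3 * \<alpha> ^ 3 \<le> 65 * exp (- (\<alpha> / 4 * real k))"
    by (simp add: y_def power_mult_distrib mult_ac)
  then show ?thesis using assms unfolding o'_def by (simp add: field_simps)
qed

text \<open>This serves as Lyapunov's condition: \<alpha>^(-4) is small against \<alpha>^(-9/2), the
  order of the cubed standard deviation.\<close>

lemma third_moment_sum:
  assumes "0 < \<alpha>"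
  shows "(\<Sum>k=1..a. (occ \<alpha> k + occ \<alpha> k ^ 3) * real k ^ 3) \<le> 260 / \<alpha> ^ 4"
proof -
  have "(\<Sum>k=1..a. (occ \<alpha> k + occ \<alpha> k ^ 3) * real k ^ 3) \<le> (\<Sum>k\<in>{0<..a}. 65 / \<alpha> ^ 3 * exp (- (\<alpha> / 4 * real k)))"
    unfolding atLeastSucAtMost_greaterThanAtMost[symmetric] One_nat_def
    by (intro sum_mono third_moment_term assms)
  also have "\<dots> \<le> 65 / \<alpha> ^ 3 * (exp (- (\<alpha> / 4 * real 0)) / (\<alpha> / 4))"
    unfolding sum_distrib_left[symmetric] using assms by (intro mult_left_mono sum_exp_le) auto
  also have "\<dots> = 260 / \<alpha> ^ 4" using assms by (simp add: eval_nat_numeral)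
  finally show ?thesis .
qed

lemma var_term_nonneg: "0 < \<alpha> \<Longrightarrow> 0 \<le> var_term \<alpha> k"
  by (simp add: var_term_def occ_nonneg)

lemma var_term_0 [simp]: "var_term \<alpha> 0 = 0"
  by (simp add: var_term_def)

lemma var_term_le:
  assumes "0 < \<alpha>"
  shows "var_term \<alpha> k \<le> 5 / \<alpha>\<^sup>2 * exp (- (\<alpha> / 4 * real k))"
proof -
  define y where "y = \<alpha> * real k"
  define o' where "o' = occ \<alpha> k"
  have y: "0 \<le> y" using assms by (simp add: y_def)
  have o: "0 \<le> o'" using assms by (simp add: o'_def occ_nonneg)
  have 1: "o' * y \<le> exp (- (y / 2))" using occ_le[OF assms, of k] by (simp add: o'_def y_def)
  have e4: "exp (- (y / 2)) = exp (- (y / 4)) * exp (- (y / 4))" by (simp flip: exp_add)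
  have "y / 4 * exp (- (y / 4)) \<le> exp (y / 4) * exp (- (y / 4))"
    using le_exp[of "y / 4"] y by (intro mult_right_mono) auto
  then have ye: "y * exp (- (y / 4)) \<le> 4" by (simp flip: exp_add)
  have "o' * y\<^sup>2 = (o' * y) * y" by (simp add: power2_eq_square)
  also have "\<dots> \<le> exp (- (y / 2)) * y" using 1 y by (intro mult_right_mono) auto
  also have "\<dots> = (y * exp (- (y / 4))) * exp (- (y / 4))" unfolding e4 by simp
  also have "\<dots> \<le> 4 * exp (- (y / 4))" using ye by (intro mult_right_mono) auto
  finally have A: "o' * y\<^sup>2 \<le> 4 * exp (- (y / 4))" .
  have "o'\<^sup>2 * y\<^sup>2 = (o' * y)\<^sup>2" by (simp add: power_mult_distrib)
  also have "\<dots> \<le> (exp (- (y / 2)))\<^sup>2" using 1 o y by (intro power_mono) auto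
  also have "\<dots> = exp (2 * - (y / 2))" using exp_of_nat_mult[of 2 "- (y / 2)"] by simp
  also have "\<dots> \<le> exp (- (y / 4))" using y by simp
  finally have "(o' + o'\<^sup>2) * y\<^sup>2 \<le> 5 * exp (- (y / 4))" using A by (simp add: algebra_simps)
  then have "(o' + o'\<^sup>2) * (real k)\<^sup>2 * \<alpha>\<^sup>2 \<le> 5 * exp (- (\<alpha> / 4 * real k))"
    by (simp add: y_def power_mult_distrib mult_ac)
  then show ?thesis using assms unfolding o'_def var_term_def by (simp add: field_simps)
qed

text \<open>The variance has order \<alpha>^(-3), and a truncation at \<open>a\<close> loses an
  exponentially small fraction of it once \<alpha> * a is large. Hence the single scale
  \<open>sdev \<alpha>\<close> serves all bounds on the parts.\<close>

lemma var_upto_le: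
  assumes "0 < \<alpha>" "a \<le> b"
  shows "var_upto \<alpha> b \<le> var_upto \<alpha> a + 20 / \<alpha> ^ 3 * exp (- (\<alpha> / 4 * real a))"
proof -
  have "{1..b} = {1..a} \<union> {a<..b}" using assms by auto
  then have "var_upto \<alpha> b = var_upto \<alpha> a + (\<Sum>k\<in>{a<..b}. var_term \<alpha> k)"
    unfolding var_upto_def by (simp only:) (rule sum.union_disjoint, auto)
  also have "(\<Sum>k\<in>{a<..b}. var_term \<alpha> k) \<le> (\<Sum>k\<in>{a<..b}. 5 / \<alpha>\<^sup>2 * exp (- (\<alpha> / 4 * real k)))"
    by (intro sum_mono var_term_le assms)
  also have "\<dots> \<le> 5 / \<alpha>\<^sup>2 * (exp (- (\<alpha> / 4 * real a)) / (\<alpha> / 4))"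
    unfolding sum_distrib_left[symmetric] using assms by (intro mult_left_mono sum_exp_le) auto
  also have "\<dots> = 20 / \<alpha> ^ 3 * exp (- (\<alpha> / 4 * real a))"
    using assms by (simp add: eval_nat_numeral)
  finally show ?thesis by simp
qed

lemma sum_lessThan_eq_upto: "(\<Sum>k<Suc n. var_term \<alpha> k) = var_upto \<alpha> n"
  unfolding var_upto_def lessThan_Suc_atMost by (simp add: sum.atMost_shift sum.atLeast1_atMost_eq lessThan_Suc_atMost atLeast0AtMost)

lemma summable_var_term:
  assumes "0 < \<alpha>"
  shows "summable (var_term \<alpha>)"
proof (rule summableI_nonneg_bounded)
  show "(\<Sum>k<n. var_term \<alpha> k) \<le> 20 / \<alpha> ^ 3" for n
  proof (cases n)
    case (Suc m)
    then show ?thesis using var_upto_le[OF assms, of 0 m] unfolding Suc sum_lessThan_eq_upto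
      by (simp add: var_upto_def)
  qed (use assms in simp)
qed (use assms in \<open>simp add: var_term_nonneg\<close>)

lemma var_upto_le_suminf:
  assumes "0 < \<alpha>" shows "var_upto \<alpha> a \<le> (\<Sum>k. var_term \<alpha> k)"
  unfolding sum_lessThan_eq_upto[symmetric]
  by (intro sum_le_suminf summable_var_term) (use assms in \<open>auto simp: var_term_nonneg\<close>)

lemma suminf_var_le:
  assumes "0 < \<alpha>"
  shows "(\<Sum>k. var_term \<alpha> k) \<le> var_upto \<alpha> a + 20 / \<alpha> ^ 3 * exp (- (\<alpha> / 4 * real a))"
proof (rule suminf_le_const[OF summable_var_term[OF assms]])
  fix n
  have "(\<Sum>k<n. var_term \<alpha> k) \<le> (\<Sum>k<Suc (max n a). var_term \<alpha> k)"
    using assms by (intro sum_mono2) (auto simp: var_term_nonneg)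
  also have "\<dots> \<le> var_upto \<alpha> a + 20 / \<alpha> ^ 3 * exp (- (\<alpha> / 4 * real a))"
    unfolding sum_lessThan_eq_upto using assms by (intro var_upto_le) auto
  finally show "(\<Sum>k<n. var_term \<alpha> k) \<le> var_upto \<alpha> a + 20 / \<alpha> ^ 3 * exp (- (\<alpha> / 4 * real a))" .
qed

text \<open>Indices k of order 1 / \<alpha>, where \<open>occ \<alpha> k\<close> is bounded below by
  a constant. About (c - 1) / \<alpha> of them exist, enough for lower bounds on the variance and
  for the decay of characteristic functions.\<close>

definition window :: "real \<Rightarrow> real \<Rightarrow> nat set" where
  "window \<alpha> c = {nat \<lceil>1 / \<alpha>\<rceil>..<nat \<lfloor>c / \<alpha>\<rfloor> + 1}"

lemma window_mem:
  assumes "0 < \<alpha>" "0 \<le> c" "k \<in> window \<alpha> c"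
  shows "1 \<le> \<alpha> * real k" "\<alpha> * real k \<le> c"
proof -
  have "1 / \<alpha> \<le> real k" using assms by (auto simp: window_def)
  then show "1 \<le> \<alpha> * real k" using assms by (simp add: field_simps)
  have "real k \<le> real (nat \<lfloor>c / \<alpha>\<rfloor>)" using assms(3) by (auto simp: window_def)
  also have "\<dots> \<le> c / \<alpha>" using assms by (intro of_nat_floor) auto
  finally have "real k \<le> c / \<alpha>" .
  then show "\<alpha> * real k \<le> c" using assms by (simp add: field_simps)
qed

lemma card_window:
  assumes "0 < \<alpha>" "1 \<le> c"
  shows "(c - 1) / \<alpha> - 1 \<le> real (card (window \<alpha> c))"
proof -
  have "1 / \<alpha> \<le> c / \<alpha>" using assms by (simp add: divide_right_mono)
  moreover have "0 \<le> 1 / \<alpha>" using assms by simp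
  moreover have "(c - 1) / \<alpha> = c / \<alpha> - 1 / \<alpha>" by (simp add: diff_divide_distrib)
  moreover have "real (card (window \<alpha> c)) \<ge> real (nat \<lfloor>c / \<alpha>\<rfloor> + 1) - real (nat \<lceil>1 / \<alpha>\<rceil>)"
    unfolding window_def card_atLeastLessThan by linarith
  ultimately show ?thesis by linarith
qed

lemma window_subset:
  assumes "0 < \<alpha>" "0 \<le> c" "c \<le> \<alpha> * real a"
  shows "window \<alpha> c \<subseteq> {1..a}"
proof
  fix k assume k: "k \<in> window \<alpha> c"
  from window_mem[OF assms(1,2) k] have "1 \<le> \<alpha> * real k" "\<alpha> * real k \<le> \<alpha> * real a"
    using assms(3) by linarith+
  then have "0 < k" "real k \<le> real a"
    using assms mult_le_cancel_left_pos[of \<alpha> "real k" "real a"] by (auto intro: gr0I)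
  then show "k \<in> {1..a}" by auto
qed

lemma occ_ge:
  assumes "0 < \<alpha>" "0 < k" "\<alpha> * real k \<le> c"
  shows "exp (- c) \<le> occ \<alpha> k"
proof -
  have p: "1 < exp (\<alpha> * real k)" using assms by simp
  have "exp (- c) \<le> qpow \<alpha> k" using assms by simp
  also have "\<dots> = 1 / exp (\<alpha> * real k)" by (simp add: exp_minus inverse_eq_divide)
  also have "\<dots> \<le> occ \<alpha> k" unfolding occ_def using p by (intro divide_left_mono) auto
  finally show ?thesis .
qed

lemma sdev_sq: "0 < \<alpha> \<Longrightarrow> (sdev \<alpha>)\<^sup>2 = 2 * (\<Sum>k. var_term \<alpha> k)"
  unfolding sdev_def by (subst real_sqrt_pow2) (auto intro!: suminf_nonneg summable_var_term simp: var_term_nonneg)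

lemma sdev_upper:
  assumes "0 < \<alpha>" shows "(sdev \<alpha>)\<^sup>2 \<le> 40 / \<alpha> ^ 3"
  using suminf_var_le[OF assms, of 0] by (simp add: sdev_sq[OF assms] var_upto_def)

lemma sdev_lower:
  assumes "0 < \<alpha>" "\<alpha> \<le> 1/2"
  shows "exp (- 2) / \<alpha> ^ 3 \<le> (sdev \<alpha>)\<^sup>2"
proof -
  let ?W = "window \<alpha> 2"
  have "1 / \<alpha>\<^sup>2 * exp (- 2) * (1 / (2 * \<alpha>)) \<le> 1 / \<alpha>\<^sup>2 * exp (- 2) * real (card ?W)"
  proof (intro mult_left_mono)
    \<comment> \<open>For \<alpha> \<le> 1/2 half of 1 / \<alpha> pays for the rounding of the
      window's ends.\<close>
    have "1 \<le> 1 / (2 * \<alpha>)" "1 / \<alpha> = 2 * (1 / (2 * \<alpha>))" using assms by (auto simp: field_simps)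
    moreover have "1 / \<alpha> - 1 \<le> real (card ?W)" using card_window[of \<alpha> 2] assms(1) by simp
      ultimately show "1 / (2 * \<alpha>) \<le> real (card ?W)" by linarith
  qed auto
  also have "\<dots> = (\<Sum>k\<in>?W. 1 / \<alpha>\<^sup>2 * exp (- 2))" by simp
  also have "\<dots> \<le> (\<Sum>k\<in>?W. var_term \<alpha> k)"
  proof (rule sum_mono)
    fix k assume k: "k \<in> ?W"
    from window_mem[OF assms(1) _ k] have k1: "1 \<le> \<alpha> * real k" "\<alpha> * real k \<le> 2" by auto
    then have k0: "0 < k" by (cases k) auto
    have "1 / \<alpha>\<^sup>2 \<le> (real k)\<^sup>2"
    proof -
      have "1 / \<alpha> \<le> real k" using k1 assms by (simp add: field_simps)
      then have "(1 / \<alpha>)\<^sup>2 \<le> (real k)\<^sup>2" using assms by (intro power_mono) auto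
      then show ?thesis by (simp add: power_divide)
    qed
    moreover have "exp (- 2) \<le> occ \<alpha> k + (occ \<alpha> k)\<^sup>2"
      using occ_ge[OF assms(1) k0 k1(2)] by (simp add: add_increasing2)
    ultimately show "1 / \<alpha>\<^sup>2 * exp (- 2) \<le> var_term \<alpha> k"
      unfolding var_term_def by (intro mult_mono) auto
  qed
  also have "\<dots> \<le> var_upto \<alpha> (nat \<lceil>2 / \<alpha>\<rceil>)"
  proof -
    have "2 / \<alpha> \<le> real (nat \<lceil>2 / \<alpha>\<rceil>)" by linarith
    then have "2 \<le> \<alpha> * real (nat \<lceil>2 / \<alpha>\<rceil>)"
      by (simp only: pos_divide_le_eq[OF assms(1)] mult.commute)
    then show ?thesis unfolding var_upto_def using assms
      by (intro sum_mono2 window_subset) (auto simp: var_term_nonneg)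
  qed
  also have "\<dots> \<le> (\<Sum>k. var_term \<alpha> k)" by (rule var_upto_le_suminf[OF assms(1)])
  finally have "2 * (1 / \<alpha>\<^sup>2 * exp (- 2) * (1 / (2 * \<alpha>))) \<le> (sdev \<alpha>)\<^sup>2"
    unfolding sdev_sq[OF assms(1)] by (rule mult_left_mono) simp
  moreover have "exp (- 2) / \<alpha> ^ 3 = 2 * (1 / \<alpha>\<^sup>2 * exp (- 2) * (1 / (2 * \<alpha>)))"
    using assms by (simp add: power2_eq_square power3_eq_cube)
  ultimately show ?thesis by (simp only:)
qed

lemma sdev_pos: "0 < \<alpha> \<Longrightarrow> \<alpha> \<le> 1/2 \<Longrightarrow> 0 < sdev \<alpha>"
proof -
  assume a: "0 < \<alpha>" "\<alpha> \<le> 1/2"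
  have "0 < exp (- 2) / \<alpha> ^ 3" using a by simp
  also have "\<dots> \<le> (sdev \<alpha>)\<^sup>2" by (rule sdev_lower[OF a])
  finally have "sdev \<alpha> \<noteq> 0" by auto
  moreover have "0 \<le> sdev \<alpha>" unfolding sdev_def
    using a by (intro real_sqrt_ge_zero mult_nonneg_nonneg suminf_nonneg summable_var_term) (auto simp: var_term_nonneg)
  ultimately show ?thesis by simp
qed

section \<open>Decay of the characteristic function\<close>

lemma norm_cf2_le_subset:
  assumes "0 < \<alpha>" "S \<subseteq> {1..a}" "0 \<le> c" "c \<le> 1/4" "\<And>k. k \<in> S \<Longrightarrow> c \<le> occ \<alpha> k"
  shows "norm (cf2 \<alpha> a b \<theta>) \<le> exp (- (c / 2 * (\<Sum>k\<in>S. 1 - cos (real k * \<theta>))))"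
proof -
  have fin: "finite S" using assms(2) finite_subset by blast
  have "norm (\<Prod>k=1..b. cf \<alpha> k \<theta>) \<le> 1"
    unfolding prod_norm[symmetric] by (intro prod_le_1) (auto simp: norm_cf_le_1 assms)
  then have "norm (cf2 \<alpha> a b \<theta>) \<le> norm (\<Prod>k=1..a. cf \<alpha> k \<theta>) * 1"
    unfolding cf2_def norm_mult by (intro mult_left_mono) auto
  also have "norm (\<Prod>k=1..a. cf \<alpha> k \<theta>) = (\<Prod>k\<in>{1..a} - S. norm (cf \<alpha> k \<theta>)) * (\<Prod>k\<in>S. norm (cf \<alpha> k \<theta>))"
    unfolding prod_norm[symmetric] using assms(2) by (intro prod.subset_diff) auto
  also have "\<dots> \<le> 1 * (\<Prod>k\<in>S. exp (- (c / 2 * (1 - cos (real k * \<theta>)))))"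
    using assms by (intro mult_mono prod_mono prod_le_1 conjI norm_cf_le_1 norm_cf_le_exp) (auto intro!: prod_nonneg)
  also have "\<dots> = exp (- (c / 2 * (\<Sum>k\<in>S. 1 - cos (real k * \<theta>))))"
    using fin by (simp add: exp_sum[symmetric] sum_negf sum_distrib_left)
  finally show ?thesis by simp
qed

lemma norm_cf2_le_1: "0 < \<alpha> \<Longrightarrow> norm (cf2 \<alpha> a b \<theta>) \<le> 1"
  using norm_cf2_le_subset[of \<alpha> "{}" a 0] by simp

text \<open>exp (- 11) is the lower bound for \<open>occ\<close> on
  \<open>window \<alpha> 11\<close>; 11 is large enough for this window to outweigh the cosine sum
  in \<open>cf2_large\<close>.\<close>

lemma exp_minus_11: "exp (- 11 :: real) \<le> 1/4"
proof -
  have "4 \<le> exp (11::real)" using exp_ge_add_one_self[of 11] by simp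
  then show ?thesis by (simp add: exp_minus inverse_eq_divide divide_le_eq)
qed

text \<open>For k in \<open>window \<alpha> 2\<close> the angle k * \<theta> stays within [-2, 2],
  so each such k contributes at least \<theta>^2 / (8 * \<alpha>^2), and there are at least 1 / (2 *
  \<alpha>) of them.\<close>

lemma cf2_small:
  assumes \<alpha>: "0 < \<alpha>" "\<alpha> \<le> 1/2" and a: "11 \<le> \<alpha> * real a" and \<theta>: "\<bar>\<theta>\<bar> \<le> \<alpha>"
  shows "norm (cf2 \<alpha> a b \<theta>) \<le> exp (- (exp (- 11) / 32 * (\<theta>\<^sup>2 / \<alpha> ^ 3)))"
proof -
  let ?W = "window \<alpha> 2" and ?c = "exp (- 11) :: real"
  have sub: "?W \<subseteq> {1..a}" using \<alpha> a by (intro window_subset) auto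
  have "norm (cf2 \<alpha> a b \<theta>) \<le> exp (- (?c / 2 * (\<Sum>k\<in>?W. 1 - cos (real k * \<theta>))))"
  proof (rule norm_cf2_le_subset[OF \<alpha>(1) sub _ exp_minus_11])
    fix k assume k: "k \<in> ?W"
    have "0 < k" using k sub by auto
    then show "?c \<le> occ \<alpha> k" using window_mem[OF \<alpha>(1) _ k] \<alpha> by (intro occ_ge) auto
  qed simp
  also have "\<dots> \<le> exp (- (?c / 2 * (\<theta>\<^sup>2 / (16 * \<alpha> ^ 3))))"
  proof -
    have "\<theta>\<^sup>2 / (16 * \<alpha> ^ 3) = 1 / (2 * \<alpha>) * (\<theta>\<^sup>2 / (8 * \<alpha>\<^sup>2))"
      by (simp add: power2_eq_square power3_eq_cube)
    also have "\<dots> \<le> real (card ?W) * (\<theta>\<^sup>2 / (8 * \<alpha>\<^sup>2))"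
    proof (intro mult_right_mono)
      have "1 \<le> 1 / (2 * \<alpha>)" "1 / \<alpha> = 2 * (1 / (2 * \<alpha>))" using \<alpha> by (auto simp: field_simps)
      moreover have "1 / \<alpha> - 1 \<le> real (card ?W)" using card_window[of \<alpha> 2] \<alpha>(1) by simp
      ultimately show "1 / (2 * \<alpha>) \<le> real (card ?W)" by linarith
    qed auto
    also have "\<dots> = (\<Sum>k\<in>?W. \<theta>\<^sup>2 / (8 * \<alpha>\<^sup>2))" by simp
    also have "\<dots> \<le> (\<Sum>k\<in>?W. 1 - cos (real k * \<theta>))"
    proof (rule sum_mono)
      fix k assume k: "k \<in> ?W"
      from window_mem[OF \<alpha>(1) _ k] have k1: "1 \<le> \<alpha> * real k" "\<alpha> * real k \<le> 2" by auto
      have "real k * \<bar>\<theta>\<bar> \<le> real k * \<alpha>" using \<theta> by (intro mult_left_mono) auto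
      then have "\<bar>real k * \<theta>\<bar> \<le> 2" using k1 by (simp add: abs_mult mult.commute)
      then have "(real k * \<theta>)\<^sup>2 / 8 \<le> 1 - cos (real k * \<theta>)" by (rule one_minus_cos_ge)
      moreover have "\<theta>\<^sup>2 / (8 * \<alpha>\<^sup>2) \<le> (real k * \<theta>)\<^sup>2 / 8"
      proof -
        have "1 / \<alpha> \<le> real k" using k1 \<alpha> by (simp add: field_simps)
        then have "(1 / \<alpha>)\<^sup>2 \<le> (real k)\<^sup>2" using \<alpha> by (intro power_mono) auto
        then have "(1 / \<alpha>)\<^sup>2 * \<theta>\<^sup>2 \<le> (real k)\<^sup>2 * \<theta>\<^sup>2" by (intro mult_right_mono) auto
        then show ?thesis by (simp add: power_mult_distrib power_divide)
      qed
      ultimately show "\<theta>\<^sup>2 / (8 * \<alpha>\<^sup>2) \<le> 1 - cos (real k * \<theta>)" by linarith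
    qed
    finally have "?c / 2 * (\<theta>\<^sup>2 / (16 * \<alpha> ^ 3)) \<le> ?c / 2 * (\<Sum>k\<in>?W. 1 - cos (real k * \<theta>))"
      by (rule mult_left_mono) simp
    then show ?thesis by (simp only: exp_le_cancel_iff neg_le_iff_le)
  qed
  finally show ?thesis by (simp add: field_simps)
qed

text \<open>As for the Dirichlet kernel, the cosine sum telescopes after multiplication by 2 * sin
  (\<theta> / 2).\<close>

lemma sum_cos_le:
  assumes "m \<le> n"
  shows "\<bar>sin (\<theta> / 2)\<bar> * \<bar>\<Sum>k\<in>{m..<n}. cos (real k * \<theta>)\<bar> \<le> 1"
proof -
  let ?s = "\<lambda>k. sin ((real k - 1/2) * \<theta>)"
  have "2 * sin (\<theta> / 2) * cos (real k * \<theta>) = ?s (Suc k) - ?s k" for k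
  proof -
    have e: "(real (Suc k) - 1/2) * \<theta> = real k * \<theta> + \<theta> / 2" "(real k - 1/2) * \<theta> = real k * \<theta> - \<theta> / 2"
      by (simp_all add: field_simps)
    show ?thesis unfolding e sin_add sin_diff by simp
  qed
  then have "2 * sin (\<theta> / 2) * (\<Sum>k\<in>{m..<n}. cos (real k * \<theta>)) = (\<Sum>k\<in>{m..<n}. ?s (Suc k) - ?s k)"
    by (simp add: sum_distrib_left)
  also have "\<dots> = ?s n - ?s m" by (rule sum_Suc_diff'[OF assms])
  finally have "\<bar>2 * sin (\<theta> / 2) * (\<Sum>k\<in>{m..<n}. cos (real k * \<theta>))\<bar> = \<bar>?s n - ?s m\<bar>" by simp
  also have "\<dots> \<le> 1 + 1" by (rule order_trans[OF abs_triangle_ineq4 add_mono]) auto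
  finally show ?thesis by (simp add: abs_mult)
qed

text \<open>For \<theta> beyond \<alpha> the cosines over the window sum to at most 1 / \<bar>sin
  (\<theta> / 2)\<bar> \<le> 4 / \<alpha>, while the window has at least 10 / \<alpha> - 1 elements.
  The surplus makes the product exponentially small in 1 / \<alpha>.\<close>

lemma cf2_large:
  assumes \<alpha>: "0 < \<alpha>" "\<alpha> \<le> 1/2" and a: "11 \<le> \<alpha> * real a" and \<theta>: "\<alpha> \<le> \<bar>\<theta>\<bar>" "\<bar>\<theta>\<bar> \<le> pi"
  shows "norm (cf2 \<alpha> a b \<theta>) \<le> exp (- (exp (- 11) / \<alpha>))"
proof -
  let ?W = "window \<alpha> 11" and ?c = "exp (- 11) :: real"
  have sub: "?W \<subseteq> {1..a}" using \<alpha> a by (intro window_subset) auto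
  have "norm (cf2 \<alpha> a b \<theta>) \<le> exp (- (?c / 2 * (\<Sum>k\<in>?W. 1 - cos (real k * \<theta>))))"
  proof (rule norm_cf2_le_subset[OF \<alpha>(1) sub _ exp_minus_11])
    fix k assume k: "k \<in> ?W"
    have "0 < k" using k sub by auto
    then show "?c \<le> occ \<alpha> k" using window_mem[OF \<alpha>(1) _ k] \<alpha> by (intro occ_ge) auto
  qed simp
  also have "\<dots> \<le> exp (- (?c / 2 * (2 / \<alpha>)))"
  proof -
    have s: "\<alpha> / 4 \<le> \<bar>sin (\<theta> / 2)\<bar>"
    proof -
      have "\<bar>\<theta>\<bar> / 2 / 2 \<le> sin (\<bar>\<theta>\<bar> / 2)" using \<theta> by (intro half_le_sin) auto
      also have "\<dots> \<le> \<bar>sin (\<theta> / 2)\<bar>" by (cases "0 \<le> \<theta>") auto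
      finally show ?thesis using \<theta> by linarith
    qed
    have mn: "nat \<lceil>1 / \<alpha>\<rceil> \<le> nat \<lfloor>11 / \<alpha>\<rfloor> + 1"
    proof -
      have "1 / \<alpha> \<le> 11 / \<alpha>" using \<alpha> by (simp add: divide_right_mono)
      then show ?thesis by linarith
    qed
    define C where "C = \<bar>\<Sum>k\<in>?W. cos (real k * \<theta>)\<bar>"
    have "\<alpha> / 4 * C \<le> \<bar>sin (\<theta> / 2)\<bar> * C" using s by (intro mult_right_mono) (auto simp: C_def)
    also have "\<dots> \<le> 1" unfolding C_def window_def by (rule sum_cos_le[OF mn])
    finally have "C \<le> 4 / \<alpha>" using \<alpha> by (simp add: field_simps)
    moreover have "10 / \<alpha> - 1 \<le> real (card ?W)" using card_window[of \<alpha> 11] \<alpha> by simp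
    moreover have "1 \<le> 1 / \<alpha>" using \<alpha> by simp
    moreover have "(\<Sum>k\<in>?W. 1 - cos (real k * \<theta>)) = real (card ?W) - (\<Sum>k\<in>?W. cos (real k * \<theta>))"
      by (simp add: sum_subtractf)
    moreover have "10 / \<alpha> = 10 * (1 / \<alpha>)" "4 / \<alpha> = 4 * (1 / \<alpha>)" "2 / \<alpha> = 2 * (1 / \<alpha>)" by auto
    ultimately have "2 / \<alpha> \<le> (\<Sum>k\<in>?W. 1 - cos (real k * \<theta>))"
      unfolding C_def by linarith
    then have "?c / 2 * (2 / \<alpha>) \<le> ?c / 2 * (\<Sum>k\<in>?W. 1 - cos (real k * \<theta>))" by (rule mult_left_mono) simp
    then show ?thesis by (simp only: exp_le_cancel_iff neg_le_iff_le)
  qed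
  finally show ?thesis by simp
qed

section \<open>A local limit theorem for the Boltzmann model\<close>

text \<open>The centred factors and the Gaussian factors have modulus at most 1, so replacing them
  one by one lets the errors add up. The constant is 2 * 5 * 260, from two sides,
  \<open>geometric_cf_approx\<close> and \<open>third_moment_sum\<close>.\<close>

lemma cf2_gaussian_approx:
  assumes "0 < \<alpha>"
  shows "norm (cf2 \<alpha> a b \<theta> * cis (- ((mean_upto \<alpha> a + mean_upto \<alpha> b) * \<theta>))
            - of_real (exp (- ((var_upto \<alpha> a + var_upto \<alpha> b) * \<theta>\<^sup>2 / 2))))
          \<le> 2600 / \<alpha> ^ 4 * \<bar>\<theta>\<bar> ^ 3"
proof -
  define z where "z k = cf \<alpha> k \<theta> * cis (- (real k * occ \<alpha> k * \<theta>))" for k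
  define w where "w k = complex_of_real (exp (- (var_term \<alpha> k * \<theta>\<^sup>2 / 2)))" for k
  have nz: "norm (z k) \<le> 1" for k using norm_cf_le_1[OF assms] by (simp add: z_def norm_mult)
  have nw: "norm (w k) \<le> 1" for k using var_term_nonneg[OF assms] by (simp add: w_def)
  have zw: "norm (z k - w k) \<le> 5 * \<bar>\<theta>\<bar> ^ 3 * ((occ \<alpha> k + occ \<alpha> k ^ 3) * real k ^ 3)" for k
  proof -
    define c where "c = cis (occ \<alpha> k * (real k * \<theta>))"
    have "z k * c = cf \<alpha> k \<theta>" by (simp add: z_def c_def mult.assoc cis_mult)
    then have eq: "norm (z k - w k) = norm (cf \<alpha> k \<theta> - c * w k)"
      using norm_mult[of "z k - w k" c] by (simp add: c_def left_diff_distrib mult.commute)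
    have w: "w k = exp (- ((occ \<alpha> k + (occ \<alpha> k)\<^sup>2) * (real k * \<theta>)\<^sup>2 / 2))"
      by (simp add: w_def var_term_def power_mult_distrib mult_ac)
    have "norm (cf \<alpha> k \<theta> - c * w k) \<le> 5 * (occ \<alpha> k + occ \<alpha> k ^ 3) * \<bar>real k * \<theta>\<bar> ^ 3"
      unfolding cf_def c_def w by (rule geometric_cf_approx[OF occ_nonneg[OF assms]])
    also have "\<dots> = 5 * \<bar>\<theta>\<bar> ^ 3 * ((occ \<alpha> k + occ \<alpha> k ^ 3) * real k ^ 3)"
      by (simp add: abs_mult power_mult_distrib)
    finally show ?thesis using eq by simp
  qed
  have one: "norm ((\<Prod>k=1..a. z k) - (\<Prod>k=1..a. w k)) \<le> 1300 / \<alpha> ^ 4 * \<bar>\<theta>\<bar> ^ 3" for a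
  proof -
    have "norm ((\<Prod>k=1..a. z k) - (\<Prod>k=1..a. w k)) \<le> (\<Sum>k=1..a. norm (z k - w k))"
      by (intro norm_prod_diff nz nw)
    also have "\<dots> \<le> (\<Sum>k=1..a. 5 * \<bar>\<theta>\<bar> ^ 3 * ((occ \<alpha> k + occ \<alpha> k ^ 3) * real k ^ 3))"
      by (intro sum_mono zw)
    also have "\<dots> \<le> 5 * \<bar>\<theta>\<bar> ^ 3 * (260 / \<alpha> ^ 4)"
      unfolding sum_distrib_left[symmetric] by (intro mult_left_mono third_moment_sum assms) auto
    finally show ?thesis by (simp add: field_simps)
  qed
  have cm: "cis (- (mean_upto \<alpha> a * \<theta>)) = (\<Prod>k=1..a. cis (- (real k * occ \<alpha> k * \<theta>)))" for a
    by (simp add: mean_upto_def cis_conv_exp exp_sum[symmetric] sum_distrib_left sum_distrib_right sum_negf)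
  have cv: "complex_of_real (exp (- (var_upto \<alpha> a * \<theta>\<^sup>2 / 2))) = (\<Prod>k=1..a. w k)" for a
    by (simp add: w_def var_upto_def exp_sum[symmetric] sum_distrib_right sum_divide_distrib sum_negf flip: of_real_prod)
  have 1: "cf2 \<alpha> a b \<theta> * cis (- ((mean_upto \<alpha> a + mean_upto \<alpha> b) * \<theta>)) = (\<Prod>k=1..a. z k) * (\<Prod>k=1..b. z k)"
  proof -
    have "cis (- ((mean_upto \<alpha> a + mean_upto \<alpha> b) * \<theta>)) = cis (- (mean_upto \<alpha> a * \<theta>)) * cis (- (mean_upto \<alpha> b * \<theta>))"
      by (simp add: cis_mult algebra_simps)
    then show ?thesis unfolding cm cf2_def z_def prod.distrib by (simp only: mult_ac)
  qed
  have 2: "complex_of_real (exp (- ((var_upto \<alpha> a + var_upto \<alpha> b) * \<theta>\<^sup>2 / 2))) = (\<Prod>k=1..a. w k) * (\<Prod>k=1..b. w k)"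
    unfolding cv[symmetric] of_real_mult[symmetric] by (simp add: algebra_simps add_divide_distrib flip: exp_add)
  have "norm ((\<Prod>k=1..a. z k) * (\<Prod>k=1..b. z k) - (\<Prod>k=1..a. w k) * (\<Prod>k=1..b. w k))
      = norm (((\<Prod>k=1..a. z k) - (\<Prod>k=1..a. w k)) * (\<Prod>k=1..b. z k) + (\<Prod>k=1..a. w k) * ((\<Prod>k=1..b. z k) - (\<Prod>k=1..b. w k)))"
    by (simp add: algebra_simps)
  also have "\<dots> \<le> norm ((\<Prod>k=1..a. z k) - (\<Prod>k=1..a. w k)) * 1 + 1 * norm ((\<Prod>k=1..b. z k) - (\<Prod>k=1..b. w k))"
    unfolding norm_mult[symmetric]
  proof (rule order_trans[OF norm_triangle_ineq add_mono])
    have "norm (\<Prod>k=1..b. z k) \<le> 1" "norm (\<Prod>k=1..a. w k) \<le> 1"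
      unfolding prod_norm[symmetric] by (intro prod_le_1 conjI nz nw; simp)+
    then show "norm (((\<Prod>k=1..a. z k) - (\<Prod>k=1..a. w k)) * (\<Prod>k=1..b. z k)) \<le> norm ((\<Prod>k=1..a. z k) - (\<Prod>k=1..a. w k)) * 1"
      "norm ((\<Prod>k=1..a. w k) * ((\<Prod>k=1..b. z k) - (\<Prod>k=1..b. w k))) \<le> 1 * norm ((\<Prod>k=1..b. z k) - (\<Prod>k=1..b. w k))"
      unfolding norm_mult by (intro mult_left_mono mult_right_mono; simp)+
  qed
  also have "\<dots> \<le> 2600 / \<alpha> ^ 4 * \<bar>\<theta>\<bar> ^ 3" using one[of a] one[of b] by simp
  finally show ?thesis unfolding 1 2 .
qed

text \<open>The centred characteristic function in the variable s = \<theta> *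
  \<open>sdev \<alpha>\<close>, set to 0 outside one period so that it can be compared with exp (-
  s^2 / 2) on the whole line.\<close>

definition cf2_rescaled :: "real \<Rightarrow> nat \<Rightarrow> nat \<Rightarrow> real \<Rightarrow> complex" where
  "cf2_rescaled \<alpha> a b s = indicator {- (pi * sdev \<alpha>)..pi * sdev \<alpha>} s *\<^sub>R
     (cf2 \<alpha> a b (s / sdev \<alpha>) * cis (- ((mean_upto \<alpha> a + mean_upto \<alpha> b) * (s / sdev \<alpha>))))"

text \<open>A factor cis (- w * s) does not change this L1 distance, so it bounds the local limit
  error for all sizes at once.\<close>

definition llt_err :: "real \<Rightarrow> nat \<Rightarrow> nat \<Rightarrow> real" where
  "llt_err \<alpha> a b = (LINT s|lborel. norm (cf2_rescaled \<alpha> a b s - of_real (exp (- s\<^sup>2 / 2))))"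

lemma continuous_cf2:
  assumes "0 < \<alpha>" shows "continuous_on A (cf2 \<alpha> a b)"
proof -
  have "1 - complex_of_real (occ \<alpha> k) * (cis (real k * \<theta>) - 1) \<noteq> 0" for k \<theta>
    using one_le_cmod_geometric_denominator[OF occ_nonneg[OF assms, of k], of "real k * \<theta>"] by fastforce
  then show ?thesis unfolding cf2_def cf_def by (intro continuous_intros) auto
qed

lemma measurable_cf2 [measurable]: "0 < \<alpha> \<Longrightarrow> cf2 \<alpha> a b \<in> borel_measurable borel"
  by (intro borel_measurable_continuous_onI continuous_cf2)

lemma measurable_cis [measurable]: "cis \<in> borel_measurable borel"
  by (intro borel_measurable_continuous_onI continuous_intros)

lemma measurable_cf2_rescaled [measurable]: "0 < \<alpha> \<Longrightarrow> cf2_rescaled \<alpha> a b \<in> borel_measurable borel"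
  unfolding cf2_rescaled_def[abs_def] by measurable

text \<open>The sum of the constants for the two ranges of \<theta> in
  \<open>cf2_rescaled_bound\<close>: 1280 = 32 * 40 combines \<open>cf2_small\<close> with
  \<open>sdev_upper\<close>, 27 = 3^3 comes from a cubic lower bound for exp, and 641 = 1 + 4^2 * 40
  from pi < 4 and \<open>sdev_upper\<close>.\<close>

definition llt_const :: real where
  "llt_const = 1280 / exp (- 11) + 641 * 27 / exp (- 11) ^ 3"

text \<open>An integrable majorant common to all \<alpha>, \<open>a\<close> and \<open>b\<close>.
  Near 0 the Gaussian decay of \<open>cf2_small\<close> is weakened to 1 / (1 + d * s^2). For larger
  \<theta> the bound exp (- c / \<alpha>) is O(\<alpha>^3), and s^2 is O(\<alpha>^(-3)) on the whole
  period.\<close>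

lemma cf2_rescaled_bound:
  assumes \<alpha>: "0 < \<alpha>" "\<alpha> \<le> 1/2" and a: "11 \<le> \<alpha> * real a"
  shows "norm (cf2_rescaled \<alpha> a b s) \<le> llt_const * (1 / (1 + s\<^sup>2))"
proof -
  define c :: real where "c = exp (- 11)"
  have c: "0 < c" "c \<le> 1" by (auto simp: c_def)
  have lc: "llt_const = 1280 / c + 641 * 27 / c ^ 3" by (simp add: llt_const_def c_def)
  define \<sigma> where "\<sigma> = sdev \<alpha>"
  have \<sigma>: "0 < \<sigma>" "\<sigma>\<^sup>2 * \<alpha> ^ 3 \<le> 40" using sdev_pos[OF \<alpha>] sdev_upper[OF \<alpha>(1)] \<alpha> by (auto simp: \<sigma>_def field_simps)
  show ?thesis
  proof (cases "\<bar>s\<bar> \<le> pi * \<sigma>")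
    case False
    then have "cf2_rescaled \<alpha> a b s = 0" by (auto simp: cf2_rescaled_def \<sigma>_def indicator_def)
    then show ?thesis using c by (simp add: lc)
  next
    case True
    define \<theta> where "\<theta> = s / \<sigma>"
    have s: "s\<^sup>2 = \<theta>\<^sup>2 * \<sigma>\<^sup>2" "\<bar>\<theta>\<bar> \<le> pi" 
      using \<sigma> True by (simp_all add: \<theta>_def power_divide abs_divide pos_divide_le_eq)
    have n: "norm (cf2_rescaled \<alpha> a b s) \<le> norm (cf2 \<alpha> a b \<theta>)"
      by (auto simp: cf2_rescaled_def \<theta>_def \<sigma>_def norm_mult indicator_def)
    have pos: "0 < 1 + s\<^sup>2" by (simp add: add_pos_nonneg)
    show ?thesis
    proof (cases "\<bar>\<theta>\<bar> \<le> \<alpha>")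
      case True
      define d where "d = c / 1280"
      have d: "0 < d" "d \<le> 1" using c by (auto simp: d_def)
      have "s\<^sup>2 \<le> 40 * (\<theta>\<^sup>2 / \<alpha> ^ 3)"
      proof -
        have "\<theta>\<^sup>2 * (\<sigma>\<^sup>2 * \<alpha> ^ 3) \<le> \<theta>\<^sup>2 * 40" using \<sigma> by (intro mult_left_mono) auto
        then show ?thesis using \<alpha> unfolding s by (simp add: field_simps)
      qed
      then have "d * s\<^sup>2 \<le> d * (40 * (\<theta>\<^sup>2 / \<alpha> ^ 3))" using d by (intro mult_left_mono) auto
      then have "d * s\<^sup>2 \<le> c / 32 * (\<theta>\<^sup>2 / \<alpha> ^ 3)" by (simp add: d_def)
      moreover have "norm (cf2 \<alpha> a b \<theta>) \<le> exp (- (c / 32 * (\<theta>\<^sup>2 / \<alpha> ^ 3)))"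
        unfolding c_def by (rule cf2_small[OF \<alpha> a True])
      ultimately have "norm (cf2 \<alpha> a b \<theta>) \<le> exp (- (d * s\<^sup>2))" by (meson exp_le_cancel_iff neg_le_iff_le order_trans)
      also have "\<dots> = 1 / exp (d * s\<^sup>2)" by (simp add: exp_minus inverse_eq_divide)
      also have "\<dots> \<le> 1 / (1 + d * s\<^sup>2)" using d exp_ge_add_one_self[of "d * s\<^sup>2"]
        by (intro divide_left_mono) (auto intro!: mult_pos_pos add_pos_nonneg)
      also have "\<dots> \<le> 1 / (d * (1 + s\<^sup>2))" using d pos
        by (intro divide_left_mono) (auto intro!: mult_pos_pos add_pos_nonneg simp: algebra_simps)
      also have "\<dots> = 1280 / c * (1 / (1 + s\<^sup>2))" by (simp add: d_def)
      also have "\<dots> \<le> llt_const * (1 / (1 + s\<^sup>2))" using c pos unfolding lc by (intro mult_right_mono) auto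
      finally show ?thesis using n by linarith
    next
      case False
      have x: "0 \<le> c / \<alpha>" using c \<alpha> by simp
      have "c / \<alpha> / 3 \<le> exp (c / \<alpha> / 3)" using x by (intro le_exp) auto
      then have "(c / \<alpha> / 3) ^ 3 \<le> exp (c / \<alpha> / 3) ^ 3" using x by (intro power_mono) auto
      also have "\<dots> = exp (c / \<alpha>)" using exp_of_nat_mult[of 3 "c / \<alpha> / 3"] by simp
      finally have e: "c ^ 3 / (27 * \<alpha> ^ 3) \<le> exp (c / \<alpha>)" by (simp add: power_divide mult.commute)
      have "norm (cf2 \<alpha> a b \<theta>) \<le> exp (- (c / \<alpha>))"
        unfolding c_def using cf2_large[OF \<alpha> a, of \<theta>] False s by auto
      also have "\<dots> = 1 / exp (c / \<alpha>)" by (simp add: exp_minus inverse_eq_divide)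
      also have "\<dots> \<le> 1 / (c ^ 3 / (27 * \<alpha> ^ 3))" using e c \<alpha> by (intro divide_left_mono) auto
      also have "\<dots> = 27 * \<alpha> ^ 3 / c ^ 3" by simp
      also have "\<dots> \<le> 641 * 27 / c ^ 3 * (1 / (1 + s\<^sup>2))"
      proof -
        have "\<theta>\<^sup>2 \<le> 4\<^sup>2" using s(2) pi_less_4 power_mono[of "\<bar>\<theta>\<bar>" 4 2] by simp
        then have "\<theta>\<^sup>2 * (\<sigma>\<^sup>2 * \<alpha> ^ 3) \<le> 4\<^sup>2 * 40" using \<sigma> \<alpha> by (intro mult_mono) auto
        moreover have "\<alpha> ^ 3 \<le> 1" using \<alpha> by (intro power_le_one) auto
        ultimately have "\<alpha> ^ 3 * (1 + s\<^sup>2) \<le> 641" unfolding s by (simp add: algebra_simps)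
        then have "\<alpha> ^ 3 \<le> 641 / (1 + s\<^sup>2)" using pos by (simp add: pos_le_divide_eq)
        then have "27 / c ^ 3 * \<alpha> ^ 3 \<le> 27 / c ^ 3 * (641 / (1 + s\<^sup>2))" using c by (intro mult_left_mono) auto
        then show ?thesis by (simp add: mult_ac)
      qed
      also have "\<dots> \<le> llt_const * (1 / (1 + s\<^sup>2))" using c pos unfolding lc by (intro mult_right_mono) auto
      finally show ?thesis using n by linarith
    qed
  qed
qed

lemma integrable_gauss: "integrable lborel (\<lambda>s::real. exp (- s\<^sup>2 / 2))"
proof -
  have "integrable lborel (\<lambda>s. sqrt (2 * pi) * (std_normal_density s * s ^ 0))"
    by (intro integrable_mult_right integrable_std_normal_moment)
  then show ?thesis by (simp add: std_normal_density_def)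
qed

lemma integral_gauss: "(LINT s|lborel. exp (- s\<^sup>2 / 2)) = sqrt (2 * pi)"
proof -
  have "(LINT s|lborel. sqrt (2 * pi) * (std_normal_density s * s ^ (2 * 0))) = sqrt (2 * pi) * 1"
    unfolding integral_mult_right_zero integral_std_normal_moment_even by simp
  then show ?thesis by (simp add: std_normal_density_def)
qed

lemma gauss_abs: "integrable lborel (\<lambda>s::real. \<bar>s\<bar> * exp (- s\<^sup>2 / 2))"
   "(LINT s::real|lborel. \<bar>s\<bar> * exp (- s\<^sup>2 / 2)) = 2"
proof -
  have "integrable lborel (\<lambda>s. sqrt (2 * pi) * (std_normal_density s * \<bar>s\<bar> ^ 1))"
    by (intro integrable_mult_right integrable_std_normal_moment_abs)
  then show "integrable lborel (\<lambda>s::real. \<bar>s\<bar> * exp (- s\<^sup>2 / 2))"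
    by (simp add: std_normal_density_def mult.commute)
  have "(LINT s|lborel. sqrt (2 * pi) * (std_normal_density s * \<bar>s\<bar> ^ (2 * 0 + 1))) = sqrt (2 * pi) * sqrt (2 / pi)"
    unfolding integral_mult_right_zero integral_std_normal_moment_abs_odd by simp
  also have "\<dots> = 2" by (simp flip: real_sqrt_mult)
  finally show "(LINT s::real|lborel. \<bar>s\<bar> * exp (- s\<^sup>2 / 2)) = 2"
    by (simp add: std_normal_density_def mult.commute)
qed

lemma integrable_cauchy: "integrable lborel (\<lambda>s::real. 1 / (1 + s\<^sup>2))"
  using integrable_inverse_1_plus_square by (simp add: set_integrable_def inverse_eq_divide)

lemma integrable_cf2_rescaled:
  assumes \<alpha>: "0 < \<alpha>" "\<alpha> \<le> 1/2" and a: "11 \<le> \<alpha> * real a"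
  shows "integrable lborel (cf2_rescaled \<alpha> a b)"
proof (rule Bochner_Integration.integrable_bound[OF integrable_mult_right[OF integrable_cauchy, of llt_const]])
  show "AE s in lborel. norm (cf2_rescaled \<alpha> a b s) \<le> norm (llt_const * (1 / (1 + s\<^sup>2)))"
    unfolding real_norm_def
    by (intro always_eventually allI order_trans[OF cf2_rescaled_bound[OF assms] abs_ge_self])
qed (use \<alpha> in simp)

text \<open>In the variable s the error of \<open>cf2_gaussian_approx\<close> is of order
  \<alpha>^(-4) / sdev^3, that is sqrt \<alpha>; the truncated variances relative to sdev^2 tend to
  1 because \<alpha> * a and \<alpha> * b tend to infinity.\<close>

lemma cf2_rescaled_tendsto:
  fixes \<alpha> :: "nat \<Rightarrow> real" and a b :: "nat \<Rightarrow> nat"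
  assumes \<alpha>: "\<alpha> \<longlonglongrightarrow> 0" "\<And>n. 0 < \<alpha> n" "\<And>n. \<alpha> n \<le> 1/2"
    and a: "filterlim (\<lambda>n. \<alpha> n * real (a n)) at_top sequentially"
    and b: "filterlim (\<lambda>n. \<alpha> n * real (b n)) at_top sequentially"
  shows "(\<lambda>n. cf2_rescaled (\<alpha> n) (a n) (b n) s) \<longlonglongrightarrow> of_real (exp (- s\<^sup>2 / 2))"
proof -
  let ?e = "\<lambda>(c :: nat \<Rightarrow> nat) n. exp (- (\<alpha> n * real (c n) / 4))"
  define \<sigma> where "\<sigma> n = sdev (\<alpha> n)" for n
  have \<sigma>p: "0 < \<sigma> n" for n using \<alpha> by (simp add: \<sigma>_def sdev_pos)
  have \<sigma>l: "exp (- 2) \<le> (\<sigma> n)\<^sup>2 * \<alpha> n ^ 3" for n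
    using sdev_lower[OF \<alpha>(2,3), of n] \<alpha>(2)[of n] by (simp add: \<sigma>_def field_simps)
  have \<sigma>inv: "1 / (\<sigma> n)\<^sup>2 \<le> exp 2 * \<alpha> n ^ 3" for n
  proof -
    have "exp 2 * exp (- 2) \<le> exp 2 * ((\<sigma> n)\<^sup>2 * \<alpha> n ^ 3)" using \<sigma>l by (intro mult_left_mono) auto
    then have "1 \<le> exp 2 * \<alpha> n ^ 3 * (\<sigma> n)\<^sup>2" by (simp add: mult_ac flip: exp_add)
    then show ?thesis using \<sigma>p[of n] by (simp add: divide_le_eq)
  qed
  define v where "v n = var_upto (\<alpha> n) (a n) + var_upto (\<alpha> n) (b n)" for n
  define r where "r n = v n / (\<sigma> n)\<^sup>2" for n
  have small: "(\<lambda>n. 1 / (\<sigma> n)\<^sup>2) \<longlonglongrightarrow> 0"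
  proof (rule tendsto_sandwich[OF _ _ tendsto_const])
    show "(\<lambda>n. exp 2 * \<alpha> n ^ 3) \<longlonglongrightarrow> 0" using tendsto_mult[OF tendsto_const tendsto_power[OF \<alpha>(1)], of "exp 2" 3] by simp
  qed (use \<sigma>inv in auto)
  have r: "r \<longlonglongrightarrow> 1"
  proof (rule tendsto_sandwich)
    define g where "g n = 1 - 20 * exp 2 * (?e a n + ?e b n)" for n
    have e0: "(\<lambda>n. exp (- (\<alpha> n * real (c n) / 4))) \<longlonglongrightarrow> 0"
      if "filterlim (\<lambda>n. \<alpha> n * real (c n)) at_top sequentially" for c
    proof (rule filterlim_compose[OF exp_at_bot])
      show "filterlim (\<lambda>n. - (\<alpha> n * real (c n) / 4)) at_bot sequentially"
        unfolding filterlim_uminus_at_top[symmetric]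
        using filterlim_tendsto_pos_mult_at_top[OF tendsto_const _ that, of "1/4"] by simp
    qed
    have "g \<longlonglongrightarrow> 1 - 20 * exp 2 * (0 + 0)"
      unfolding g_def by (intro tendsto_intros e0 a b)
    then show "g \<longlonglongrightarrow> 1" by simp
    show "\<forall>\<^sub>F n in sequentially. g n \<le> r n"
    proof (intro always_eventually allI)
      fix n
      have "(\<sigma> n)\<^sup>2 \<le> v n + 20 / \<alpha> n ^ 3 * (?e a n + ?e b n)"
        unfolding \<sigma>_def sdev_sq[OF \<alpha>(2)] v_def
        using suminf_var_le[OF \<alpha>(2), of n "a n"] suminf_var_le[OF \<alpha>(2), of n "b n"] by (simp add: algebra_simps)
      also have "\<dots> \<le> v n + 20 * exp 2 * (?e a n + ?e b n) * (\<sigma> n)\<^sup>2"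
      proof -
        have "1 / \<alpha> n ^ 3 \<le> exp 2 * (\<sigma> n)\<^sup>2" using \<sigma>inv[of n] \<sigma>p[of n] \<alpha>(2)[of n] by (simp add: field_simps)
        then have "1 / \<alpha> n ^ 3 * (20 * (?e a n + ?e b n))
           \<le> exp 2 * (\<sigma> n)\<^sup>2 * (20 * (?e a n + ?e b n))"
          by (intro mult_right_mono) (auto intro: add_nonneg_nonneg)
        then show ?thesis by (simp add: mult_ac)
      qed
      finally have "g n * (\<sigma> n)\<^sup>2 \<le> v n" by (simp add: g_def algebra_simps)
      then show "g n \<le> r n" using \<sigma>p[of n] by (simp add: r_def pos_le_divide_eq)
    qed
    show "\<forall>\<^sub>F n in sequentially. r n \<le> 1"
    proof (intro always_eventually allI)
      fix n
      have "v n \<le> (\<sigma> n)\<^sup>2" unfolding \<sigma>_def sdev_sq[OF \<alpha>(2)] v_def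
        using var_upto_le_suminf[OF \<alpha>(2), of n "a n"] var_upto_le_suminf[OF \<alpha>(2), of n "b n"] by simp
      then show "r n \<le> 1" using \<sigma>p[of n] by (simp add: r_def)
    qed
  qed simp
  define h where "h n = 2600 / \<alpha> n ^ 4 * \<bar>s / \<sigma> n\<bar> ^ 3" for n
  have h: "h \<longlonglongrightarrow> 0"
  proof (rule tendsto_sandwich[OF _ _ tendsto_const])
    show "(\<lambda>n. 2600 * \<bar>s\<bar> ^ 3 * sqrt (exp 2 ^ 3 * \<alpha> n)) \<longlonglongrightarrow> 0"
      using tendsto_mult[OF tendsto_const tendsto_real_sqrt[OF tendsto_mult[OF tendsto_const \<alpha>(1)]], of "2600 * \<bar>s\<bar> ^ 3" "exp 2 ^ 3"] by simp
    have "1 / \<alpha> n ^ 4 / \<sigma> n ^ 3 \<le> sqrt (exp 2 ^ 3 * \<alpha> n)" for n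
    proof (rule real_le_rsqrt)
      have "(1 / \<alpha> n ^ 4 / \<sigma> n ^ 3)\<^sup>2 = 1 / \<alpha> n ^ 8 * (1 / (\<sigma> n)\<^sup>2) ^ 3"
        by (simp add: power_divide power_mult_distrib flip: power_mult)
      also have "\<dots> \<le> 1 / \<alpha> n ^ 8 * (exp 2 * \<alpha> n ^ 3) ^ 3"
        using \<sigma>inv[of n] \<sigma>p[of n] \<alpha>(2)[of n] by (intro mult_left_mono power_mono) auto
      also have "\<dots> = exp 2 ^ 3 * \<alpha> n"
      proof -
        have "(exp 2 * \<alpha> n ^ 3) ^ 3 = exp 2 ^ 3 * \<alpha> n ^ 9" by (simp only: power_mult_distrib power_mult[symmetric]) simp
        also have "\<alpha> n ^ 9 = \<alpha> n ^ 8 * \<alpha> n" using power_Suc2[of "\<alpha> n" 8] by simp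
        finally show ?thesis using \<alpha>(2)[of n] by simp
      qed
      finally show "(1 / \<alpha> n ^ 4 / \<sigma> n ^ 3)\<^sup>2 \<le> exp 2 ^ 3 * \<alpha> n" .
    qed
    then have "2600 * \<bar>s\<bar> ^ 3 * (1 / \<alpha> n ^ 4 / \<sigma> n ^ 3) \<le> 2600 * \<bar>s\<bar> ^ 3 * sqrt (exp 2 ^ 3 * \<alpha> n)" for n
      by (intro mult_left_mono) auto
    moreover have "h n = 2600 * \<bar>s\<bar> ^ 3 * (1 / \<alpha> n ^ 4 / \<sigma> n ^ 3)" for n
    proof -
      have "\<bar>s / \<sigma> n\<bar> = \<bar>s\<bar> / \<sigma> n" using \<sigma>p[of n] by (simp add: abs_divide)
      then show ?thesis unfolding h_def by (simp only: power_divide) simp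
    qed
    ultimately show "\<forall>\<^sub>F n in sequentially. h n \<le> 2600 * \<bar>s\<bar> ^ 3 * sqrt (exp 2 ^ 3 * \<alpha> n)" by simp
  qed (use \<alpha> in \<open>simp add: h_def less_imp_le\<close>)
  define G where "G n = complex_of_real (exp (- (r n * s\<^sup>2 / 2)))" for n
  have G: "G \<longlonglongrightarrow> of_real (exp (- (1 * s\<^sup>2 / 2)))"
    unfolding G_def by (intro tendsto_intros r) simp_all
  have ev: "\<forall>\<^sub>F n in sequentially. norm (cf2_rescaled (\<alpha> n) (a n) (b n) s - G n) \<le> h n"
  proof -
    \<comment> \<open>Eventually the fixed s lies inside the rescaled period, so the indicator is
      1.\<close>
    have "\<forall>\<^sub>F n in sequentially. 1 / (\<sigma> n)\<^sup>2 < 1 / (1 + s\<^sup>2)"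
      by (rule order_tendstoD(2)[OF small]) (simp add: add_pos_nonneg)
    then show ?thesis
    proof eventually_elim
      case (elim n)
      have "1 + s\<^sup>2 < (\<sigma> n)\<^sup>2"
      proof (rule ccontr)
        assume "\<not> ?thesis"
        then have "1 / (1 + s\<^sup>2) \<le> 1 / (\<sigma> n)\<^sup>2" using \<sigma>p[of n] by (intro frac_le) auto
        then show False using elim by linarith
      qed
      then have "\<bar>s\<bar>\<^sup>2 \<le> (\<sigma> n)\<^sup>2" by simp
      then have "\<bar>s\<bar> \<le> \<sigma> n" by (rule power2_le_imp_le) (use \<sigma>p[of n] in simp)
      also have "\<dots> \<le> pi * \<sigma> n" using \<sigma>p[of n] pi_gt3 by simp
      finally have i: "indicator {- (pi * \<sigma> n)..pi * \<sigma> n} s = (1::real)" by (auto simp: indicator_def)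
      have "G n = of_real (exp (- (v n * (s / \<sigma> n)\<^sup>2 / 2)))" by (simp add: G_def r_def power_divide)
      then show ?case
        using cf2_gaussian_approx[OF \<alpha>(2), of n "a n" "b n" "s / \<sigma> n"] i
        unfolding cf2_rescaled_def \<sigma>_def[symmetric] v_def h_def by simp
    qed
  qed
  have "(\<lambda>n. cf2_rescaled (\<alpha> n) (a n) (b n) s - G n) \<longlonglongrightarrow> 0"
    by (rule Lim_null_comparison[OF ev h])
  from tendsto_add[OF this G] show ?thesis by simp
qed

lemma llt_err_tendsto:
  fixes \<alpha> :: "nat \<Rightarrow> real" and a b :: "nat \<Rightarrow> nat"
  assumes \<alpha>: "\<alpha> \<longlonglongrightarrow> 0" "\<forall>\<^sub>F n in sequentially. 0 < \<alpha> n"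
    and a: "filterlim (\<lambda>n. \<alpha> n * real (a n)) at_top sequentially"
    and b: "filterlim (\<lambda>n. \<alpha> n * real (b n)) at_top sequentially"
  shows "(\<lambda>n. llt_err (\<alpha> n) (a n) (b n)) \<longlonglongrightarrow> 0"
proof -
  have "\<forall>\<^sub>F n in sequentially. \<alpha> n < 1/2" by (rule order_tendstoD(2)[OF \<alpha>(1)]) simp
  moreover have "\<forall>\<^sub>F n in sequentially. 11 \<le> \<alpha> n * real (a n)"
    using a unfolding filterlim_at_top by blast
  ultimately have "\<forall>\<^sub>F n in sequentially. 0 < \<alpha> n \<and> \<alpha> n \<le> 1/2 \<and> 11 \<le> \<alpha> n * real (a n)"
    using \<alpha>(2) by eventually_elim auto
  \<comment> \<open>The conditions hold only eventually; dominated convergence is applied to the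
    shifted sequence, where they hold for every index.\<close>
  then obtain N where N: "\<And>n. N \<le> n \<Longrightarrow> 0 < \<alpha> n \<and> \<alpha> n \<le> 1/2 \<and> 11 \<le> \<alpha> n * real (a n)"
    unfolding eventually_sequentially by blast
  let ?f = "\<lambda>i. cf2_rescaled (\<alpha> (i + N)) (a (i + N)) (b (i + N))" and ?g = "\<lambda>s::real. complex_of_real (exp (- s\<^sup>2 / 2))"
  have "(\<lambda>n. llt_err (\<alpha> (n + N)) (a (n + N)) (b (n + N))) \<longlonglongrightarrow> (LINT s::real|lborel. 0::real)"
    unfolding llt_err_def
  proof (rule integral_dominated_convergence[where w = "\<lambda>s. llt_const * (1 / (1 + s\<^sup>2)) + exp (- s\<^sup>2 / 2)"])
    show "integrable lborel (\<lambda>s. llt_const * (1 / (1 + s\<^sup>2)) + exp (- s\<^sup>2 / 2))"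
      by (intro Bochner_Integration.integrable_add integrable_mult_right integrable_cauchy integrable_gauss)
    show "(\<lambda>s. norm (?f i s - ?g s)) \<in> borel_measurable lborel" for i
    proof -
      have [measurable]: "?f i \<in> borel_measurable borel"
        using N[of "i + N"] by (intro measurable_cf2_rescaled) auto
      show ?thesis by measurable
    qed
    show "AE s in lborel. (\<lambda>i. norm (?f i s - ?g s)) \<longlonglongrightarrow> 0"
    proof (intro always_eventually allI)
      fix s :: real
      have "(\<lambda>i. ?f i s) \<longlonglongrightarrow> of_real (exp (- s\<^sup>2 / 2))"
        using N by (intro cf2_rescaled_tendsto filterlim_compose[OF a filterlim_add_const_nat_at_top]
          filterlim_compose[OF b filterlim_add_const_nat_at_top] LIMSEQ_ignore_initial_segment[OF \<alpha>(1)]) auto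
      then show "(\<lambda>i. norm (?f i s - ?g s)) \<longlonglongrightarrow> 0"
        using LIM_zero tendsto_norm_zero by blast
    qed
    show "AE s in lborel. norm (norm (?f i s - ?g s))
        \<le> llt_const * (1 / (1 + s\<^sup>2)) + exp (- s\<^sup>2 / 2)" for i
    proof (intro always_eventually allI)
      fix s :: real
      show "norm (norm (?f i s - ?g s))
        \<le> llt_const * (1 / (1 + s\<^sup>2)) + exp (- s\<^sup>2 / 2)"
        using cf2_rescaled_bound[of "\<alpha> (i + N)" "a (i + N)" "b (i + N)" s] N[of "i + N"]
          norm_triangle_ineq4[of "?f i s" "?g s"]
        by (simp del: of_real_exp)
    qed
  qed simp
  then show ?thesis by (simp add: LIMSEQ_offset[of _ N])
qed

text \<open>Uniformity follows from the statement about sequences: at each n a violating pair is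
  selected if one exists. Every such selection satisfies the growth conditions, so its error tends
  to 0 and eventually there is nothing to select.\<close>

lemma llt_err_uniform:
  fixes \<alpha> :: "nat \<Rightarrow> real" and a0 :: "nat \<Rightarrow> nat"
  assumes \<alpha>: "\<alpha> \<longlonglongrightarrow> 0" "\<forall>\<^sub>F n in sequentially. 0 < \<alpha> n"
    and a0: "filterlim (\<lambda>n. \<alpha> n * real (a0 n)) at_top sequentially" and \<epsilon>: "0 < \<epsilon>"
  shows "\<forall>\<^sub>F n in sequentially. \<forall>a\<ge>a0 n. \<forall>b\<ge>a0 n. llt_err (\<alpha> n) a b < \<epsilon>"
proof -
  define bad where "bad n p \<longleftrightarrow> a0 n \<le> fst p \<and> a0 n \<le> snd p \<and> \<epsilon> \<le> llt_err (\<alpha> n) (fst p) (snd p)" for n and p :: "nat \<times> nat"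
  define c where "c n = (if \<exists>p. bad n p then SOME p. bad n p else (a0 n, a0 n))" for n
  have c2: "bad n (c n)" if "\<exists>p. bad n p" for n
    using someI_ex[OF that] that by (simp add: c_def)
  have c1: "a0 n \<le> fst (c n) \<and> a0 n \<le> snd (c n)" for n
  proof (cases "\<exists>p. bad n p")
    case True
    from c2[OF this] show ?thesis by (simp add: bad_def)
  qed (simp add: c_def)
  have fl: "filterlim (\<lambda>n. \<alpha> n * real (d n)) at_top sequentially" if d: "\<And>n. a0 n \<le> d n" for d
  proof (rule filterlim_at_top_mono[OF a0])
    show "\<forall>\<^sub>F n in sequentially. \<alpha> n * real (a0 n) \<le> \<alpha> n * real (d n)"
      using \<alpha>(2) by eventually_elim (auto intro!: mult_left_mono d)
  qed
  have "(\<lambda>n. llt_err (\<alpha> n) (fst (c n)) (snd (c n))) \<longlonglongrightarrow> 0"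
    using c1 by (intro llt_err_tendsto \<alpha> fl) auto
  then have "\<forall>\<^sub>F n in sequentially. llt_err (\<alpha> n) (fst (c n)) (snd (c n)) < \<epsilon>"
    by (rule order_tendstoD) (rule \<epsilon>)
  then show ?thesis
  proof eventually_elim
    case (elim n)
    then have "\<not> (\<exists>p. bad n p)" using c2[of n] by (auto simp: bad_def)
    then show ?case unfolding bad_def not_less[symmetric] by (metis fst_conv snd_conv)
  qed
qed

text \<open>A local limit theorem: \<open>wt\<close> is about 1 / (sqrt (2 * pi) * sdev). The upper
  bound takes absolute values and so holds for every \<open>m\<close>. The lower bound loses 2 *
  \<bar>w\<bar> for an \<open>m\<close> that is w standard deviations off the mean, as \<bar>s\<bar>
  * exp (- s^2 / 2) has integral 2.\<close>

lemma wt_gauss: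
  assumes \<alpha>: "0 < \<alpha>" "\<alpha> \<le> 1/2" and a: "11 \<le> \<alpha> * real a"
  shows "2 * pi * sdev \<alpha> * wt \<alpha> a b m \<le> sqrt (2 * pi) + llt_err \<alpha> a b"
    and "sqrt (2 * pi) - 2 * \<bar>(real m - mean_upto \<alpha> a - mean_upto \<alpha> b) / sdev \<alpha>\<bar> - llt_err \<alpha> a b
           \<le> 2 * pi * sdev \<alpha> * wt \<alpha> a b m"
proof -
  define \<sigma> where "\<sigma> = sdev \<alpha>"
  have \<sigma>: "0 < \<sigma>" using sdev_pos[OF \<alpha>] by (simp add: \<sigma>_def)
  define w where "w = (real m - mean_upto \<alpha> a - mean_upto \<alpha> b) / \<sigma>"
  let ?f = "cf2_rescaled \<alpha> a b" and ?g = "\<lambda>s. complex_of_real (exp (- s\<^sup>2 / 2))"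
  let ?J = "LINT s|lborel. ?g s * cis (- (w * s))" and ?w = "complex_of_real (2 * pi * \<sigma> * wt \<alpha> a b m)"
  have if1: "integrable lborel ?f" by (rule integrable_cf2_rescaled[OF assms])
  have ig: "integrable lborel ?g" by (intro integrable_of_real integrable_gauss)
  have bnd: "integrable lborel (\<lambda>s. f s * cis (- (w * s)))" if "integrable lborel f" for f :: "real \<Rightarrow> complex"
    by (rule Bochner_Integration.integrable_bound[OF that]) (use that in \<open>auto simp: norm_mult\<close>)
  have "complex_of_real (2 * pi * wt \<alpha> a b m) = (LINT \<theta>|lborel. indicator {-pi..pi} \<theta> *\<^sub>R (cf2 \<alpha> a b \<theta> * cis (- (real m * \<theta>))))"
    using wt_fourier[OF \<alpha>(1)] by (simp add: set_lebesgue_integral_def)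
  also have "\<dots> = \<bar>1 / \<sigma>\<bar> *\<^sub>R (LINT s|lborel. indicator {-pi..pi} (0 + 1 / \<sigma> * s) *\<^sub>R (cf2 \<alpha> a b (0 + 1 / \<sigma> * s) * cis (- (real m * (0 + 1 / \<sigma> * s)))))"
    by (rule lborel_integral_real_affine) (use \<sigma> in simp)
  also have "(\<lambda>s. indicator {-pi..pi} (0 + 1 / \<sigma> * s) *\<^sub>R (cf2 \<alpha> a b (0 + 1 / \<sigma> * s) * cis (- (real m * (0 + 1 / \<sigma> * s)))))
      = (\<lambda>s. ?f s * cis (- (w * s)))"
  proof
    fix s
    have i: "indicator {-pi..pi} (0 + 1 / \<sigma> * s) = (indicator {- (pi * \<sigma>)..pi * \<sigma>} s :: real)"
      using \<sigma> by (auto simp: indicator_def field_simps)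
    have c: "cis (- (real m * (0 + 1 / \<sigma> * s))) = cis (- ((mean_upto \<alpha> a + mean_upto \<alpha> b) * (s / \<sigma>))) * cis (- (w * s))"
      using \<sigma> by (simp add: cis_mult w_def field_simps)
    show "indicator {-pi..pi} (0 + 1 / \<sigma> * s) *\<^sub>R (cf2 \<alpha> a b (0 + 1 / \<sigma> * s) * cis (- (real m * (0 + 1 / \<sigma> * s)))) = ?f s * cis (- (w * s))"
      unfolding i c cf2_rescaled_def \<sigma>_def[symmetric] by (simp add: mult.assoc)
  qed
  finally have main: "?w = (LINT s|lborel. ?f s * cis (- (w * s)))"
    using \<sigma> by (simp add: scaleR_conv_of_real field_simps)
  have "norm ((LINT s|lborel. ?f s * cis (- (w * s))) - ?J)
      = norm (LINT s|lborel. (?f s - ?g s) * cis (- (w * s)))"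
    by (subst Bochner_Integration.integral_diff[symmetric, OF bnd[OF if1] bnd[OF ig]]) (simp only: left_diff_distrib)
  also have "\<dots> \<le> (LINT s|lborel. norm ((?f s - ?g s) * cis (- (w * s))))"
    by (rule integral_norm_bound)
  also have "\<dots> = llt_err \<alpha> a b" by (simp add: norm_mult llt_err_def)
  finally have err: "norm (?w - ?J) \<le> llt_err \<alpha> a b"
    unfolding main .
  have g0: "(LINT s|lborel. ?g s) = sqrt (2 * pi)"
    unfolding integral_complex_of_real integral_gauss ..
  have "norm ?J \<le> (LINT s|lborel. norm (?g s * cis (- (w * s))))"
    by (rule integral_norm_bound)
  also have "\<dots> = sqrt (2 * pi)" using integral_gauss by (simp add: norm_mult del: of_real_exp)
  finally have up: "norm ?J \<le> sqrt (2 * pi)" .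
  show "2 * pi * sdev \<alpha> * wt \<alpha> a b m \<le> sqrt (2 * pi) + llt_err \<alpha> a b"
  proof -
    have "2 * pi * \<sigma> * wt \<alpha> a b m \<le> norm (?w)"
      unfolding norm_of_real by (rule abs_ge_self)
    then show ?thesis using err up norm_triangle_sub[of "?w" "?J"]
      unfolding \<sigma>_def by linarith
  qed
  have "norm (?J - sqrt (2 * pi)) = norm (LINT s|lborel. ?g s * (cis (- (w * s)) - 1))"
    unfolding g0[symmetric]
    by (subst Bochner_Integration.integral_diff[symmetric, OF bnd[OF ig] ig]) (simp only: right_diff_distrib mult_1_right)
  also have "\<dots> \<le> (LINT s|lborel. \<bar>w\<bar> * (\<bar>s\<bar> * exp (- s\<^sup>2 / 2)))"
  proof (rule Bochner_Integration.integral_norm_bound_integral)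
    show "integrable lborel (\<lambda>s. ?g s * (cis (- (w * s)) - 1))"
      using Bochner_Integration.integrable_diff[OF bnd[OF ig] ig] by (simp add: right_diff_distrib del: of_real_exp)
    show "norm (?g s * (cis (- (w * s)) - 1)) \<le> \<bar>w\<bar> * (\<bar>s\<bar> * exp (- s\<^sup>2 / 2))" for s
      unfolding norm_mult using mult_left_mono[OF cis_approx(1)[of "- (w * s)"], of "exp (- s\<^sup>2 / 2)"]
      by (simp add: abs_mult mult_ac del: of_real_exp)
  qed (intro integrable_mult_right gauss_abs)
  also have "\<dots> = 2 * \<bar>w\<bar>" using gauss_abs(2) by simp
  finally have lo: "norm (?J - sqrt (2 * pi)) \<le> 2 * \<bar>w\<bar>" .
  have "norm (?w - complex_of_real (sqrt (2 * pi))) \<le> llt_err \<alpha> a b + 2 * \<bar>w\<bar>"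
    using norm_triangle_ineq[of "?w - ?J"
       "?J - sqrt (2 * pi)"] err lo by simp
  then have "\<bar>2 * pi * \<sigma> * wt \<alpha> a b m - sqrt (2 * pi)\<bar> \<le> llt_err \<alpha> a b + 2 * \<bar>w\<bar>"
    unfolding of_real_diff[symmetric] norm_of_real .
  then show "sqrt (2 * pi) - 2 * \<bar>(real m - mean_upto \<alpha> a - mean_upto \<alpha> b) / sdev \<alpha>\<bar> - llt_err \<alpha> a b
           \<le> 2 * pi * sdev \<alpha> * wt \<alpha> a b m"
    unfolding w_def \<sigma>_def by linarith
qed

section \<open>The mean size and the number of unimodal sequences\<close>

lemma mean_term_le:
  assumes "0 < \<alpha>"
  shows "real k * occ \<alpha> k \<le> 1 / \<alpha> * exp (- (\<alpha> / 2 * real k))"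
  using occ_le[OF assms, of k] assms by (simp add: field_simps)

lemma summable_mean_term:
  assumes "0 < \<alpha>" shows "summable (\<lambda>k. real k * occ \<alpha> k)"
proof (rule summable_comparison_test')
  have "summable (\<lambda>k. exp (- (\<alpha> / 2)) ^ k)" using assms by (intro summable_geometric) simp
  then show "summable (\<lambda>k. 1 / \<alpha> * exp (- (\<alpha> / 2 * real k)))"
    by (intro summable_mult) (simp add: exp_of_nat_mult[symmetric] mult_ac)
  show "norm (real k * occ \<alpha> k) \<le> 1 / \<alpha> * exp (- (\<alpha> / 2 * real k))" for k
    using mean_term_le[OF assms, of k] occ_nonneg[OF assms, of k] by simp
qed

definition total_mean :: "real \<Rightarrow> real" where
  "total_mean \<alpha> = (\<Sum>k. real k * occ \<alpha> k)"

text \<open>This is 1 / (4 * sinh (y / 2)^2), the sum of k * exp (- y * k) over k \<ge> 1.\<close>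

definition dual_term :: "real \<Rightarrow> real" where
  "dual_term y = exp y / (exp y - 1)\<^sup>2"

text \<open>The exponent 5/4 lies strictly between 1 and 3/2: above 1 the correction is summable
  over multiples of \<alpha>, below 3/2 the resulting error \<alpha>^(-5/4) is negligible against
  \<open>sdev\<close>.\<close>

lemma dual_term_bounds:
  assumes "0 < y"
  shows "dual_term y \<le> 1 / y\<^sup>2" "1 / y\<^sup>2 - dual_term y \<le> y powr (- (5/4))" "0 \<le> dual_term y"
proof -
  have e: "0 < exp y - 1" using assms by simp
  show "0 \<le> dual_term y" by (simp add: dual_term_def)
  have "(y * exp (y / 2))\<^sup>2 \<le> (exp y - 1)\<^sup>2" using assms by (intro power_mono mult_exp_half_le) auto
  then have "y\<^sup>2 * exp y \<le> (exp y - 1)\<^sup>2" by (simp add: power_mult_distrib flip: exp_double)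
  then show "dual_term y \<le> 1 / y\<^sup>2" using e assms by (simp add: dual_term_def field_simps)
  have ey: "1 - y \<le> exp (- y)" using exp_ge_add_one_self[of "- y"] by simp
  have "exp y - 1 \<le> y * exp y"
  proof -
    have "(1 - y) * exp y \<le> exp (- y) * exp y" using ey by (intro mult_right_mono) auto
    then show ?thesis by (simp add: algebra_simps flip: exp_add)
  qed
  then have "(exp y - 1)\<^sup>2 \<le> (y * exp y)\<^sup>2" using e by (intro power_mono) auto
  then have "exp y / (y * exp y)\<^sup>2 \<le> dual_term y"
    unfolding dual_term_def using e by (intro divide_left_mono) (auto intro!: mult_pos_pos assms)
  moreover have "exp y / (y * exp y)\<^sup>2 = exp (- y) / y\<^sup>2"
    by (simp add: power2_eq_square exp_minus field_simps)
  ultimately have "1 / y\<^sup>2 - dual_term y \<le> (1 - exp (- y)) / y\<^sup>2" by (simp add: diff_divide_distrib)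
  also have "\<dots> \<le> y powr (3/4) / y\<^sup>2"
  proof (intro divide_right_mono)
    \<comment> \<open>The left side is at most y and at most 1, hence at most every power of y with
      exponent in [0, 1].\<close>
    show "1 - exp (- y) \<le> y powr (3/4)"
    proof (cases "y \<le> 1")
      case True
      then have "y powr 1 \<le> y powr (3/4)" using assms by (intro powr_mono') auto
      then show ?thesis using ey assms by simp
    next
      case False
      then have "1 \<le> y powr (3/4)" by (intro ge_one_powr_ge_zero) auto
      then show ?thesis using exp_gt_zero[of "-y"] by linarith
    qed
  qed simp
  also have "\<dots> = y powr (- (5/4))"
    using assms by (simp add: powr_diff[symmetric] flip: powr_numeral)
  finally show "1 / y\<^sup>2 - dual_term y \<le> y powr (- (5/4))" .
qed

lemma ennreal_suminf_swap:
  fixes f :: "nat \<Rightarrow> nat \<Rightarrow> ennreal"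
  shows "(\<Sum>i. \<Sum>j. f i j) = (\<Sum>j. \<Sum>i. f i j)"
proof -
  have "(\<Sum>i. \<Sum>j. f i j) = (\<Sum>i. \<integral>\<^sup>+j. f i j \<partial>count_space UNIV)"
    by (simp add: nn_integral_count_space_nat)
  also have "\<dots> = (\<integral>\<^sup>+j. (\<Sum>i. f i j) \<partial>count_space UNIV)"
    by (rule nn_integral_suminf[symmetric]) simp
  finally show ?thesis by (simp add: nn_integral_count_space_nat)
qed

lemma occ_geometric:
  assumes "0 < \<alpha>" "0 < k"
  shows "(\<lambda>j. exp (- (\<alpha> * real k * real (Suc j)))) sums occ \<alpha> k"
proof -
  define x where "x = qpow \<alpha> k"
  have x: "0 < x" "x < 1" using assms by (auto simp: x_def)
  have "(\<lambda>j. x * x ^ j) sums (x * (1 / (1 - x)))" using x by (intro sums_mult geometric_sums) auto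
  moreover have "x * (1 / (1 - x)) = occ \<alpha> k"
    using x by (simp add: x_def occ_def exp_minus field_simps)
  moreover have "x * x ^ j = exp (- (\<alpha> * real k * real (Suc j)))" for j
  proof -
    have "exp (real (Suc j) * - (\<alpha> * real k)) = x ^ Suc j" unfolding x_def by (rule exp_of_nat_mult)
    then show ?thesis by (simp add: algebra_simps)
  qed
  ultimately show ?thesis by (simp only:)
qed

lemma dual_geometric:
  assumes "0 < y"
  shows "(\<lambda>k. real (Suc k) * exp (- (y * real (Suc k)))) sums dual_term y"
proof -
  define x where "x = exp (- y)"
  have x: "0 < x" "x < 1" using assms by (auto simp: x_def)
  have "(\<lambda>k. x * (real (Suc k) * x ^ k)) sums (x * (1 / (1 - x)\<^sup>2))"
    using x by (intro sums_mult geometric_deriv_sums) auto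
  moreover have "x * (1 / (1 - x)\<^sup>2) = dual_term y"
  proof -
    have "1 - x = (exp y - 1) * x" by (simp add: x_def algebra_simps flip: exp_add)
    then have "x * (1 / (1 - x)\<^sup>2) = 1 / x / (exp y - 1)\<^sup>2" using x by (simp add: power_mult_distrib power2_eq_square)
    then show ?thesis by (simp add: dual_term_def x_def exp_minus inverse_eq_divide)
  qed
  moreover have "x * (real (Suc k) * x ^ k) = real (Suc k) * exp (- (y * real (Suc k)))" for k
  proof -
    have "exp (real (Suc k) * - y) = x ^ Suc k" unfolding x_def by (rule exp_of_nat_mult)
    then have "exp (- (y * real (Suc k))) = x ^ Suc k" by (simp add: algebra_simps)
    then show ?thesis by simp
  qed
  ultimately show ?thesis by (simp only:)
qed

text \<open>
  Expanding \<open>occ\<close> into a geometric series and summing over \<open>k\<close> first turns the mean into a sum that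
  is close to the Basel series.
\<close>
lemma total_mean_dual:
  assumes "0 < \<alpha>"
  shows "(\<lambda>j. dual_term (\<alpha> * real (Suc j))) sums total_mean \<alpha>"
proof -
  define h where "h k j = real (Suc k) * exp (- (\<alpha> * real (Suc k) * real (Suc j)))" for k j
  have h0: "0 \<le> h k j" for k j by (simp add: h_def)
  have 1: "(\<lambda>j. h k j) sums (real (Suc k) * occ \<alpha> (Suc k))" for k
    unfolding h_def by (intro sums_mult occ_geometric assms) simp
  have 2: "(\<lambda>k. h k j) sums dual_term (\<alpha> * real (Suc j))" for j
    using dual_geometric[of "\<alpha> * real (Suc j)"] assms by (simp add: h_def mult_ac)
  have sm: "summable (\<lambda>j. dual_term (\<alpha> * real (Suc j)))"
  proof (rule summable_comparison_test')
    show "summable (\<lambda>j. 1 / \<alpha>\<^sup>2 * (1 / (real (Suc j))\<^sup>2))"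
      using inverse_squares_sums by (intro summable_mult) (auto simp: sums_iff)
    show "norm (dual_term (\<alpha> * real (Suc j))) \<le> 1 / \<alpha>\<^sup>2 * (1 / (real (Suc j))\<^sup>2)" for j
      using dual_term_bounds[of "\<alpha> * real (Suc j)"] assms by (simp add: power_mult_distrib)
  qed
  have st: "summable (\<lambda>k. real (Suc k) * occ \<alpha> (Suc k))"
    using summable_mean_term[OF assms] by (subst summable_Suc_iff)
  have e1: "(\<Sum>j. ennreal (h k j)) = ennreal (real (Suc k) * occ \<alpha> (Suc k))" for k
    unfolding sums_unique[OF 1] by (rule suminf_ennreal2[OF h0 sums_summable[OF 1]])
  have e2: "(\<Sum>k. ennreal (h k j)) = ennreal (dual_term (\<alpha> * real (Suc j)))" for j
    unfolding sums_unique[OF 2] by (rule suminf_ennreal2[OF h0 sums_summable[OF 2]])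
  have d0: "0 \<le> dual_term (\<alpha> * real (Suc j))" for j using assms by (intro dual_term_bounds) simp
  have o0: "0 \<le> real (Suc k) * occ \<alpha> (Suc k)" for k using occ_nonneg[OF assms] by simp
  have "ennreal (\<Sum>k. real (Suc k) * occ \<alpha> (Suc k)) = (\<Sum>k. ennreal (real (Suc k) * occ \<alpha> (Suc k)))"
    by (rule suminf_ennreal2[symmetric, OF o0 st])
  also have "\<dots> = (\<Sum>k. \<Sum>j. ennreal (h k j))" by (simp only: e1)
  also have "\<dots> = (\<Sum>j. \<Sum>k. ennreal (h k j))" by (rule ennreal_suminf_swap)
  also have "\<dots> = (\<Sum>j. ennreal (dual_term (\<alpha> * real (Suc j))))" by (simp only: e2)
  also have "\<dots> = ennreal (\<Sum>j. dual_term (\<alpha> * real (Suc j)))"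
    by (rule suminf_ennreal2[OF d0 sm])
  finally have "(\<Sum>k. real (Suc k) * occ \<alpha> (Suc k)) = (\<Sum>j. dual_term (\<alpha> * real (Suc j)))"
    using suminf_nonneg[OF st o0] suminf_nonneg[OF sm d0] by simp
  moreover have "total_mean \<alpha> = (\<Sum>k. real (Suc k) * occ \<alpha> (Suc k))"
    unfolding total_mean_def using suminf_split_head[OF summable_mean_term[OF assms]] by simp
  ultimately show ?thesis using sm by (simp add: sums_iff)
qed

text \<open>The value of the Riemann zeta function at 5/4.\<close>

definition mean_const :: real where
  "mean_const = (\<Sum>j. real (Suc j) powr (- (5/4)))"

text \<open>The two sides together have mean about pi^2 / (3 * \<alpha>^2), which equals n for
  \<alpha> = \<open>scale n\<close>; this is where B = sqrt 3 / pi comes from.\<close>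

lemma total_mean_approx:
  assumes "0 < \<alpha>"
  shows "\<bar>total_mean \<alpha> - pi\<^sup>2 / 6 / \<alpha>\<^sup>2\<bar> \<le> mean_const * \<alpha> powr (- (5/4))"
proof -
  have s1: "(\<lambda>j. 1 / \<alpha>\<^sup>2 * (1 / (real (Suc j))\<^sup>2)) sums (1 / \<alpha>\<^sup>2 * (pi\<^sup>2 / 6))"
    using sums_mult[OF inverse_squares_sums, of "1 / \<alpha>\<^sup>2"] by (simp add: add.commute)
  have "summable (\<lambda>j. real j powr (- (5/4)))" by (simp add: summable_real_powr_iff)
  then have "summable (\<lambda>j. real (Suc j) powr (- (5/4)))" by (subst summable_Suc_iff)
  then have s2: "(\<lambda>j. \<alpha> powr (- (5/4)) * real (Suc j) powr (- (5/4))) sums (\<alpha> powr (- (5/4)) * mean_const)"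
    unfolding mean_const_def by (intro sums_mult summable_sums)
  note s3 = sums_diff[OF s1 total_mean_dual[OF assms]]
  have b: "0 \<le> 1 / \<alpha>\<^sup>2 * (1 / (real (Suc j))\<^sup>2) - dual_term (\<alpha> * real (Suc j))"
     "1 / \<alpha>\<^sup>2 * (1 / (real (Suc j))\<^sup>2) - dual_term (\<alpha> * real (Suc j)) \<le> \<alpha> powr (- (5/4)) * real (Suc j) powr (- (5/4))" for j
    using dual_term_bounds(1,2)[of "\<alpha> * real (Suc j)"] assms by (simp_all add: power_mult_distrib powr_mult del: of_nat_Suc)
  have "1 / \<alpha>\<^sup>2 * (pi\<^sup>2 / 6) - total_mean \<alpha> \<le> \<alpha> powr (- (5/4)) * mean_const"
    by (rule sums_le[OF b(2) s3 s2])
  moreover have "0 \<le> 1 / \<alpha>\<^sup>2 * (pi\<^sup>2 / 6) - total_mean \<alpha>"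
    by (rule sums_le[OF b(1) sums_zero s3])
  moreover have "pi\<^sup>2 / 6 / \<alpha>\<^sup>2 = 1 / \<alpha>\<^sup>2 * (pi\<^sup>2 / 6)" by simp
  ultimately show ?thesis by (simp only: mult.commute abs_le_iff) linarith
qed

text \<open>The sum of \<open>k * exp (- \<alpha> * k)\<close> over \<open>k > a\<close>.\<close>
definition tail_sum :: "real \<Rightarrow> nat \<Rightarrow> real" where
  "tail_sum \<alpha> a = qpow \<alpha> (Suc a) / (1 - exp (- \<alpha>)) * (real a + 1 / (1 - exp (- \<alpha>)))"

lemma tail_sum_diff:
  assumes "0 < \<alpha>" "a \<le> b"
  shows "(\<Sum>k\<in>{a<..b}. real k * qpow \<alpha> k) = tail_sum \<alpha> a - tail_sum \<alpha> b"
  using assms(2)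
proof (induction b rule: dec_induct)
  case (step b)
  define q where "q = exp (- \<alpha>)"
  have q: "0 < q" "q < 1" using assms by (auto simp: q_def)
  define r where "r = qpow \<alpha> (Suc b)"
  have r2: "qpow \<alpha> (Suc (Suc b)) = q * r" by (simp add: q_def r_def algebra_simps flip: exp_add)
  define d where "d = 1 - q"
  have d: "q = 1 - d" "d \<noteq> 0" using q by (auto simp: d_def)
  have "tail_sum \<alpha> b - tail_sum \<alpha> (Suc b) = r / d * (real b + 1 / d) - (1 - d) * r / d * (real (Suc b) + 1 / d)"
    unfolding tail_sum_def r2 r_def[symmetric] q_def[symmetric] d(1) by simp
  also have "\<dots> = real (Suc b) * r"
    using d(2) by (simp add: field_simps)
  finally have "tail_sum \<alpha> b - tail_sum \<alpha> (Suc b) = real (Suc b) * r" .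
  moreover have "{a<..Suc b} = insert (Suc b) {a<..b}" using step by auto
  ultimately show ?case using step by (simp add: r_def)
qed simp

lemma tail_sum_nonneg: "0 < \<alpha> \<Longrightarrow> 0 \<le> tail_sum \<alpha> a"
  unfolding tail_sum_def by (intro mult_nonneg_nonneg divide_nonneg_nonneg add_nonneg_nonneg) auto

lemma tail_sum_tendsto:
  assumes "0 < \<alpha>" shows "(\<lambda>b. tail_sum \<alpha> b) \<longlonglongrightarrow> 0"
proof -
  define q where "q = exp (- \<alpha>)"
  have q: "0 < q" "q < 1" using assms by (auto simp: q_def)
  have "(\<lambda>b. q / (1 - q) * (real b * q ^ b + q ^ b * (1 / (1 - q)))) \<longlonglongrightarrow> q / (1 - q) * (0 + 0 * (1 / (1 - q)))"
    using q by (intro tendsto_intros powser_times_n_limit_0 LIMSEQ_power_zero) auto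
  moreover have "tail_sum \<alpha> b = q / (1 - q) * (real b * q ^ b + q ^ b * (1 / (1 - q)))" for b
  proof -
    have "exp (real (Suc b) * - \<alpha>) = q ^ Suc b" unfolding q_def by (rule exp_of_nat_mult)
    then have "qpow \<alpha> (Suc b) = q * q ^ b" by (simp add: algebra_simps)
    then have "tail_sum \<alpha> b = q * q ^ b / (1 - q) * (real b + 1 / (1 - q))"
      unfolding tail_sum_def q_def[symmetric] by (simp only:)
    also have "\<dots> = q / (1 - q) * (real b * q ^ b + q ^ b * (1 / (1 - q)))"
      by (simp add: distrib_left add_divide_distrib)
    finally show ?thesis .
  qed
  ultimately show ?thesis by simp
qed

lemma occ_bounds:
  assumes "0 < \<alpha>" "0 < k" "qpow \<alpha> k \<le> 1/2"
  shows "qpow \<alpha> k \<le> occ \<alpha> k" "occ \<alpha> k \<le> qpow \<alpha> k * (1 + 2 * qpow \<alpha> k)"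
proof -
  define x where "x = qpow \<alpha> k"
  have x: "0 < x" "x \<le> 1/2" using assms by (auto simp: x_def)
  have o: "occ \<alpha> k = x / (1 - x)" using x by (simp add: x_def occ_def exp_minus field_simps)
  show "qpow \<alpha> k \<le> occ \<alpha> k" unfolding o x_def[symmetric] using x
    by (simp add: pos_le_divide_eq algebra_simps)
  have "1 \<le> (1 + 2 * x) * (1 - x)"
  proof -
    have "x * (2 * x) \<le> x * 1" using x by (intro mult_left_mono) auto
    then show ?thesis by (simp add: algebra_simps)
  qed
  then have "x * 1 \<le> x * ((1 + 2 * x) * (1 - x))" using x by (intro mult_left_mono) auto
  then show "occ \<alpha> k \<le> qpow \<alpha> k * (1 + 2 * qpow \<alpha> k)"
    unfolding o x_def[symmetric] using x by (simp add: pos_divide_le_eq mult_ac)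
qed

lemma sum_lessThan_eq_mean_upto: "(\<Sum>k<Suc n. real k * occ \<alpha> k) = mean_upto \<alpha> n"
  unfolding mean_upto_def lessThan_Suc_atMost by (simp add: sum.atMost_shift sum.atLeast1_atMost_eq)

text \<open>Beyond \<open>a\<close> the means \<open>occ\<close> exceed exp (- \<alpha> * k) by a
  relative error of at most 2 * exp (- \<alpha> * a), and the sum of k * exp (- \<alpha> * k) has
  the closed form \<open>tail_sum\<close>.\<close>

lemma mean_tail_bounds:
  assumes \<alpha>: "0 < \<alpha>" and h: "qpow \<alpha> a \<le> 1/2"
  shows "tail_sum \<alpha> a \<le> total_mean \<alpha> - mean_upto \<alpha> a"
    "total_mean \<alpha> - mean_upto \<alpha> a \<le> (1 + 2 * qpow \<alpha> a) * tail_sum \<alpha> a"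
proof -
  let ?q = "\<lambda>k. qpow \<alpha> k"
  have q: "?q k \<le> ?q a" if "a < k" for k using that \<alpha> by simp
  have split: "mean_upto \<alpha> b = mean_upto \<alpha> a + (\<Sum>k\<in>{a<..b}. real k * occ \<alpha> k)" if "a \<le> b" for b
  proof -
    have "{1..b} = {1..a} \<union> {a<..b}" using that by auto
    then show ?thesis unfolding mean_upto_def by (simp only:) (rule sum.union_disjoint, auto)
  qed
  have m: "mean_upto \<alpha> b \<le> total_mean \<alpha>" for b
    unfolding total_mean_def sum_lessThan_eq_mean_upto[symmetric]
    by (intro sum_le_suminf summable_mean_term \<alpha>) (use \<alpha> in \<open>auto simp: occ_nonneg\<close>)
  have low: "mean_upto \<alpha> a + tail_sum \<alpha> a - tail_sum \<alpha> b \<le> total_mean \<alpha>" if "a \<le> b" for b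
  proof -
    have "tail_sum \<alpha> a - tail_sum \<alpha> b \<le> (\<Sum>k\<in>{a<..b}. real k * occ \<alpha> k)"
      unfolding tail_sum_diff[OF \<alpha> that, symmetric]
      by (intro sum_mono mult_left_mono occ_bounds \<alpha> order_trans[OF q h]) auto
    then show ?thesis using split[OF that] m[of b] by simp
  qed
  have "(\<lambda>b. mean_upto \<alpha> a + tail_sum \<alpha> a - tail_sum \<alpha> b) \<longlonglongrightarrow> mean_upto \<alpha> a + tail_sum \<alpha> a - 0"
    by (intro tendsto_intros tail_sum_tendsto \<alpha>)
  then have "mean_upto \<alpha> a + tail_sum \<alpha> a - 0 \<le> total_mean \<alpha>"
    by (rule tendsto_upperbound) (auto intro: low eventually_sequentiallyI)
  then show "tail_sum \<alpha> a \<le> total_mean \<alpha> - mean_upto \<alpha> a" by simp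
  have "total_mean \<alpha> \<le> mean_upto \<alpha> a + (1 + 2 * ?q a) * tail_sum \<alpha> a"
    unfolding total_mean_def
  proof (rule suminf_le_const[OF summable_mean_term[OF \<alpha>]])
    fix n
    have "(\<Sum>k<n. real k * occ \<alpha> k) \<le> (\<Sum>k<Suc (max n a). real k * occ \<alpha> k)"
      using \<alpha> by (intro sum_mono2) (auto simp: occ_nonneg)
    also have "\<dots> = mean_upto \<alpha> (max n a)" by (rule sum_lessThan_eq_mean_upto)
    also have "\<dots> = mean_upto \<alpha> a + (\<Sum>k\<in>{a<..max n a}. real k * occ \<alpha> k)" by (rule split) simp
    also have "(\<Sum>k\<in>{a<..max n a}. real k * occ \<alpha> k) \<le> (\<Sum>k\<in>{a<..max n a}. (1 + 2 * ?q a) * (real k * ?q k))"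
    proof (rule sum_mono)
      fix k assume k: "k \<in> {a<..max n a}"
      have "occ \<alpha> k \<le> ?q k * (1 + 2 * ?q k)"
        using k by (intro occ_bounds \<alpha> order_trans[OF q h]) auto
      also have "\<dots> \<le> ?q k * (1 + 2 * ?q a)" using q[of k] k by (intro mult_left_mono) auto
      finally have "real k * occ \<alpha> k \<le> real k * (?q k * (1 + 2 * ?q a))" by (intro mult_left_mono) auto
      then show "real k * occ \<alpha> k \<le> (1 + 2 * ?q a) * (real k * ?q k)" by (simp add: mult_ac)
    qed
    also have "\<dots> = (1 + 2 * ?q a) * (tail_sum \<alpha> a - tail_sum \<alpha> (max n a))"
      unfolding sum_distrib_left[symmetric] by (subst tail_sum_diff[OF \<alpha>]) auto
    also have "\<dots> \<le> (1 + 2 * ?q a) * tail_sum \<alpha> a"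
      using tail_sum_nonneg[OF \<alpha>] by (intro mult_left_mono) (auto intro: add_nonneg_nonneg)
    finally show "(\<Sum>k<n. real k * occ \<alpha> k) \<le> mean_upto \<alpha> a + (1 + 2 * ?q a) * tail_sum \<alpha> a" by simp
  qed
  then show "total_mean \<alpha> - mean_upto \<alpha> a \<le> (1 + 2 * ?q a) * tail_sum \<alpha> a" by simp
qed

text \<open>The trivial bound for a probability, read off from the Fourier integral. It serves for
  peaks below the cutoff, where the local limit bound is not at hand.\<close>

lemma wt_le_1:
  assumes "0 < \<alpha>" shows "wt \<alpha> a b m \<le> 1"
proof -
  let ?f = "\<lambda>\<theta>. indicator {-pi..pi} \<theta> *\<^sub>R (cf2 \<alpha> a b \<theta> * cis (- (real m * \<theta>)))"
  have "norm (complex_of_real (2 * pi * wt \<alpha> a b m)) = norm (integral\<^sup>L lborel ?f)"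
    unfolding wt_fourier[OF assms] set_lebesgue_integral_def ..
  also have "\<dots> \<le> (LINT \<theta>|lborel. indicator {-pi..pi} \<theta> :: real)"
  proof (rule Bochner_Integration.integral_norm_bound_integral)
    show "integrable lborel ?f"
      unfolding set_integrable_def[symmetric]
      by (intro borel_integrable_atLeastAtMost' continuous_intros continuous_cf2 assms)
    show "norm (?f \<theta>) \<le> indicator {-pi..pi} \<theta>" for \<theta>
      using norm_cf2_le_1[OF assms, of a b \<theta>] by (simp add: norm_mult indicator_def)
  qed simp
  also have "\<dots> = 2 * pi" by simp
  finally have "2 * pi * wt \<alpha> a b m \<le> 2 * pi * 1" unfolding norm_of_real using abs_ge_self[of "2 * pi * wt \<alpha> a b m"] by linarith
  then show ?thesis by (rule mult_left_le_imp_le) simp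
qed

section \<open>The weighted number of unimodal sequences\<close>

lemma Zinv_split:
  assumes "p \<le> n" shows "Zinv \<alpha> n = Zinv \<alpha> p * (\<Prod>k\<in>{p<..n}. 1 - qpow \<alpha> k)"
proof -
  have "{1..n} = {1..p} \<union> {p<..n}" using assms by auto
  then show ?thesis unfolding Zinv_def by (simp only:) (rule prod.union_disjoint, auto)
qed

lemma sum_exp_interval:
  assumes "0 < \<alpha>" "p \<le> n"
  shows "(\<Sum>k\<in>{p<..n}. qpow \<alpha> k) = (qpow \<alpha> (Suc p) - qpow \<alpha> (Suc n)) / (1 - exp (- \<alpha>))"
  using assms(2)
proof (induction n rule: dec_induct)
  case (step n)
  define q where "q = exp (- \<alpha>)"
  have q: "0 < q" "q < 1" using assms by (auto simp: q_def)
  define r where "r = qpow \<alpha> (Suc n)"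
  have r2: "qpow \<alpha> (Suc (Suc n)) = q * r" by (simp add: q_def r_def algebra_simps flip: exp_add)
  have "{p<..Suc n} = insert (Suc n) {p<..n}" using step by auto
  then have "(\<Sum>k\<in>{p<..Suc n}. qpow \<alpha> k) = r + (qpow \<alpha> (Suc p) - r) / (1 - q)"
    using step by (simp add: r_def q_def)
  also have "\<dots> = (qpow \<alpha> (Suc p) - q * r) / (1 - q)" using q by (simp add: field_simps)
  finally show ?case unfolding r2 q_def[symmetric] .
qed simp

definition scale :: "nat \<Rightarrow> real" where
  "scale n = 1 / (B * sqrt (real n))"

text \<open>Chosen such that \<open>exp (- \<alpha> * cutoff \<alpha>)\<close> is of order \<open>sqrt \<alpha>\<close>.\<close>
definition cutoff :: "real \<Rightarrow> nat" where
  "cutoff \<alpha> = nat \<lceil>ln (1 / \<alpha>) / (2 * \<alpha>)\<rceil>"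

lemma B_pos: "0 < B" by (simp add: B_def)

lemma scale_pos: "0 < n \<Longrightarrow> 0 < scale n"
  by (simp add: scale_def B_pos)

lemma scale_tendsto: "scale \<longlonglongrightarrow> 0"
  unfolding scale_def using B_pos by real_asymp

lemma eventually_scale_pos: "\<forall>\<^sub>F n in sequentially. 0 < scale n"
  using eventually_gt_at_top[of 0] by eventually_elim (rule scale_pos)

lemma scale_at_right: "filterlim scale (at_right 0) sequentially"
  using scale_tendsto eventually_scale_pos by (simp add: filterlim_at eventually_mono)

lemma exp_minus_half_ln:
  assumes "0 < (\<alpha>::real)"
  shows "exp (- (ln (1 / \<alpha>) / 2)) = sqrt \<alpha>"
proof -
  have "sqrt \<alpha> = exp (ln (sqrt \<alpha>))" using assms by simp
  also have "ln (sqrt \<alpha>) = - (ln (1 / \<alpha>) / 2)" using assms by (simp add: ln_sqrt ln_div)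
  finally show ?thesis by simp
qed

lemma cutoff_bounds:
  assumes "0 < \<alpha>" "\<alpha> \<le> 1/2"
  shows "ln (1 / \<alpha>) / 2 \<le> \<alpha> * real (cutoff \<alpha>)"
    and "qpow \<alpha> (cutoff \<alpha>) \<le> sqrt \<alpha>"
    and "sqrt \<alpha> / 3 \<le> qpow \<alpha> (cutoff \<alpha>)"
    and "real (cutoff \<alpha>) \<le> 1 / \<alpha>\<^sup>2"
proof -
  have l: "0 \<le> ln (1 / \<alpha>)" using assms by (intro ln_ge_zero) auto
  then have nn: "0 \<le> ln (1 / \<alpha>) / (2 * \<alpha>)" using assms by simp
  have c: "ln (1 / \<alpha>) / (2 * \<alpha>) \<le> real (cutoff \<alpha>)" "real (cutoff \<alpha>) \<le> ln (1 / \<alpha>) / (2 * \<alpha>) + 1"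
    unfolding cutoff_def using nn by linarith+
  show 1: "ln (1 / \<alpha>) / 2 \<le> \<alpha> * real (cutoff \<alpha>)" using c(1) assms by (simp add: field_simps)
  note s = exp_minus_half_ln[OF assms(1)]
  show "qpow \<alpha> (cutoff \<alpha>) \<le> sqrt \<alpha>" unfolding s[symmetric] using 1 by simp
  have "\<alpha> * real (cutoff \<alpha>) \<le> ln (1 / \<alpha>) / 2 + \<alpha>" 
    using mult_left_mono[OF c(2), of \<alpha>] assms by (simp add: distrib_left)
  also have "\<dots> \<le> ln (1 / \<alpha>) / 2 + 1" using assms by simp
  finally have "exp (- (ln (1 / \<alpha>) / 2)) * exp (- 1) \<le> qpow \<alpha> (cutoff \<alpha>)"
    unfolding exp_add[symmetric] by simp
  \<comment> \<open>Rounding the cutoff up costs a factor of at least exp (- \<alpha>), estimated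
    here by 1/3.\<close>
  moreover have "1 / 3 \<le> exp (- 1 :: real)" using exp_le by (simp add: exp_minus inverse_eq_divide divide_le_cancel frac_le)
  then have "sqrt \<alpha> * (1 / 3) \<le> sqrt \<alpha> * exp (- 1)" using assms by (intro mult_left_mono) auto
  ultimately show "sqrt \<alpha> / 3 \<le> qpow \<alpha> (cutoff \<alpha>)" unfolding s by simp
  have "ln (1 / \<alpha>) \<le> 1 / \<alpha> - 1" using assms by (intro ln_le_minus_one) auto
  then have "ln (1 / \<alpha>) / (2 * \<alpha>) + 1 \<le> (1 / \<alpha> - 1) / (2 * \<alpha>) + 1" using assms by (intro add_mono divide_right_mono) auto
  also have "\<dots> = (1 - \<alpha> + 2 * \<alpha>\<^sup>2) / (2 * \<alpha>\<^sup>2)" using assms by (simp add: field_simps power2_eq_square)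
  also have "\<dots> \<le> 2 / (2 * \<alpha>\<^sup>2)"
  proof (intro divide_right_mono)
    have "\<alpha> * \<alpha> \<le> 1/2 * (1/2)" using assms by (intro mult_mono) auto
    then show "1 - \<alpha> + 2 * \<alpha>\<^sup>2 \<le> 2" using assms by (simp add: power2_eq_square)
  qed simp
  finally show "real (cutoff \<alpha>) \<le> 1 / \<alpha>\<^sup>2" using c(2) by simp
qed

lemma cutoff_at_top:
  assumes "\<alpha> \<longlonglongrightarrow> 0" "\<forall>\<^sub>F n in sequentially. 0 < \<alpha> n"
  shows "filterlim (\<lambda>n. \<alpha> n * real (cutoff (\<alpha> n))) at_top sequentially"
proof (rule filterlim_at_top_mono)
  have "filterlim (\<lambda>x::real. ln (1 / x) / 2) at_top (at_right 0)" by real_asymp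
  moreover have "filterlim \<alpha> (at_right 0) sequentially"
    using assms by (simp add: filterlim_at eventually_mono)
  ultimately show "filterlim (\<lambda>n. ln (1 / \<alpha> n) / 2) at_top sequentially" by (rule filterlim_compose)
  have "\<forall>\<^sub>F n in sequentially. \<alpha> n < 1/2" by (rule order_tendstoD(2)[OF assms(1)]) simp
  with assms(2) show "\<forall>\<^sub>F n in sequentially. ln (1 / \<alpha> n) / 2 \<le> \<alpha> n * real (cutoff (\<alpha> n))"
    by eventually_elim (rule cutoff_bounds, auto)
qed

text \<open>A Riemann sum for the integral of exp (- 2 * x), which is 1/2: the increments of exp (-
  2 * g * q^p) in p are about twice the summands, so the sum telescopes. The factor 1 - z pays for
  the second order, since q^p \<le> z from c on.\<close>

lemma boltzmann_peak_sum:
  assumes \<alpha>: "0 < \<alpha>" and c: "qpow \<alpha> c \<le> z" "z < 1" and "c \<le> n"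
  defines "g \<equiv> 1 / (1 - exp (- \<alpha>))"
  shows "(\<Sum>p\<in>{c..n}. qpow \<alpha> p * exp (- 2 * g * qpow \<alpha> (Suc p))) \<le> 1 / (2 * (1 - z))"
proof -
  let ?E = "\<lambda>p. exp (- 2 * g * qpow \<alpha> p)"
  have g: "0 < g" "g * (1 - exp (- \<alpha>)) = 1" using \<alpha> by (auto simp: g_def)
  have step: "2 * (1 - z) * (qpow \<alpha> p * ?E (Suc p)) \<le> ?E (Suc p) - ?E p" if "c \<le> p" for p
  proof -
    define x where "x = qpow \<alpha> p"
    have x: "0 \<le> x" "x \<le> z"
    proof -
      have "qpow \<alpha> p \<le> qpow \<alpha> c" using \<alpha> that by simp
      then show "x \<le> z" using c(1) unfolding x_def by linarith
    qed (simp add: x_def)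
    have "qpow \<alpha> (Suc p) = x * exp (- \<alpha>)" by (simp add: x_def algebra_simps flip: exp_add)
    then have "- 2 * g * x = - 2 * g * qpow \<alpha> (Suc p) + - 2 * (g * (1 - exp (- \<alpha>))) * x"
      by (simp add: algebra_simps)
    then have "?E p = ?E (Suc p) * exp (- (2 * x))"
      unfolding g(2) x_def[symmetric] by (simp add: exp_add[symmetric])
    moreover have "2 * (1 - z) * x \<le> 1 - exp (- (2 * x))"
    proof -
      have "exp (- (2 * x)) \<le> 1 - 2 * x + 2 * x\<^sup>2"
      proof -
        have "exp (- (2 * x)) * (1 + 2 * x + 2 * x\<^sup>2) \<le> exp (- (2 * x)) * exp (2 * x)"
          using exp_lower_Taylor_quadratic[of "2 * x"] x by (intro mult_left_mono) (auto simp: power2_eq_square)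
        also have "\<dots> = 1" by (simp flip: exp_add)
        \<comment> \<open>The product of the two quadratics is 1 + 4 * x^4, so the lower Taylor
          bound for exp (2 * x) yields an upper one for its reciprocal.\<close>
        also have "1 \<le> (1 - 2 * x + 2 * x\<^sup>2) * (1 + 2 * x + 2 * x\<^sup>2)"
        proof -
          have "(1 - 2 * x + 2 * x\<^sup>2) * (1 + 2 * x + 2 * x\<^sup>2) = 1 + 4 * (x\<^sup>2)\<^sup>2" by (simp add: power2_eq_square algebra_simps)
          then show ?thesis by simp
        qed
        finally show ?thesis using x by (elim mult_right_le_imp_le) (auto intro!: add_pos_nonneg)
      qed
      moreover have "x * x \<le> z * x" using x by (intro mult_right_mono) auto
      ultimately show ?thesis by (simp add: power2_eq_square algebra_simps)
    qed
    then have "?E (Suc p) * (2 * (1 - z) * x) \<le> ?E (Suc p) * (1 - exp (- (2 * x)))" by (intro mult_left_mono) auto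
    ultimately show ?thesis unfolding x_def[symmetric] by (simp add: algebra_simps)
  qed
  have "2 * (1 - z) * (\<Sum>p\<in>{c..n}. qpow \<alpha> p * ?E (Suc p)) \<le> (\<Sum>p\<in>{c..<Suc n}. ?E (Suc p) - ?E p)"
    unfolding sum_distrib_left atLeastLessThanSuc_atLeastAtMost by (intro sum_mono step) auto
  also have "\<dots> = ?E (Suc n) - ?E c" using assms by (intro sum_Suc_diff') simp
  also have "\<dots> \<le> 1"
  proof -
    have "?E (Suc n) \<le> 1" using g by simp
    then show ?thesis using exp_gt_zero[of "- 2 * g * qpow \<alpha> c"] by linarith
  qed
  finally show ?thesis using c by (simp add: pos_le_divide_eq mult.commute)
qed

lemma inverse_one_minus_exp_bounds:
  fixes \<alpha> :: real
  assumes "0 < \<alpha>"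
  shows "1 / \<alpha> \<le> 1 / (1 - exp (- \<alpha>))" "exp (- \<alpha>) / (1 - exp (- \<alpha>)) \<le> 1 / \<alpha>"
proof -
  have "1 - exp (- \<alpha>) \<le> \<alpha>" using exp_ge_add_one_self[of "- \<alpha>"] by simp
  then show "1 / \<alpha> \<le> 1 / (1 - exp (- \<alpha>))" using assms by (intro divide_left_mono) auto
  have "(1 + \<alpha>) * exp (- \<alpha>) \<le> exp \<alpha> * exp (- \<alpha>)" by (intro mult_right_mono exp_ge_add_one_self) auto
  then have "\<alpha> * exp (- \<alpha>) \<le> 1 - exp (- \<alpha>)" by (simp add: algebra_simps flip: exp_add)
  then show "exp (- \<alpha>) / (1 - exp (- \<alpha>)) \<le> 1 / \<alpha>" using assms by (simp add: field_simps)
qed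

text \<open>Relative to the model in which both sides may use all parts up to n, a peak p requires
  that no part exceeds p on either side. By 1 - x \<le> exp (- x) this has probability at most the
  second factor of the summand; the prefactor pays for stopping the geometric sum at n.\<close>

lemma unimodal_boltzmann_sum:
  assumes \<alpha>: "0 < \<alpha>"
  shows "real (card (unimodal_seqs n)) * qpow \<alpha> n * (Zinv \<alpha> n)\<^sup>2 \<le>
    exp (2 / \<alpha> * qpow \<alpha> n) *
    (\<Sum>p=1..n. qpow \<alpha> p * exp (- 2 * (1 / (1 - exp (- \<alpha>))) * qpow \<alpha> (Suc p)) * wt \<alpha> p p (n - p))"
proof -
  define g where "g = 1 / (1 - exp (- \<alpha>))"
  have g: "0 < g" using \<alpha> by (simp add: g_def)
  have "real (card (unimodal_seqs n)) * qpow \<alpha> n * (Zinv \<alpha> n)\<^sup>2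
     \<le> (\<Sum>p=1..n. real (num_pairs p p (n - p))) * qpow \<alpha> n * (Zinv \<alpha> n)\<^sup>2"
    using card_unimodal_seqs_le[of n] by (intro mult_right_mono) (auto simp flip: of_nat_sum)
  also have "\<dots> = (\<Sum>p=1..n. real (num_pairs p p (n - p)) * qpow \<alpha> n * (Zinv \<alpha> n)\<^sup>2)"
    by (simp add: sum_distrib_right)
  also have "\<dots> \<le> (\<Sum>p=1..n. exp (2 / \<alpha> * qpow \<alpha> n) * (qpow \<alpha> p * exp (- 2 * g * qpow \<alpha> (Suc p)) * wt \<alpha> p p (n - p)))"
  proof (rule sum_mono)
    fix p assume p: "p \<in> {1..n}"
    let ?R = "\<Prod>k\<in>{p<..n}. 1 - qpow \<alpha> k"
    have R0: "0 \<le> ?R" using \<alpha> by (intro prod_nonneg) auto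
    have e: "qpow \<alpha> n = qpow \<alpha> p * qpow \<alpha> (n - p)"
      using p by (simp add: algebra_simps of_nat_diff flip: exp_add)
    have "?R \<le> (\<Prod>k\<in>{p<..n}. exp (- qpow \<alpha> k))"
      using \<alpha> exp_ge_add_one_self[of "- qpow \<alpha> k" for k] by (intro prod_mono) auto
    also have "\<dots> = exp (- (\<Sum>k\<in>{p<..n}. qpow \<alpha> k))"
      by (simp add: exp_sum[symmetric] sum_negf)
    also have "\<dots> = exp (- (g * qpow \<alpha> (Suc p)) + g * qpow \<alpha> (Suc n))"
      using p by (subst sum_exp_interval[OF \<alpha>]) (auto simp: g_def diff_divide_distrib)
    also have "\<dots> \<le> exp (- (g * qpow \<alpha> (Suc p)) + 1 / \<alpha> * qpow \<alpha> n)"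
    proof -
      have "g * qpow \<alpha> (Suc n) = exp (- \<alpha>) / (1 - exp (- \<alpha>)) * qpow \<alpha> n"
        by (simp add: g_def algebra_simps flip: exp_add)
      also have "\<dots> \<le> 1 / \<alpha> * qpow \<alpha> n"
        by (intro mult_right_mono inverse_one_minus_exp_bounds \<alpha>) auto
      finally show ?thesis by simp
    qed
    finally have "?R\<^sup>2 \<le> (exp (- (g * qpow \<alpha> (Suc p)) + 1 / \<alpha> * qpow \<alpha> n))\<^sup>2"
      using R0 by (intro power_mono) auto
    also have "\<dots> = exp (- 2 * g * qpow \<alpha> (Suc p)) * exp (2 / \<alpha> * qpow \<alpha> n)"
      by (simp add: algebra_simps flip: exp_double exp_add)
    finally have R2: "?R\<^sup>2 \<le> exp (- 2 * g * qpow \<alpha> (Suc p)) * exp (2 / \<alpha> * qpow \<alpha> n)" .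
    have "real (num_pairs p p (n - p)) * qpow \<alpha> n * (Zinv \<alpha> n)\<^sup>2
       = (qpow \<alpha> p * wt \<alpha> p p (n - p)) * ?R\<^sup>2"
      using p unfolding e by (subst Zinv_split[of p n]) (auto simp: wt_def power_mult_distrib power2_eq_square)
    also have "\<dots> \<le> (qpow \<alpha> p * wt \<alpha> p p (n - p)) * (exp (- 2 * g * qpow \<alpha> (Suc p)) * exp (2 / \<alpha> * qpow \<alpha> n))"
      using R2 wt_nonneg[OF \<alpha>] by (intro mult_left_mono) auto
    finally show "real (num_pairs p p (n - p)) * qpow \<alpha> n * (Zinv \<alpha> n)\<^sup>2 \<le>
      exp (2 / \<alpha> * qpow \<alpha> n) * (qpow \<alpha> p * exp (- 2 * g * qpow \<alpha> (Suc p)) * wt \<alpha> p p (n - p))"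
      by (simp only: mult_ac)
  qed
  finally show ?thesis unfolding g_def sum_distrib_left .
qed

text \<open>For peaks above the cutoff \<open>wt\<close> is at most about 1 / (sqrt (2 * pi) *
  sdev), and the remaining factors sum to about 1/2. Each smaller peak carries a factor at most exp
  (- (2/3) / sqrt \<alpha>), and there are at most \<alpha>^(-2) of them.\<close>

lemma card_unimodal_seqs_asymp:
  assumes \<epsilon>: "0 < \<epsilon>"
  shows "\<forall>\<^sub>F n in sequentially. 2 * pi * sdev (scale n) *
     (real (card (unimodal_seqs n)) * qpow (scale n) n * (Zinv (scale n) n)\<^sup>2) \<le> (sqrt (2 * pi) + \<epsilon>) / 2"
proof -
  define \<epsilon>' where "\<epsilon>' = \<epsilon> / 2"
  \<comment> \<open>The explicit final bound: the main term, then the total of the peaks below the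
    cutoff with \<open>sdev\<close> and their number replaced by upper bounds.\<close>
  define A where "A n = exp (2 / scale n * qpow (scale n) n) *
     ((sqrt (2 * pi) + \<epsilon>') * (1 / (2 * (1 - sqrt (scale n)))) + 2 * pi * (sqrt (40 / scale n ^ 3) * (1 / (scale n)\<^sup>2 * exp (- (2 / 3) / sqrt (scale n)))))" for n
  have "A \<longlonglongrightarrow> exp (2 * 0) * ((sqrt (2 * pi) + \<epsilon>') * (1 / (2 * (1 - 0))) + 2 * pi * 0)"
  proof -
    have 1: "(\<lambda>n. qpow (scale n) n / scale n) \<longlonglongrightarrow> 0"
      unfolding scale_def using B_pos by real_asymp
    have "((\<lambda>x::real. sqrt (40 / x ^ 3) * (1 / x\<^sup>2 * exp (- (2 / 3) / sqrt x))) \<longlongrightarrow> 0) (at_right 0)"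
      by real_asymp
    from filterlim_compose[OF this scale_at_right]
    have 2: "(\<lambda>n. sqrt (40 / scale n ^ 3) * (1 / (scale n)\<^sup>2 * exp (- (2 / 3) / sqrt (scale n)))) \<longlonglongrightarrow> 0" .
    have 3: "(\<lambda>n. sqrt (scale n)) \<longlonglongrightarrow> 0" using tendsto_real_sqrt[OF scale_tendsto] by simp
    have "(\<lambda>n. exp (2 * (qpow (scale n) n / scale n)) *
     ((sqrt (2 * pi) + \<epsilon>') * (1 / (2 * (1 - sqrt (scale n)))) + 2 * pi * (sqrt (40 / scale n ^ 3) * (1 / (scale n)\<^sup>2 * exp (- (2 / 3) / sqrt (scale n))))))
      \<longlonglongrightarrow> exp (2 * 0) * ((sqrt (2 * pi) + \<epsilon>') * (1 / (2 * (1 - 0))) + 2 * pi * 0)"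
      by (intro tendsto_mult tendsto_exp tendsto_add tendsto_const tendsto_divide tendsto_diff 1 2 3) simp
    then show ?thesis by (simp add: A_def[abs_def])
  qed
  then have "A \<longlonglongrightarrow> (sqrt (2 * pi) + \<epsilon>') / 2" by simp
  then have evA: "\<forall>\<^sub>F n in sequentially. A n < (sqrt (2 * pi) + \<epsilon>) / 2"
    by (rule order_tendstoD) (use \<epsilon> in \<open>simp add: \<epsilon>'_def\<close>)
  have evl: "\<forall>\<^sub>F n in sequentially. \<forall>a\<ge>cutoff (scale n). \<forall>b\<ge>cutoff (scale n). llt_err (scale n) a b < \<epsilon>'"
    by (rule llt_err_uniform[OF scale_tendsto eventually_scale_pos cutoff_at_top[OF scale_tendsto eventually_scale_pos]])
       (use \<epsilon> in \<open>simp add: \<epsilon>'_def\<close>)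
  have ev11: "\<forall>\<^sub>F n in sequentially. 11 \<le> scale n * real (cutoff (scale n))"
    using cutoff_at_top[OF scale_tendsto eventually_scale_pos] unfolding filterlim_at_top by blast
  have ev2: "\<forall>\<^sub>F n in sequentially. scale n < 1/2" by (rule order_tendstoD(2)[OF scale_tendsto]) simp
  have "\<forall>\<^sub>F n in sequentially. real n * scale n \<ge> ln (1 / scale n) / 2 + 1"
    unfolding scale_def using B_pos by real_asymp
  from evA evl ev11 ev2 eventually_scale_pos this show ?thesis
  proof eventually_elim
    case (elim n)
    define \<alpha> where "\<alpha> = scale n"
    define c where "c = cutoff \<alpha>"
    have \<alpha>: "0 < \<alpha>" "\<alpha> \<le> 1/2" using elim by (auto simp: \<alpha>_def)
    define g where "g = 1 / (1 - exp (- \<alpha>))"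
    have g: "1 / \<alpha> \<le> g" unfolding g_def by (rule inverse_one_minus_exp_bounds[OF \<alpha>(1)])
    have g0: "0 < g" using \<alpha> by (simp add: g_def)
    define \<sigma> where "\<sigma> = sdev \<alpha>"
    have \<sigma>: "0 < \<sigma>" "\<sigma> \<le> sqrt (40 / \<alpha> ^ 3)"
      using sdev_pos[OF \<alpha>] real_le_rsqrt[OF sdev_upper[OF \<alpha>(1)]] by (auto simp: \<sigma>_def)
    define T where "T p = qpow \<alpha> p * exp (- 2 * g * qpow \<alpha> (Suc p))" for p
    have T0: "0 \<le> T p" for p by (simp add: T_def)
    have cn: "c \<le> n"
    proof -
      have "\<alpha> * real c \<le> ln (1 / \<alpha>) / 2 + \<alpha>"
      proof -
        have "0 \<le> ln (1 / \<alpha>) / (2 * \<alpha>)" using \<alpha> by (intro divide_nonneg_nonneg ln_ge_zero) auto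
        then have "real c \<le> ln (1 / \<alpha>) / (2 * \<alpha>) + 1" unfolding c_def cutoff_def by linarith
        from mult_left_mono[OF this, of \<alpha>] show ?thesis using \<alpha> by (simp add: distrib_left)
      qed
      also have "\<dots> \<le> \<alpha> * real n" using elim \<alpha> by (simp add: \<alpha>_def mult.commute)
      finally show ?thesis using \<alpha> by simp
    qed
    have big: "2 * pi * \<sigma> * wt \<alpha> p p m \<le> sqrt (2 * pi) + \<epsilon>'" if "c \<le> p" for p m
    proof -
      have "\<alpha> * real c \<le> \<alpha> * real p" using that \<alpha> by (intro mult_left_mono) auto
      then have "11 \<le> \<alpha> * real p" using elim(3) by (simp add: \<alpha>_def c_def)
      from wt_gauss(1)[OF \<alpha> this, of p m] show ?thesis
        using elim(2) that unfolding \<sigma>_def \<alpha>_def c_def by (smt (verit, best))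
    qed
    have small: "T p * wt \<alpha> p p (n - p) \<le> exp (- (2 / 3) / sqrt \<alpha>)" if "p < c" for p
    proof -
      have "T p * wt \<alpha> p p (n - p) \<le> (1 * exp (- 2 * g * qpow \<alpha> (Suc p))) * 1"
        unfolding T_def using \<alpha> wt_nonneg[OF \<alpha>(1)] wt_le_1[OF \<alpha>(1)] by (intro mult_mono) auto
      also have "\<dots> \<le> exp (- (2 / 3) / sqrt \<alpha>)"
      proof -
        have "1 / \<alpha> * (sqrt \<alpha> / 3) \<le> g * qpow \<alpha> (Suc p)"
        proof (intro mult_mono g)
          have "sqrt \<alpha> / 3 \<le> qpow \<alpha> c" unfolding c_def by (rule cutoff_bounds[OF \<alpha>])
          also have "\<dots> \<le> qpow \<alpha> (Suc p)" using that \<alpha> by simp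
          finally show "sqrt \<alpha> / 3 \<le> qpow \<alpha> (Suc p)" .
        qed (use \<alpha> g0 in auto)
        moreover have "1 / \<alpha> * (sqrt \<alpha> / 3) = 1 / 3 / sqrt \<alpha>"
          using \<alpha> real_sqrt_mult_self[of \<alpha>] by (simp add: field_simps)
        ultimately show ?thesis by simp
      qed
      finally show ?thesis .
    qed
    have sub: "{1..n} \<subseteq> {c..n} \<union> {..<c}" by auto
    have "2 * pi * \<sigma> * (\<Sum>p=1..n. T p * wt \<alpha> p p (n - p)) \<le>
        2 * pi * \<sigma> * ((\<Sum>p\<in>{c..n}. T p * wt \<alpha> p p (n - p)) + (\<Sum>p<c. T p * wt \<alpha> p p (n - p)))"
    proof (intro mult_left_mono)
      have "(\<Sum>p=1..n. T p * wt \<alpha> p p (n - p)) \<le> (\<Sum>p\<in>{c..n} \<union> {..<c}. T p * wt \<alpha> p p (n - p))"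
        using sub T0 wt_nonneg[OF \<alpha>(1)] by (intro sum_mono2) auto
      also have "\<dots> = (\<Sum>p\<in>{c..n}. T p * wt \<alpha> p p (n - p)) + (\<Sum>p<c. T p * wt \<alpha> p p (n - p))"
        by (rule sum.union_disjoint) auto
      finally show "(\<Sum>p=1..n. T p * wt \<alpha> p p (n - p)) \<le> (\<Sum>p\<in>{c..n}. T p * wt \<alpha> p p (n - p)) + (\<Sum>p<c. T p * wt \<alpha> p p (n - p))" .
    qed (use \<sigma> in simp)
    also have "\<dots> = (\<Sum>p\<in>{c..n}. T p * (2 * pi * \<sigma> * wt \<alpha> p p (n - p))) + 2 * pi * (\<sigma> * (\<Sum>p<c. T p * wt \<alpha> p p (n - p)))"
      by (simp add: algebra_simps sum_distrib_left)
    also have "\<dots> \<le> (\<Sum>p\<in>{c..n}. T p * (sqrt (2 * pi) + \<epsilon>')) + 2 * pi * (sqrt (40 / \<alpha> ^ 3) * (1 / \<alpha>\<^sup>2 * exp (- (2 / 3) / sqrt \<alpha>)))"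
    proof (intro add_mono sum_mono mult_left_mono mult_mono)
      have "(\<Sum>p<c. T p * wt \<alpha> p p (n - p)) \<le> (\<Sum>p<c. exp (- (2 / 3) / sqrt \<alpha>))"
        using small by (intro sum_mono) auto
      also have "\<dots> = real c * exp (- (2 / 3) / sqrt \<alpha>)" by simp
      also have "\<dots> \<le> 1 / \<alpha>\<^sup>2 * exp (- (2 / 3) / sqrt \<alpha>)"
        unfolding c_def by (intro mult_right_mono cutoff_bounds \<alpha>) simp
      finally show "(\<Sum>p<c. T p * wt \<alpha> p p (n - p)) \<le> 1 / \<alpha>\<^sup>2 * exp (- (2 / 3) / sqrt \<alpha>)" .
    qed (use big \<sigma> T0 \<alpha> wt_nonneg[OF \<alpha>(1)] in \<open>auto intro!: sum_nonneg\<close>)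
    also have "(\<Sum>p\<in>{c..n}. T p * (sqrt (2 * pi) + \<epsilon>')) = (sqrt (2 * pi) + \<epsilon>') * (\<Sum>p\<in>{c..n}. T p)"
      by (subst mult.commute) (rule sum_distrib_right[symmetric])
    also have "\<dots> \<le> (sqrt (2 * pi) + \<epsilon>') * (1 / (2 * (1 - sqrt \<alpha>)))"
    proof (intro mult_left_mono)
      have "qpow \<alpha> c \<le> sqrt \<alpha>" unfolding c_def by (rule cutoff_bounds[OF \<alpha>])
      moreover have "sqrt \<alpha> < 1" using \<alpha> by simp
      ultimately show "(\<Sum>p\<in>{c..n}. T p) \<le> 1 / (2 * (1 - sqrt \<alpha>))"
        unfolding T_def g_def using cn \<alpha> by (intro boltzmann_peak_sum) auto
    qed (use \<epsilon> in \<open>simp add: \<epsilon>'_def\<close>)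
    finally have main: "2 * pi * \<sigma> * (\<Sum>p=1..n. T p * wt \<alpha> p p (n - p)) \<le>
       (sqrt (2 * pi) + \<epsilon>') * (1 / (2 * (1 - sqrt \<alpha>))) + 2 * pi * (sqrt (40 / \<alpha> ^ 3) * (1 / \<alpha>\<^sup>2 * exp (- (2 / 3) / sqrt \<alpha>)))" by simp
    have "2 * pi * \<sigma> * (real (card (unimodal_seqs n)) * qpow \<alpha> n * (Zinv \<alpha> n)\<^sup>2) \<le>
       2 * pi * \<sigma> * (exp (2 / \<alpha> * qpow \<alpha> n) * (\<Sum>p=1..n. T p * wt \<alpha> p p (n - p)))"
      using unimodal_boltzmann_sum[OF \<alpha>(1), of n] \<sigma> unfolding T_def g_def by (intro mult_left_mono) auto
    also have "\<dots> = exp (2 / \<alpha> * qpow \<alpha> n) * (2 * pi * \<sigma> * (\<Sum>p=1..n. T p * wt \<alpha> p p (n - p)))"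
      by (simp only: mult_ac)
    also have "\<dots> \<le> A n" unfolding A_def \<alpha>_def[symmetric] by (intro mult_left_mono main) simp
    also have "\<dots> \<le> (sqrt (2 * pi) + \<epsilon>) / 2" using elim by simp
    finally show ?case unfolding \<sigma>_def \<alpha>_def .
  qed
qed

section \<open>Integration along decreasing chains\<close>

lemma nn_integral_FTC_atMost:
  fixes f F :: "real \<Rightarrow> real"
  assumes f: "f \<in> borel_measurable borel" and F: "\<And>x. x \<le> a \<Longrightarrow> (F has_real_derivative f x) (at x)"
    and nn: "\<And>x. x \<le> a \<Longrightarrow> 0 \<le> f x" and lim: "(F \<longlongrightarrow> T) at_bot"
  shows "(\<integral>\<^sup>+x. ennreal (f x) * indicator {..a} x \<partial>lborel) = ennreal (F a - T)"
proof -
  have "(\<integral>\<^sup>+x. ennreal (f x) * indicator {..a} x \<partial>lborel)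
      = (\<integral>\<^sup>+x. ennreal (f (0 + (-1) * x)) * indicator {..a} (0 + (-1) * x) \<partial>lborel)"
    using f by (subst nn_integral_real_affine[where c = "-1" and t = 0]) auto
  also have "\<dots> = (\<integral>\<^sup>+x. ennreal (f (- x)) * indicator {- a..} x \<partial>lborel)"
    by (intro nn_integral_cong) (auto simp: indicator_def)
  also have "\<dots> = ennreal (- T - (- F (- (- a))))"
  proof (rule nn_integral_FTC_atLeast[where F = "\<lambda>x. - F (- x)"])
    show "(\<lambda>x. f (- x)) \<in> borel_measurable borel" using f by measurable
    show "((\<lambda>x. - F (- x)) has_real_derivative f (- x)) (at x)" if "- a \<le> x" for x
    proof -
      have "((\<lambda>x. F (- x)) has_real_derivative f (- x) * (- 1)) (at x)"
        by (rule DERIV_chain2[OF F]) (use that in \<open>auto intro!: derivative_eq_intros\<close>)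
      from DERIV_minus[OF this] show ?thesis by simp
    qed
    show "((\<lambda>x. - F (- x)) \<longlongrightarrow> - T) at_top"
      by (intro tendsto_minus filterlim_compose[OF lim filterlim_uminus_at_bot_at_top])
  qed (use nn in auto)
  finally show ?thesis by simp
qed

lemma nn_integral_FTC_UNIV:
  fixes f F :: "real \<Rightarrow> real"
  assumes f: "f \<in> borel_measurable borel" and F: "\<And>x. (F has_real_derivative f x) (at x)"
    and nn: "\<And>x. 0 \<le> f x" and lim: "(F \<longlongrightarrow> A) at_bot" "(F \<longlongrightarrow> T) at_top"
  shows "(\<integral>\<^sup>+x. ennreal (f x) \<partial>lborel) = ennreal (T - A)"
proof -
  have mono: "F x \<le> F y" if "x \<le> y" for x y
    by (rule DERIV_nonneg_imp_nondecreasing[OF that]) (use F nn in blast)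
  have A: "A \<le> F 0" by (rule tendsto_upperbound[OF lim(1)]) (auto intro: mono eventually_at_bot_linorderI[of 0])
  have T: "F 0 \<le> T" by (rule tendsto_lowerbound[OF lim(2)]) (auto intro: mono eventually_at_top_linorderI[of 0])
  have "(\<integral>\<^sup>+x. ennreal (f x) \<partial>lborel)
      = (\<integral>\<^sup>+x. ennreal (f x) * indicator {..0} x + ennreal (f x) * indicator {0..} x \<partial>lborel)"
  proof (rule nn_integral_cong_AE)
    have "AE x in lborel. x \<noteq> (0::real)" by (rule AE_lborel_singleton)
    then show "AE x in lborel. ennreal (f x) = ennreal (f x) * indicator {..0} x + ennreal (f x) * indicator {0..} x"
      by eventually_elim (auto simp: indicator_def)
  qed
  also have "\<dots> = ennreal (F 0 - A) + ennreal (T - F 0)"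
    using f nn_integral_FTC_atMost[OF f F nn lim(1), of 0] nn_integral_FTC_atLeast[of f 0 F T] F nn lim(2)
    by (subst nn_integral_add) auto
  also have "\<dots> = ennreal (T - A)" using A T by (simp flip: ennreal_plus)
  finally show ?thesis .
qed

text \<open>The variable in which the coordinates become a Poisson process of rate 1.\<close>
definition xi :: "real \<Rightarrow> real" where
  "xi y = exp (- y) / 2"

lemma xi_pos: "0 < xi y" by (simp add: xi_def)

lemma DERIV_xi: "(xi has_real_derivative - xi y) (at y)"
  unfolding xi_def[abs_def] by (auto intro!: derivative_eq_intros)

lemma xi_measurable [measurable]: "xi \<in> borel_measurable borel"
  unfolding xi_def[abs_def] by measurable

lemma xi_at_top: "(xi \<longlongrightarrow> 0) at_top"
  unfolding xi_def[abs_def] by real_asymp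

lemma xi_at_bot: "filterlim xi at_top at_bot"
  unfolding xi_def[abs_def] by real_asymp

text \<open>With x = xi y one has dy = - dx / x, which turns this into Euler's integral for m! and
  explains the exponent \<open>Suc m\<close>. \<open>G\<close> is the normalised upper incomplete
  Gamma function.\<close>

lemma nn_integral_gamma_xi:
  "(\<integral>\<^sup>+y. ennreal (xi y ^ Suc m * exp (- xi y)) \<partial>lborel) = ennreal (fact m)"
proof -
  define G where "G x = (\<Sum>i\<le>m. x ^ i / fact i) * exp (- x)" for x :: real
  have dG: "(G has_real_derivative - (x ^ m / fact m * exp (- x))) (at x)" for x
    unfolding G_def[abs_def]
  proof (induction m)
    case (Suc m)
    have "real (Suc m) * x ^ (Suc m - Suc 0) / fact (Suc m) = x ^ m / fact m"
      by (simp del: of_nat_Suc)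
    then have d1: "((\<lambda>x. x ^ Suc m / fact (Suc m)) has_real_derivative x ^ m / fact m) (at x)"
      using DERIV_cdivide[OF DERIV_pow[of "Suc m" x], of "fact (Suc m)"] by (simp only:)
    have d2: "((\<lambda>x. exp (- x)) has_real_derivative - exp (- x)) (at x)"
      by (auto intro!: derivative_eq_intros)
    from DERIV_add[OF Suc.IH DERIV_mult[OF d1 d2]]
    have "((\<lambda>x. (\<Sum>i\<le>m. x ^ i / fact i) * exp (- x) + x ^ Suc m / fact (Suc m) * exp (- x)) has_real_derivative
        - (x ^ Suc m / fact (Suc m) * exp (- x))) (at x)"
      by (simp del: power_Suc fact_Suc add: mult.commute)
    then show ?case by (simp only: sum.atMost_Suc distrib_right)
  qed (auto intro!: derivative_eq_intros)
  have "(\<integral>\<^sup>+y. ennreal (xi y ^ Suc m / fact m * exp (- xi y)) \<partial>lborel) = ennreal (1 - 0)"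
  proof (rule nn_integral_FTC_UNIV[where F = "\<lambda>y. G (xi y)"])
    show "((\<lambda>y. G (xi y)) has_real_derivative xi y ^ Suc m / fact m * exp (- xi y)) (at y)" for y
      using DERIV_chain2[OF dG DERIV_xi, of y] by (simp add: mult_ac)
    show "0 \<le> xi y ^ Suc m / fact m * exp (- xi y)" for y
      using xi_pos[of y] by simp
    have "isCont G 0" using dG DERIV_isCont by blast
    from isCont_tendsto_compose[OF this xi_at_top] have "((\<lambda>y. G (xi y)) \<longlongrightarrow> G 0) at_top" .
    moreover have "(\<Sum>i\<le>m. 0 ^ i / fact i) = (1::real)" by (induction m) auto
    ultimately show "((\<lambda>y. G (xi y)) \<longlongrightarrow> 1) at_top" by (simp add: G_def)
    have "((\<lambda>x::real. x ^ i / fact i * exp (- x)) \<longlongrightarrow> 0) at_top" for i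
      using tendsto_mult[OF tendsto_const tendsto_power_div_exp_0[of i], of "1 / fact i"]
      by (simp add: exp_minus inverse_eq_divide)
    then have "((\<lambda>x. \<Sum>i\<le>m. x ^ i / fact i * exp (- x)) \<longlongrightarrow> (\<Sum>i\<le>m. 0)) (at_top :: real filter)"
      by (intro tendsto_sum)
    then have "(G \<longlongrightarrow> 0) at_top" by (simp add: G_def[abs_def] sum_distrib_right)
    then show "((\<lambda>y. G (xi y)) \<longlongrightarrow> 0) at_bot"
      using filterlim_compose xi_at_bot by blast
  qed measurable
  then have "ennreal (fact m) * (\<integral>\<^sup>+y. ennreal (xi y ^ Suc m / fact m * exp (- xi y)) \<partial>lborel) = ennreal (fact m)" by simp
  then show ?thesis
    by (subst (asm) nn_integral_cmult[symmetric]) (simp_all add: ennreal_mult'[symmetric])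
qed

section \<open>Integrating a chain from its lowest coordinate\<close>

abbreviation lborel_Pi :: "'i set \<Rightarrow> ('i \<Rightarrow> real) measure" where
  "lborel_Pi I \<equiv> \<Pi>\<^sub>M i\<in>I. lborel"

interpretation lborel_prod: product_sigma_finite "\<lambda>_. lborel :: real measure"
  by (rule product_sigma_finite.intro) (rule sigma_finite_lborel)

text \<open>In the variables xi (u (c i)), which increase along the chain,
  \<open>chain_weight c k u * exp (- xi (u (c k)))\<close> is exp (- xi (u (c 0))) times the density
  of the next k points of a Poisson process of rate 1.\<close>

primrec chain_weight :: "(nat \<Rightarrow> 'i) \<Rightarrow> nat \<Rightarrow> ('i \<Rightarrow> real) \<Rightarrow> real" where
  "chain_weight c 0 u = 1"
| "chain_weight c (Suc k) u = chain_weight c k u * (if u (c (Suc k)) \<le> u (c k) then xi (u (c (Suc k))) else 0)"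

lemma chain_weight_nonneg: "0 \<le> chain_weight c k u"
  by (induction k) (auto simp: xi_pos less_imp_le)

lemma chain_weight_cong: "(\<And>i. i \<le> k \<Longrightarrow> u (c i) = w (c i)) \<Longrightarrow> chain_weight c k u = chain_weight c k w"
  by (induction k) auto

lemma component_measurable:
  "i \<in> I \<Longrightarrow> (\<lambda>u. u i) \<in> borel_measurable (lborel_Pi I)"
  using measurable_component_singleton[of i I "\<lambda>_. lborel"] by simp

lemma chain_weight_measurable:
  "c ` {..k} \<subseteq> I \<Longrightarrow> chain_weight c k \<in> borel_measurable (lborel_Pi I)"
proof (induction k)
  case 0
  have "(\<lambda>u. 1) \<in> borel_measurable (lborel_Pi I)" by measurable
  also have "(\<lambda>u. 1) = chain_weight c 0" by (rule ext) simp
  finally show ?case .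
next
  case (Suc k)
  have "c k \<in> I" "c (Suc k) \<in> I" and sub: "c ` {..k} \<subseteq> I"
    using Suc.prems by (simp_all add: image_subset_iff)
  note [measurable] = this(1,2)[THEN component_measurable]
  note [measurable] = Suc.IH[OF sub]
  have "(\<lambda>u. chain_weight c k u * (if u (c (Suc k)) \<le> u (c k) then xi (u (c (Suc k))) else 0)) \<in> borel_measurable (lborel_Pi I)"
    by measurable
  also have "(\<lambda>u. chain_weight c k u * (if u (c (Suc k)) \<le> u (c k) then xi (u (c (Suc k))) else 0)) = chain_weight c (Suc k)"
    by (rule ext) simp
  finally show ?case .
qed

lemma nn_integral_bottom:
  "(\<integral>\<^sup>+y. ennreal ((if y \<le> x then xi y else 0) * exp (- xi y)) \<partial>lborel) = ennreal (exp (- xi x))"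
proof -
  have "(\<integral>\<^sup>+y. ennreal ((if y \<le> x then xi y else 0) * exp (- xi y)) \<partial>lborel)
      = (\<integral>\<^sup>+y. ennreal (xi y * exp (- xi y)) * indicator {..x} y \<partial>lborel)"
    by (intro nn_integral_cong) (auto simp: indicator_def)
  also have "\<dots> = ennreal (exp (- xi x) - 0)"
  proof (rule nn_integral_FTC_atMost)
    show "((\<lambda>y. exp (- xi y)) has_real_derivative xi y * exp (- xi y)) (at y)" for y
      by (auto intro!: derivative_eq_intros DERIV_xi)
    show "((\<lambda>y. exp (- xi y)) \<longlongrightarrow> 0) at_bot"
      by (rule filterlim_compose[OF exp_at_bot]) (simp add: filterlim_uminus_at_top[symmetric] xi_at_bot)
  qed (auto simp: xi_pos less_imp_le)
  finally show ?thesis by simp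
qed

text \<open>Memorylessness: integrating out the lowest point reproduces the factor exp (- xi y) one
  step higher. Nonnegative values let Tonelli's theorem apply to every measurable \<open>h\<close>
  that ignores the lowest coordinate.\<close>

lemma peel_bottom:
  fixes h :: "('i \<Rightarrow> real) \<Rightarrow> ennreal" and c :: "nat \<Rightarrow> 'i"
  assumes I: "finite I" "c ` {..k} \<subseteq> I" "c (Suc k) \<notin> I"
    and h: "h \<in> borel_measurable (lborel_Pi (insert (c (Suc k)) I))"
    and indep: "\<And>u y. h (u(c (Suc k) := y)) = h u"
  shows "(\<integral>\<^sup>+u. h u * ennreal (chain_weight c (Suc k) u * exp (- xi (u (c (Suc k))))) \<partial>lborel_Pi (insert (c (Suc k)) I))
       = (\<integral>\<^sup>+u. h u * ennreal (chain_weight c k u * exp (- xi (u (c k)))) \<partial>lborel_Pi I)"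
proof -
  let ?i = "c (Suc k)"
  have ne: "c j \<noteq> ?i" if "j \<le> k" for j using I that by auto
  note [measurable] = h
  have "c ` {..Suc k} \<subseteq> insert (c (Suc k)) I" using I(2) by (auto simp: atMost_Suc)
  have "?i \<in> insert ?i I" by simp
  note [measurable] = component_measurable[OF this]
  from chain_weight_measurable[OF \<open>c ` {..Suc k} \<subseteq> _\<close>]
  have [measurable]: "chain_weight c (Suc k) \<in> borel_measurable (lborel_Pi (insert (c (Suc k)) I))" .
  have "(\<integral>\<^sup>+u. h u * ennreal (chain_weight c (Suc k) u * exp (- xi (u ?i))) \<partial>lborel_Pi (insert ?i I))
     = (\<integral>\<^sup>+u. (\<integral>\<^sup>+y. h (u(?i := y)) * ennreal (chain_weight c (Suc k) (u(?i := y)) * exp (- xi ((u(?i := y)) ?i))) \<partial>lborel) \<partial>lborel_Pi I)"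
    by (rule lborel_prod.product_nn_integral_insert[OF I(1,3)]) measurable
  also have "\<dots> = (\<integral>\<^sup>+u. h u * ennreal (chain_weight c k u * exp (- xi (u (c k)))) \<partial>lborel_Pi I)"
  proof (rule nn_integral_cong)
    fix u :: "'i \<Rightarrow> real"
    have cw: "chain_weight c k (u(?i := y)) = chain_weight c k u" for y
      by (rule chain_weight_cong) (use ne in auto)
    have "(\<integral>\<^sup>+y. h (u(?i := y)) * ennreal (chain_weight c (Suc k) (u(?i := y)) * exp (- xi ((u(?i := y)) ?i))) \<partial>lborel)
       = (\<integral>\<^sup>+y. (h u * ennreal (chain_weight c k u)) * ennreal ((if y \<le> u (c k) then xi y else 0) * exp (- xi y)) \<partial>lborel)"
      unfolding indep chain_weight.simps cw using ne[of k] chain_weight_nonneg[of c k u]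
      by (intro nn_integral_cong) (simp add: ennreal_mult'[symmetric] mult.assoc)
    also have "\<dots> = (h u * ennreal (chain_weight c k u)) * ennreal (exp (- xi (u (c k))))"
      by (subst nn_integral_cmult) (auto simp: nn_integral_bottom)
    finally show "(\<integral>\<^sup>+y. h (u(?i := y)) * ennreal (chain_weight c (Suc k) (u(?i := y)) * exp (- xi ((u(?i := y)) ?i))) \<partial>lborel)
      = h u * ennreal (chain_weight c k u * exp (- xi (u (c k))))"
      using chain_weight_nonneg[of c k u] by (simp add: ennreal_mult'[symmetric] mult.assoc)
  qed
  finally show ?thesis .
qed

section \<open>Integrating a chain from its highest coordinate\<close>

primrec top_weight :: "(nat \<Rightarrow> 'i) \<Rightarrow> nat \<Rightarrow> ('i \<Rightarrow> real) \<Rightarrow> real" where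
  "top_weight c 0 u = exp (- u (c 0))"
| "top_weight c (Suc k) u = top_weight c k u * (if u (c (Suc k)) \<le> u (c k) then exp (- u (c (Suc k))) else 0)"

text \<open>The total excess of the upper coordinates over the lowest one (see
  \<open>spread_eq\<close>), in Abel-summed form: each new coordinate adds one weighted gap, which
  one integration can handle.\<close>

primrec spread :: "(nat \<Rightarrow> 'i) \<Rightarrow> nat \<Rightarrow> ('i \<Rightarrow> real) \<Rightarrow> real" where
  "spread c 0 u = 0"
| "spread c (Suc k) u = spread c k u + real (Suc k) * (u (c k) - u (c (Suc k)))"

lemma spread_eq: "spread c k u = (\<Sum>i<k. u (c i)) - real k * u (c k)"
  by (induction k) (auto simp: algebra_simps)

lemma top_weight_nonneg: "0 \<le> top_weight c k u"
  by (induction k) auto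

text \<open>Where the coordinates do not decrease, \<open>spread\<close> may be negative, but there
  the weight vanishes. Nonnegativity is needed to split the product in
  \<open>ennreal\<close>.\<close>

lemma top_weight_spread_nonneg: "0 \<le> top_weight c k u * spread c k u"
proof (induction k)
  case (Suc k)
  show ?case
  proof (cases "u (c (Suc k)) \<le> u (c k)")
    case True
    have "top_weight c (Suc k) u * spread c (Suc k) u = exp (- u (c (Suc k))) *
        (top_weight c k u * spread c k u + top_weight c k u * (real (Suc k) * (u (c k) - u (c (Suc k)))))"
      using True by (simp add: algebra_simps)
    moreover have "0 \<le> \<dots>" using Suc True top_weight_nonneg[of c k u]
      by (intro mult_nonneg_nonneg[OF exp_ge_zero add_nonneg_nonneg[OF Suc mult_nonneg_nonneg[OF top_weight_nonneg]]]) simp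
    ultimately show ?thesis by (simp only:)
  qed simp
qed simp

lemma top_weight_cong: "(\<And>i. i \<le> k \<Longrightarrow> u (c i) = w (c i)) \<Longrightarrow> top_weight c k u = top_weight c k w"
  by (induction k) auto

lemma spread_cong: "(\<And>i. i \<le> k \<Longrightarrow> u (c i) = w (c i)) \<Longrightarrow> spread c k u = spread c k w"
  by (induction k) auto

lemma top_weight_measurable:
  "c ` {..k} \<subseteq> I \<Longrightarrow> top_weight c k \<in> borel_measurable (lborel_Pi I)"
proof (induction k)
  case 0
  then have "c 0 \<in> I" by simp
  note [measurable] = component_measurable[OF this]
  have "(\<lambda>u. exp (- u (c 0)) :: real) \<in> borel_measurable (lborel_Pi I)" by measurable
  also have "(\<lambda>u. exp (- u (c 0))) = top_weight c 0" by (rule ext) simp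
  finally show ?case .
next
  case (Suc k)
  have "c k \<in> I" "c (Suc k) \<in> I" and sub: "c ` {..k} \<subseteq> I"
    using Suc.prems by (simp_all add: image_subset_iff)
  note [measurable] = this(1,2)[THEN component_measurable]
  note [measurable] = Suc.IH[OF sub]
  have "(\<lambda>u. top_weight c k u * (if u (c (Suc k)) \<le> u (c k) then exp (- u (c (Suc k))) else 0)) \<in> borel_measurable (lborel_Pi I)"
    by measurable
  also have "(\<lambda>u. top_weight c k u * (if u (c (Suc k)) \<le> u (c k) then exp (- u (c (Suc k))) else 0)) = top_weight c (Suc k)"
    by (rule ext) simp
  finally show ?case .
qed

lemma spread_measurable:
  "c ` {..k} \<subseteq> I \<Longrightarrow> spread c k \<in> borel_measurable (lborel_Pi I)"
proof (induction k)
  case 0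
  have "(\<lambda>u. 0) \<in> borel_measurable (lborel_Pi I)" by measurable
  also have "(\<lambda>u. 0) = spread c 0" by (rule ext) simp
  finally show ?case .
next
  case (Suc k)
  have "c k \<in> I" "c (Suc k) \<in> I" and sub: "c ` {..k} \<subseteq> I"
    using Suc.prems by (simp_all add: image_subset_iff)
  note [measurable] = this(1,2)[THEN component_measurable]
  note [measurable] = Suc.IH[OF sub]
  have "(\<lambda>u. spread c k u + real (Suc k) * (u (c k) - u (c (Suc k)))) \<in> borel_measurable (lborel_Pi I)"
    by measurable
  also have "(\<lambda>u. spread c k u + real (Suc k) * (u (c k) - u (c (Suc k)))) = spread c (Suc k)"
    by (rule ext) simp
  finally show ?case .
qed

text \<open>Both integrals agree because a gap of rate m has mean 1 / m, so m times the gap has mean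
  1.\<close>

lemma nn_integral_exp_tail:
  fixes m y :: real
  assumes "0 < m"
  shows "(\<integral>\<^sup>+z. ennreal (if y \<le> z then exp (- (m * z)) else 0) \<partial>lborel) = ennreal (exp (- (m * y)) / m)"
    and "(\<integral>\<^sup>+z. ennreal (if y \<le> z then m * (z - y) * exp (- (m * z)) else 0) \<partial>lborel) = ennreal (exp (- (m * y)) / m)"
proof -
  have "(\<integral>\<^sup>+z. ennreal (if y \<le> z then exp (- (m * z)) else 0) \<partial>lborel)
      = (\<integral>\<^sup>+z. ennreal (exp (- (m * z))) * indicator {y..} z \<partial>lborel)"
    by (intro nn_integral_cong) (auto simp: indicator_def)
  also have "\<dots> = ennreal (0 - (- exp (- (m * y)) / m))"
  proof (rule nn_integral_FTC_atLeast)
    show "((\<lambda>z. - exp (- (m * z)) / m) has_real_derivative exp (- (m * z))) (at z)" for z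
      using assms by (auto intro!: derivative_eq_intros)
    show "((\<lambda>z. - exp (- (m * z)) / m) \<longlongrightarrow> 0) at_top" using assms by real_asymp
  qed auto
  finally show "(\<integral>\<^sup>+z. ennreal (if y \<le> z then exp (- (m * z)) else 0) \<partial>lborel) = ennreal (exp (- (m * y)) / m)" by simp
  have "(\<integral>\<^sup>+z. ennreal (if y \<le> z then m * (z - y) * exp (- (m * z)) else 0) \<partial>lborel)
      = (\<integral>\<^sup>+z. ennreal (m * (z - y) * exp (- (m * z))) * indicator {y..} z \<partial>lborel)"
    by (intro nn_integral_cong) (auto simp: indicator_def)
  also have "\<dots> = ennreal (0 - (- (exp (- (m * y)) * ((y - y) + 1 / m))))"
  proof (rule nn_integral_FTC_atLeast[where F = "\<lambda>z. - (exp (- (m * z)) * ((z - y) + 1 / m))"])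
    show "((\<lambda>z. - (exp (- (m * z)) * ((z - y) + 1 / m))) has_real_derivative m * (z - y) * exp (- (m * z))) (at z)" for z
      using assms by (auto intro!: derivative_eq_intros simp: field_simps)
    show "((\<lambda>z. - (exp (- (m * z)) * ((z - y) + 1 / m))) \<longlongrightarrow> 0) at_top" using assms by real_asymp
  qed (use assms in auto)
  finally show "(\<integral>\<^sup>+z. ennreal (if y \<le> z then m * (z - y) * exp (- (m * z)) else 0) \<partial>lborel) = ennreal (exp (- (m * y)) / m)" by simp
qed

lemma insert_image_atMost_Suc: "c ` {..Suc k} = insert (c (Suc k)) (c ` {..k})"
  by (auto simp: atMost_Suc)

text \<open>Given the lowest coordinate, the gaps above it are independent exponential variables
  with rates 1, ..., k (Renyi's representation). Each contributes 1 to the mean of the weighted sum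
  \<open>spread\<close>, so the second integral is k times the first.\<close>

lemma top_integral:
  fixes c :: "nat \<Rightarrow> 'i" and \<phi> :: "real \<Rightarrow> ennreal"
  assumes c: "inj c" and \<phi>: "\<phi> \<in> borel_measurable borel"
  shows "(\<integral>\<^sup>+u. ennreal (top_weight c k u) * \<phi> (u (c k)) \<partial>lborel_Pi (c ` {..k}))
     = (\<integral>\<^sup>+y. ennreal (exp (- (real (Suc k) * y)) / fact k) * \<phi> y \<partial>lborel)"
    and "(\<integral>\<^sup>+u. ennreal (top_weight c k u * spread c k u) * \<phi> (u (c k)) \<partial>lborel_Pi (c ` {..k}))
     = (\<integral>\<^sup>+y. ennreal (real k * exp (- (real (Suc k) * y)) / fact k) * \<phi> y \<partial>lborel)"
  using \<phi>
proof (induction k arbitrary: \<phi>)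
  case 0
  case 1
  note [measurable] = 1
  have "(\<integral>\<^sup>+u. ennreal (exp (- u (c 0))) * \<phi> (u (c 0)) \<partial>lborel_Pi {c 0}) = (\<integral>\<^sup>+y. ennreal (exp (- y)) * \<phi> y \<partial>lborel)"
    by (rule lborel_prod.product_nn_integral_singleton[of "\<lambda>y. ennreal (exp (- y)) * \<phi> y" "c 0"]) measurable
  then show ?case by simp
next
  case 0
  case 2
  show ?case by simp
next
  case (Suc k)
  let ?b = "\<lambda>y z::real. ennreal (if y \<le> z then 1 else 0)"
  let ?d = "\<lambda>y z::real. ennreal (if y \<le> z then real (Suc k) * (z - y) else 0)"
  let ?e = "\<lambda>y::real. exp (- (real (Suc k) * y))" and ?e2 = "\<lambda>y::real. exp (- (real (Suc (Suc k)) * y))"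
  let ?ts = "\<lambda>y u. top_weight c (Suc k) (u(c (Suc k) := y)) * spread c (Suc k) (u(c (Suc k) := y))"
  let ?M = "lborel_Pi (c ` {..k})" and ?M' = "lborel_Pi (insert (c (Suc k)) (c ` {..k}))"
  let ?I = "c ` {..k}" and ?i = "c (Suc k)"
  have i: "?i \<notin> ?I" using c by (auto dest: injD)
  have ne: "c j \<noteq> ?i" if "j \<le> k" for j using i that by (metis atMost_iff imageI)
  have tw: "top_weight c k (u(?i := y)) = top_weight c k u" for u y
    by (rule top_weight_cong) (use ne in auto)
  have sp: "spread c k (u(?i := y)) = spread c k u" for u y
    by (rule spread_cong) (use ne in auto)
  have me: "(\<lambda>z. ?b y z) \<in> borel_measurable borel"
     "(\<lambda>z. ?d y z) \<in> borel_measurable borel"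
     "(\<lambda>z. ennreal (if y \<le> z then ?e z else 0)) \<in> borel_measurable lborel"
     "(\<lambda>z. ennreal (if y \<le> z then real (Suc k) * (z - y) * ?e z else 0)) \<in> borel_measurable lborel"
     for y :: real
    by measurable
  have m: "0 < real (Suc k)" by simp
  have [measurable]: "top_weight c (Suc k) \<in> borel_measurable (?M')"
      "spread c (Suc k) \<in> borel_measurable (?M')"
      "top_weight c k \<in> borel_measurable (?M)"
      "spread c k \<in> borel_measurable (?M)"
    unfolding insert_image_atMost_Suc[symmetric]
    by (intro top_weight_measurable spread_measurable order_refl)+
  have "c k \<in> ?I" by auto
  note [measurable] = component_measurable[OF this]
  have "?i \<in> insert ?i ?I" by simp
  note [measurable] = component_measurable[OF this]
  \<comment> \<open>The induction hypotheses are used with \<phi> describing the link between the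
    old lowest coordinate and the new value y: its indicator, or the weighted gap.\<close>
  have A: "(\<integral>\<^sup>+u. ennreal (top_weight c k u) * ?b y (u (c k)) \<partial>?M)
      = ennreal (?e y / fact (Suc k))" for y
  proof -
    have "(\<integral>\<^sup>+u. ennreal (top_weight c k u) * ?b y (u (c k)) \<partial>?M)
      = (\<integral>\<^sup>+z. ennreal (?e z / fact k) * ?b y z \<partial>lborel)"
      by (rule Suc.IH(1)[where \<phi> = "\<lambda>z. ?b y z"]) (rule me)
    also have "\<dots> = (\<integral>\<^sup>+z. ennreal (1 / fact k) * ennreal (if y \<le> z then ?e z else 0) \<partial>lborel)"
      by (intro nn_integral_cong) (auto simp: ennreal_mult'[symmetric])
    also have "\<dots> = ennreal (1 / fact k) * (\<integral>\<^sup>+z. ennreal (if y \<le> z then ?e z else 0) \<partial>lborel)"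
      by (rule nn_integral_cmult) (rule me)
    also have "\<dots> = ennreal (1 / fact k) * ennreal (?e y / real (Suc k))"
      by (simp only: nn_integral_exp_tail(1)[OF m])
    finally show ?thesis by (simp add: ennreal_mult'[symmetric] mult.commute)
  qed
  have Bsp: "(\<integral>\<^sup>+u. ennreal (top_weight c k u * spread c k u) * ?b y (u (c k)) \<partial>?M)
      = ennreal (real k * ?e y / fact (Suc k))" for y
  proof -
    have "(\<integral>\<^sup>+u. ennreal (top_weight c k u * spread c k u) * ?b y (u (c k)) \<partial>?M)
      = (\<integral>\<^sup>+z. ennreal (real k * ?e z / fact k) * ?b y z \<partial>lborel)"
      by (rule Suc.IH(2)[where \<phi> = "\<lambda>z. ?b y z"]) (rule me)
    also have "\<dots> = (\<integral>\<^sup>+z. ennreal (real k / fact k) * ennreal (if y \<le> z then ?e z else 0) \<partial>lborel)"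
      by (intro nn_integral_cong) (auto simp: ennreal_mult'[symmetric])
    also have "\<dots> = ennreal (real k / fact k) * (\<integral>\<^sup>+z. ennreal (if y \<le> z then ?e z else 0) \<partial>lborel)"
      by (rule nn_integral_cmult) (rule me)
    also have "\<dots> = ennreal (real k / fact k) * ennreal (?e y / real (Suc k))"
      by (simp only: nn_integral_exp_tail(1)[OF m])
    finally show ?thesis by (simp add: ennreal_mult'[symmetric] mult.commute)
  qed
  have Csp: "(\<integral>\<^sup>+u. ennreal (top_weight c k u) * ?d y (u (c k)) \<partial>?M)
      = ennreal (?e y / fact (Suc k))" for y
  proof -
    have "(\<integral>\<^sup>+u. ennreal (top_weight c k u) * ?d y (u (c k)) \<partial>?M)
      = (\<integral>\<^sup>+z. ennreal (?e z / fact k) * ?d y z \<partial>lborel)"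
      by (rule Suc.IH(1)[where \<phi> = "\<lambda>z. ?d y z"]) (rule me)
    also have "\<dots> = (\<integral>\<^sup>+z. ennreal (1 / fact k) * ennreal (if y \<le> z then real (Suc k) * (z - y) * ?e z else 0) \<partial>lborel)"
      by (intro nn_integral_cong) (auto simp: ennreal_mult'[symmetric] mult_ac)
    also have "\<dots> = ennreal (1 / fact k) * (\<integral>\<^sup>+z. ennreal (if y \<le> z then real (Suc k) * (z - y) * ?e z else 0) \<partial>lborel)"
      by (rule nn_integral_cmult) (rule me)
    also have "\<dots> = ennreal (1 / fact k) * ennreal (?e y / real (Suc k))"
      by (simp only: nn_integral_exp_tail(2)[OF m])
    finally show ?thesis by (simp add: ennreal_mult'[symmetric] mult.commute)
  qed
  { case 1
    note [measurable] = 1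
    have "(\<integral>\<^sup>+u. ennreal (top_weight c (Suc k) u) * \<phi> (u ?i) \<partial>?M')
      = (\<integral>\<^sup>+y. (\<integral>\<^sup>+u. ennreal (top_weight c (Suc k) (u(?i := y))) * \<phi> ((u(?i := y)) ?i) \<partial>?M) \<partial>lborel)"
      by (rule lborel_prod.product_nn_integral_insert_rev[OF _ i]) (simp, measurable)
    also have "\<dots> = (\<integral>\<^sup>+y. ennreal (?e2 y / fact (Suc k)) * \<phi> y \<partial>lborel)"
    proof (rule nn_integral_cong)
      fix y :: real
      have "(\<integral>\<^sup>+u. ennreal (top_weight c (Suc k) (u(?i := y))) * \<phi> ((u(?i := y)) ?i) \<partial>?M)
        = (\<integral>\<^sup>+u. (ennreal (exp (- y)) * \<phi> y) * (ennreal (top_weight c k u) * ?b y (u (c k))) \<partial>?M)"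
      proof (rule nn_integral_cong)
        fix u :: "'i \<Rightarrow> real"
        have "top_weight c (Suc k) (u(?i := y)) = exp (- y) * top_weight c k u * (if y \<le> u (c k) then 1 else 0)"
          using ne[of k] by (simp add: tw)
        then have "ennreal (top_weight c (Suc k) (u(?i := y))) = ennreal (exp (- y)) * ennreal (top_weight c k u) * ?b y (u (c k))"
          using top_weight_nonneg[of c k u] by (simp only: ennreal_mult'[OF exp_ge_zero] ennreal_mult'[OF mult_nonneg_nonneg[OF exp_ge_zero top_weight_nonneg]])
        then show "ennreal (top_weight c (Suc k) (u(?i := y))) * \<phi> ((u(?i := y)) ?i)
          = (ennreal (exp (- y)) * \<phi> y) * (ennreal (top_weight c k u) * ?b y (u (c k)))"
          by (simp only: fun_upd_same mult_ac)
      qed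
      also have "\<dots> = (ennreal (exp (- y)) * \<phi> y) * (\<integral>\<^sup>+u. ennreal (top_weight c k u) * ?b y (u (c k)) \<partial>?M)"
        by (rule nn_integral_cmult) measurable
      also have "\<dots> = (ennreal (exp (- y)) * \<phi> y) * ennreal (?e y / fact (Suc k))"
        by (simp only: A)
      also have "\<dots> = (ennreal (exp (- y)) * ennreal (?e y / fact (Suc k))) * \<phi> y"
        by (simp only: mult_ac)
      also have "ennreal (exp (- y)) * ennreal (?e y / fact (Suc k)) = ennreal (?e2 y / fact (Suc k))"
        unfolding ennreal_mult'[OF exp_ge_zero, symmetric] times_divide_eq_right exp_add[symmetric] by (simp add: algebra_simps)
      finally show "(\<integral>\<^sup>+u. ennreal (top_weight c (Suc k) (u(?i := y))) * \<phi> ((u(?i := y)) ?i) \<partial>?M)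
        = ennreal (?e2 y / fact (Suc k)) * \<phi> y" .
    qed
    finally show ?case unfolding insert_image_atMost_Suc .
  next
    case 2
    note [measurable] = 2
    have "(\<integral>\<^sup>+u. ennreal (top_weight c (Suc k) u * spread c (Suc k) u) * \<phi> (u ?i) \<partial>?M')
      = (\<integral>\<^sup>+y. (\<integral>\<^sup>+u. ennreal (?ts y u) * \<phi> ((u(?i := y)) ?i) \<partial>?M) \<partial>lborel)"
      by (rule lborel_prod.product_nn_integral_insert_rev[OF _ i]) (simp, measurable)
    also have "\<dots> = (\<integral>\<^sup>+y. ennreal (real (Suc k) * ?e2 y / fact (Suc k)) * \<phi> y \<partial>lborel)"
    proof (rule nn_integral_cong)
      fix y :: real
      have "(\<integral>\<^sup>+u. ennreal (?ts y u) * \<phi> ((u(?i := y)) ?i) \<partial>?M)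
        = (\<integral>\<^sup>+u. (ennreal (exp (- y)) * \<phi> y) * (ennreal (top_weight c k u * spread c k u) * ?b y (u (c k))
            + ennreal (top_weight c k u) * ?d y (u (c k))) \<partial>?M)"
      proof (rule nn_integral_cong)
        fix u :: "'i \<Rightarrow> real"
        show "ennreal (?ts y u) * \<phi> ((u(?i := y)) ?i)
         = (ennreal (exp (- y)) * \<phi> y) * (ennreal (top_weight c k u * spread c k u) * ?b y (u (c k))
            + ennreal (top_weight c k u) * ?d y (u (c k)))"
        proof (cases "y \<le> u (c k)")
          case True
          have "?ts y u =
             exp (- y) * (top_weight c k u * spread c k u + top_weight c k u * (real (Suc k) * (u (c k) - y)))"
            using True ne[of k] by (simp add: tw sp algebra_simps)
          also have "ennreal \<dots> = ennreal (exp (- y)) * (ennreal (top_weight c k u * spread c k u) + ennreal (top_weight c k u) * ennreal (real (Suc k) * (u (c k) - y)))"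
            using True top_weight_nonneg[of c k u] top_weight_spread_nonneg[of c k u]
            by (simp only: ennreal_mult'[OF exp_ge_zero] ennreal_mult'[OF top_weight_nonneg, symmetric])
               (subst ennreal_plus[symmetric], simp_all)
          finally show ?thesis using True by (simp only: mult_ac fun_upd_same if_True ennreal_1 mult_1_left mult_1_right)
        next
          case False
          then show ?thesis using ne[of k] by (simp add: tw sp)
        qed
      qed
      also have "\<dots> = (ennreal (exp (- y)) * \<phi> y) * (ennreal (real k * ?e y / fact (Suc k)) + ennreal (?e y / fact (Suc k)))"
      proof -
        have "(\<integral>\<^sup>+u. ennreal (top_weight c k u * spread c k u) * ?b y (u (c k))
            + ennreal (top_weight c k u) * ?d y (u (c k)) \<partial>?M)
          = ennreal (real k * ?e y / fact (Suc k)) + ennreal (?e y / fact (Suc k))"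
          unfolding Bsp[of y, symmetric] Csp[of y, symmetric] by (rule nn_integral_add) measurable
        moreover have "(\<integral>\<^sup>+u. (ennreal (exp (- y)) * \<phi> y) * (ennreal (top_weight c k u * spread c k u) * ?b y (u (c k)) + ennreal (top_weight c k u) * ?d y (u (c k))) \<partial>?M) = (ennreal (exp (- y)) * \<phi> y) * (\<integral>\<^sup>+u. ennreal (top_weight c k u * spread c k u) * ?b y (u (c k)) + ennreal (top_weight c k u) * ?d y (u (c k)) \<partial>?M)"
          by (rule nn_integral_cmult) measurable
        ultimately show ?thesis by (simp only:)
      qed
      also have "ennreal (real k * ?e y / fact (Suc k)) + ennreal (?e y / fact (Suc k))
          = ennreal (real (Suc k) * ?e y / fact (Suc k))"
      proof -
        have "real (Suc k) * ?e y / fact (Suc k) = real k * ?e y / fact (Suc k) + ?e y / fact (Suc k)"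
          by (simp only: of_nat_Suc distrib_right add_divide_distrib mult_1_left add.commute)
        then show ?thesis by (simp only: ennreal_plus[symmetric] divide_nonneg_nonneg mult_nonneg_nonneg of_nat_0_le_iff exp_ge_zero fact_ge_zero)
      qed
      also have "(ennreal (exp (- y)) * \<phi> y) * \<dots> = (ennreal (exp (- y)) * \<dots>) * \<phi> y"
        by (simp only: mult_ac)
      also have "ennreal (exp (- y)) * ennreal (real (Suc k) * ?e y / fact (Suc k)) = ennreal (real (Suc k) * ?e2 y / fact (Suc k))"
      proof -
        have "exp (- y) * (real (Suc k) * ?e y / fact (Suc k)) = real (Suc k) * (exp (- y) * ?e y) / fact (Suc k)"
          by (simp only: times_divide_eq_right mult_ac)
        also have "exp (- y) * ?e y = ?e2 y"
          unfolding exp_add[symmetric] by (simp add: algebra_simps)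
        finally show ?thesis by (simp only: ennreal_mult'[OF exp_ge_zero, symmetric])
      qed
      finally show "(\<integral>\<^sup>+u. ennreal (?ts y u) * \<phi> ((u(?i := y)) ?i) \<partial>?M)
        = ennreal (real (Suc k) * ?e2 y / fact (Suc k)) * \<phi> y" .
    qed
    finally show ?case unfolding insert_image_atMost_Suc .
  }
qed

section \<open>The limit law as a probability measure\<close>

text \<open>The peak is coordinate 0 of either side, so each side becomes a chain indexed by 0, ...,
  t with the common top \<open>U0\<close>.\<close>

definition side_coord :: "side \<Rightarrow> nat \<Rightarrow> coord" where
  "side_coord j k = (if k = 0 then U0 else U j k)"

lemma side_coord_simps [simp]: "side_coord j 0 = U0" "side_coord j (Suc k) = U j (Suc k)"
  by (auto simp: side_coord_def)

lemma inj_side_coord: "inj (side_coord j)"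
  by (rule injI) (auto simp: side_coord_def split: if_splits)

lemma side_coord_image: "side_coord j ` {..t} = insert U0 (U j ` {1..t})"
proof (induction t)
  case (Suc t)
  have "{1..Suc t} = insert (Suc t) {1..t}" by auto
  then show ?case unfolding insert_image_atMost_Suc Suc by auto
qed simp

lemma coords_eq: "j \<noteq> j' \<Longrightarrow> coords t = side_coord j ` {..t} \<union> U j' ` {1..t}"
  unfolding side_coord_image coords_def
  by (cases j; cases j') (auto simp: image_iff, (metis side.exhaust atLeastAtMost_iff One_nat_def)+)

lemma finite_coords: "finite (coords t)"
  using coords_eq[of L R t] by simp

lemma card_coords: "card (coords t) = 2 * t + 1"
proof -
  have "coords t = insert U0 (U L ` {1..t} \<union> U R ` {1..t})"
    using coords_eq[of L R t] by (auto simp: side_coord_image)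
  moreover have "card (U L ` {1..t} \<union> U R ` {1..t}) = t + t"
    by (subst card_Un_disjoint) (auto simp: card_image inj_on_def)
  ultimately show ?thesis by (simp add: image_iff)
qed

lemma chain_weight_eq:
  "chain_weight c k u = (if \<forall>i<k. u (c (Suc i)) \<le> u (c i) then (\<Prod>i=1..k. xi (u (c i))) else 0)"
  by (induction k) (auto simp: less_Suc_eq)

lemma prod_xi: "(\<Prod>i=1..k. xi (f i)) = exp (- (\<Sum>i=1..k. f i)) / 2 ^ k"
proof (induction k)
  case (Suc k)
  then show ?case by (simp add: xi_def exp_add exp_diff exp_minus field_simps)
qed simp

text \<open>The two sides share only the peak coordinate, so one of them can be integrated out while
  the other is kept.\<close>

lemma F_eq:
  assumes "0 < t"
  shows "F t u = exp (- u U0) * (chain_weight (side_coord L) t u * exp (- xi (u (U L t)))) *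
     (chain_weight (side_coord R) t u * exp (- xi (u (U R t))))"
proof -
  have cond: "(u U0 \<ge> u (U j 1) \<and> (\<forall>k. 1 \<le> k \<and> k < t \<longrightarrow> u (U j k) \<ge> u (U j (k + 1))))
      \<longleftrightarrow> (\<forall>i<t. u (side_coord j (Suc i)) \<le> u (side_coord j i))" for j
    using assms by (auto simp: side_coord_def Suc_le_eq split: if_splits)
  have all: "(\<forall>j. Q j) \<longleftrightarrow> Q L \<and> Q R" for Q :: "side \<Rightarrow> bool"
    by (metis side.exhaust)
  have pr: "(\<Prod>i=1..t. xi (u (side_coord j i))) = exp (- (\<Sum>i=1..t. u (U j i))) / 2 ^ t" for j
  proof -
    have "(\<Prod>i=1..t. xi (u (side_coord j i))) = (\<Prod>i=1..t. xi (u (U j i)))"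
      by (intro prod.cong) (auto simp: side_coord_def)
    then show ?thesis unfolding prod_xi .
  qed
  have "1 / 2 ^ (2 * t) * exp (- u U0 - (\<Sum>k = 1..t. u (U L k) + u (U R k)) - exp (- u (U L t)) / 2 - exp (- u (U R t)) / 2)
     = exp (- u U0) * (exp (- (\<Sum>i=1..t. u (U L i))) / 2 ^ t * exp (- xi (u (U L t)))) * (exp (- (\<Sum>i=1..t. u (U R i))) / 2 ^ t * exp (- xi (u (U R t))))"
  proof -
    have "exp (- u U0 - (\<Sum>k = 1..t. u (U L k) + u (U R k)) - exp (- u (U L t)) / 2 - exp (- u (U R t)) / 2)
      = exp (- u U0) * exp (- (\<Sum>i=1..t. u (U L i))) * exp (- xi (u (U L t))) * exp (- (\<Sum>i=1..t. u (U R i))) * exp (- xi (u (U R t)))"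
      unfolding exp_add[symmetric] by (simp add: xi_def sum.distrib algebra_simps)
    moreover have "(2::real) ^ (2 * t) = 2 ^ t * 2 ^ t" by (simp add: mult_2 power_add)
    ultimately show ?thesis by simp
  qed
  then show ?thesis unfolding F_def all cond chain_weight_eq pr by auto
qed

lemma side_chain_measurable:
  assumes "side_coord j ` {..t} \<subseteq> I"
  shows "chain_weight (side_coord j) t \<in> borel_measurable (lborel_Pi I)"
    "(\<lambda>u. u (side_coord j t)) \<in> borel_measurable (lborel_Pi I)"
    "spread (side_coord j) t \<in> borel_measurable (lborel_Pi I)"
  using assms by (auto intro!: chain_weight_measurable spread_measurable component_measurable)

text \<open>Removing the lowest coordinate again and again leaves exp (- xi (u U0)) for a whole
  side, whatever its length.\<close>

lemma reduce_side:
  fixes h :: "(coord \<Rightarrow> real) \<Rightarrow> ennreal"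
  assumes I: "finite I" "U0 \<in> I" "\<And>k. 1 \<le> k \<Longrightarrow> U j k \<notin> I"
    and h: "\<And>r. h \<in> borel_measurable (lborel_Pi (I \<union> U j ` {1..r}))"
    and indep: "\<And>u k y. 1 \<le> k \<Longrightarrow> h (u(U j k := y)) = h u"
  shows "(\<integral>\<^sup>+u. h u * ennreal (chain_weight (side_coord j) r u * exp (- xi (u (side_coord j r)))) \<partial>lborel_Pi (I \<union> U j ` {1..r}))
     = (\<integral>\<^sup>+u. h u * ennreal (exp (- xi (u U0))) \<partial>lborel_Pi I)"
proof (induction r)
  case (Suc r)
  have eq: "I \<union> U j ` {1..Suc r} = insert (side_coord j (Suc r)) (I \<union> U j ` {1..r})"
    by (simp add: atLeastAtMostSuc_conv)
  have sub: "side_coord j ` {..r} \<subseteq> I \<union> U j ` {1..r}"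
    using I(2) by (simp add: side_coord_image)
  have nin: "side_coord j (Suc r) \<notin> I \<union> U j ` {1..r}"
    using I(3)[of "Suc r"] by auto
  have "(\<integral>\<^sup>+u. h u * ennreal (chain_weight (side_coord j) (Suc r) u * exp (- xi (u (side_coord j (Suc r))))) \<partial>lborel_Pi (insert (side_coord j (Suc r)) (I \<union> U j ` {1..r})))
    = (\<integral>\<^sup>+u. h u * ennreal (chain_weight (side_coord j) r u * exp (- xi (u (side_coord j r)))) \<partial>lborel_Pi (I \<union> U j ` {1..r}))"
    by (rule peel_bottom[OF _ sub nin h[of "Suc r", unfolded eq]]) (use I indep[of "Suc r"] in auto)
  then show ?case unfolding eq Suc .
qed simp

lemma F_nonneg: "0 \<le> F t u"
  by (simp add: F_def)

lemma F_split_integral: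
  fixes h :: "(coord \<Rightarrow> real) \<Rightarrow> ennreal"
  assumes t: "0 < t" and j: "j \<noteq> j'"
    and h: "\<And>r. h \<in> borel_measurable (lborel_Pi (side_coord j ` {..t} \<union> U j' ` {1..r}))"
    and indep: "\<And>u k y. 1 \<le> k \<Longrightarrow> h (u(U j' k := y)) = h u"
  shows "(\<integral>\<^sup>+u. h u * ennreal (F t u) \<partial>lborel_Pi (coords t))
     = (\<integral>\<^sup>+u. h u * ennreal (exp (- u U0) * (chain_weight (side_coord j) t u * exp (- xi (u (side_coord j t))))) * ennreal (exp (- xi (u U0))) \<partial>lborel_Pi (side_coord j ` {..t}))"
proof -
  let ?I = "side_coord j ` {..t}"
  let ?A = "\<lambda>u. exp (- u U0) * (chain_weight (side_coord j) t u * exp (- xi (u (side_coord j t))))"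
  have U: "side_coord i t = U i t" for i using t by (simp add: side_coord_def)
  have F: "F t u = ?A u * (chain_weight (side_coord j') t u * exp (- xi (u (side_coord j' t))))" for u
    unfolding F_eq[OF t] U using j by (cases j; cases j') auto
  have A0: "0 \<le> ?A u" for u by (simp add: chain_weight_nonneg)
  have "(\<integral>\<^sup>+u. h u * ennreal (F t u) \<partial>lborel_Pi (coords t)) =
     (\<integral>\<^sup>+u. (h u * ennreal (?A u)) * ennreal (chain_weight (side_coord j') t u * exp (- xi (u (side_coord j' t)))) \<partial>lborel_Pi (?I \<union> U j' ` {1..t}))"
  proof -
    have "ennreal (F t u) = ennreal (?A u) * ennreal (chain_weight (side_coord j') t u * exp (- xi (u (side_coord j' t))))" for u
      unfolding F by (rule ennreal_mult'[OF A0])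
    then show ?thesis unfolding coords_eq[OF j] by (simp only: mult.assoc)
  qed
  also have "\<dots> = (\<integral>\<^sup>+u. (h u * ennreal (?A u)) * ennreal (exp (- xi (u U0))) \<partial>lborel_Pi ?I)"
  proof (rule reduce_side)
    show "finite ?I" "U0 \<in> ?I" by (auto simp: side_coord_image)
    show "U j' k \<notin> ?I" if "1 \<le> k" for k using j by (auto simp: side_coord_image)
    show "(\<lambda>u. h u * ennreal (?A u)) \<in> borel_measurable (lborel_Pi (?I \<union> U j' ` {1..r}))" for r
    proof -
      have "U0 \<in> ?I \<union> U j' ` {1..r}" by (auto simp: side_coord_image)
      note [measurable] = h[of r] side_chain_measurable[of j t "?I \<union> U j' ` {1..r}", OF Un_upper1]
        component_measurable[OF this]
      show ?thesis by measurable
    qed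
    fix u :: "coord \<Rightarrow> real" and k y assume k: "1 \<le> (k::nat)"
    have ne: "side_coord j i \<noteq> U j' k" for i using j k by (auto simp: side_coord_def)
    have "chain_weight (side_coord j) t (u(U j' k := y)) = chain_weight (side_coord j) t u"
      by (rule chain_weight_cong) (use ne in auto)
    then show "h (u(U j' k := y)) * ennreal (?A (u(U j' k := y))) = h u * ennreal (?A u)"
      using indep[OF k] ne[of t] by simp
  qed
  finally show ?thesis .
qed

text \<open>Each side contributes exp (- xi y), together exp (- exp (- y)), so the peak has a Gumbel
  law.\<close>

lemma F_peak_integral:
  fixes g :: "real \<Rightarrow> ennreal"
  assumes t: "0 < t" and g: "g \<in> borel_measurable borel"
  shows "(\<integral>\<^sup>+u. g (u U0) * ennreal (F t u) \<partial>lborel_Pi (coords t))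
     = (\<integral>\<^sup>+y. g y * ennreal (exp (- y) * exp (- exp (- y))) \<partial>lborel)"
proof -
  have gm: "(\<lambda>u. g (u U0)) \<in> borel_measurable (lborel_Pi I)" if "U0 \<in> I" for I
    using measurable_compose[OF component_measurable[OF that] g] .
  have LR: "L \<noteq> R" by simp
  have "(\<integral>\<^sup>+u. g (u U0) * ennreal (F t u) \<partial>lborel_Pi (coords t))
    = (\<integral>\<^sup>+u. g (u U0) * ennreal (exp (- u U0) * (chain_weight (side_coord L) t u * exp (- xi (u (side_coord L t))))) * ennreal (exp (- xi (u U0))) \<partial>lborel_Pi (side_coord L ` {..t}))"
    by (rule F_split_integral[OF t LR]) (auto intro!: gm simp: side_coord_image)
  also have "\<dots> = (\<integral>\<^sup>+u. (g (u U0) * ennreal (exp (- u U0)) * ennreal (exp (- xi (u U0)))) * ennreal (chain_weight (side_coord L) t u * exp (- xi (u (side_coord L t)))) \<partial>lborel_Pi ({U0} \<union> U L ` {1..t}))"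
    by (simp add: side_coord_image ennreal_mult' mult_ac)
  also have "\<dots> = (\<integral>\<^sup>+u. (g (u U0) * ennreal (exp (- u U0)) * ennreal (exp (- xi (u U0)))) * ennreal (exp (- xi (u U0))) \<partial>lborel_Pi {U0})"
  proof (rule reduce_side)
    show "(\<lambda>u. g (u U0) * ennreal (exp (- u U0)) * ennreal (exp (- xi (u U0)))) \<in> borel_measurable (lborel_Pi ({U0} \<union> U L ` {1..r}))" for r
    proof -
      have U: "U0 \<in> {U0} \<union> U L ` {1..r}" by simp
      note [measurable] = gm[OF U] component_measurable[OF U]
      show ?thesis by measurable
    qed
  qed auto
  also have "\<dots> = (\<integral>\<^sup>+y. (g y * ennreal (exp (- y)) * ennreal (exp (- xi y))) * ennreal (exp (- xi y)) \<partial>lborel)"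
  proof -
    note [measurable] = g
    have "(\<lambda>y. (g y * ennreal (exp (- y)) * ennreal (exp (- xi y))) * ennreal (exp (- xi y))) \<in> borel_measurable lborel"
      by measurable
    from lborel_prod.product_nn_integral_singleton[OF this] show ?thesis .
  qed
  also have "\<dots> = (\<integral>\<^sup>+y. g y * ennreal (exp (- y) * exp (- exp (- y))) \<partial>lborel)"
  proof (intro nn_integral_cong)
    fix y :: real
    have "exp (- y) * exp (- exp (- y)) = exp (- y) * (exp (- xi y) * exp (- xi y))"
      unfolding exp_add[symmetric] by (simp add: xi_def)
    then show "(g y * ennreal (exp (- y)) * ennreal (exp (- xi y))) * ennreal (exp (- xi y)) = g y * ennreal (exp (- y) * exp (- exp (- y)))"
      by (simp add: ennreal_mult' mult_ac)
  qed
  finally show ?thesis .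
qed

lemma F_total:
  assumes "0 < t" shows "(\<integral>\<^sup>+u. ennreal (F t u) \<partial>lborel_Pi (coords t)) = 1"
proof -
  have "(\<integral>\<^sup>+y. ennreal (exp (- y) * exp (- exp (- y))) \<partial>lborel) = ennreal (1 - 0)"
  proof (rule nn_integral_FTC_UNIV[where F = "\<lambda>y. exp (- exp (- y))"])
    show "((\<lambda>y. exp (- exp (- y))) has_real_derivative exp (- y) * exp (- exp (- y))) (at y)" for y :: real
      by (auto intro!: derivative_eq_intros)
    show "((\<lambda>y::real. exp (- exp (- y))) \<longlongrightarrow> 0) at_bot" "((\<lambda>y::real. exp (- exp (- y))) \<longlongrightarrow> 1) at_top" by real_asymp+
  qed auto
  then show ?thesis using F_peak_integral[OF assms, of "\<lambda>_. 1"] by simp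
qed

lemma F_peak_tail:
  assumes "0 < t"
  shows "(\<integral>\<^sup>+u. indicator {K..} (u U0) * ennreal (F t u) \<partial>lborel_Pi (coords t)) \<le> ennreal (exp (- K))"
proof -
  have "(\<integral>\<^sup>+u. indicator {K..} (u U0) * ennreal (F t u) \<partial>lborel_Pi (coords t))
      = (\<integral>\<^sup>+y. indicator {K..} y * ennreal (exp (- y) * exp (- exp (- y))) \<partial>lborel)"
    by (rule F_peak_integral[OF assms]) simp
  also have "\<dots> \<le> (\<integral>\<^sup>+z. ennreal (if K \<le> z then exp (- (1 * z)) else 0) \<partial>lborel)"
    by (intro nn_integral_mono) (auto simp: indicator_def intro!: ennreal_leI mult_left_le)
  also have "\<dots> = ennreal (exp (- (1 * K)) / 1)" by (rule nn_integral_exp_tail) simp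
  finally show ?thesis by simp
qed

lemma chain_weight_top_weight: "exp (- u (c 0)) * chain_weight c k u = top_weight c k u / 2 ^ k"
  by (induction k) (auto simp: xi_def field_simps)

text \<open>Dropping the factor exp (- xi (u U0)) \<le> 1 of the other side leaves, besides
  \<open>h\<close> and the top weight, a function of the lowest coordinate alone, to which
  \<open>top_integral\<close> applies. The total mass of the majorant is 2 instead of 1, hence the
  factors 2 below.\<close>

lemma F_side_bound:
  fixes h :: "(coord \<Rightarrow> real) \<Rightarrow> ennreal"
  assumes t: "0 < t"
    and h: "\<And>I. side_coord j ` {..t} \<subseteq> I \<Longrightarrow> h \<in> borel_measurable (lborel_Pi I)"
    and indep: "\<And>u j' k y. j' \<noteq> j \<Longrightarrow> 1 \<le> k \<Longrightarrow> h (u(U j' k := y)) = h u"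
  shows "(\<integral>\<^sup>+u. h u * ennreal (F t u) \<partial>lborel_Pi (coords t))
    \<le> (\<integral>\<^sup>+u. h u * ennreal (top_weight (side_coord j) t u) * ennreal (exp (- xi (u (side_coord j t))) / 2 ^ t) \<partial>lborel_Pi (side_coord j ` {..t}))"
proof -
  let ?c = "side_coord j"
  let ?M = "lborel_Pi (?c ` {..t})"
  let ?A = "\<lambda>u. exp (- u U0) * (chain_weight ?c t u * exp (- xi (u (?c t))))"
  obtain j' where j': "j \<noteq> j'" by (metis side.distinct(1))
  have "(\<integral>\<^sup>+u. h u * ennreal (F t u) \<partial>lborel_Pi (coords t))
     = (\<integral>\<^sup>+u. h u * ennreal (?A u) * ennreal (exp (- xi (u U0))) \<partial>?M)"
    by (rule F_split_integral[OF t j']) (use h indep j' in auto)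
  also have "\<dots> \<le> (\<integral>\<^sup>+u. h u * ennreal (top_weight ?c t u) * ennreal (exp (- xi (u (?c t))) / 2 ^ t) \<partial>?M)"
  proof (intro nn_integral_mono)
    fix u :: "coord \<Rightarrow> real"
    have "?A u
        = top_weight ?c t u * (exp (- xi (u (?c t))) / 2 ^ t)"
    proof -
      have "exp (- u U0) * chain_weight ?c t u = top_weight ?c t u / 2 ^ t"
        using chain_weight_top_weight[of u "?c" t] by simp
      then show ?thesis unfolding mult.assoc[symmetric] by (simp only: times_divide_eq_left times_divide_eq_right)
    qed
    then have "h u * ennreal (?A u) =
       h u * ennreal (top_weight ?c t u) * ennreal (exp (- xi (u (?c t))) / 2 ^ t)"
      by (simp only: ennreal_mult'[OF top_weight_nonneg] mult.assoc)
    moreover have "ennreal (exp (- xi (u U0))) \<le> 1"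
      using xi_pos[of "u U0"] by (simp add: less_imp_le)
    ultimately show "h u * ennreal (?A u) * ennreal (exp (- xi (u U0)))
      \<le> h u * ennreal (top_weight ?c t u) * ennreal (exp (- xi (u (?c t))) / 2 ^ t)"
      using mult_left_mono[of "ennreal (exp (- xi (u U0)))" 1] by simp
  qed
  finally show ?thesis .
qed

lemma exp_power_xi: "exp (- (real (Suc t) * y)) / 2 ^ t = 2 * xi y ^ Suc t"
proof -
  have "exp (- (real (Suc t) * y)) = exp (- y) ^ Suc t"
    using exp_of_nat_mult[of "Suc t" "- y"] by simp
  then show ?thesis by (simp add: xi_def power_divide)
qed

lemma xi_moment:
  "has_bochner_integral lborel (\<lambda>y. xi y ^ Suc m * exp (- xi y)) (fact m)"
  by (rule has_bochner_integral_nn_integral) (auto simp: nn_integral_gamma_xi xi_pos less_imp_le simp del: power_Suc)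

text \<open>Under the majorant, xi of the lowest coordinate has twice the Gamma density of shape t +
  1. Its mean and variance are t + 1, so the second moment about t is (t + 1) + 1.\<close>

lemma F_deviation:
  assumes t: "0 < t"
  shows "(\<integral>\<^sup>+u. ennreal ((xi (u (U j t)) - real t)\<^sup>2) * ennreal (F t u) \<partial>lborel_Pi (coords t)) \<le> ennreal (2 * (real t + 2))"
proof -
  let ?c = "side_coord j"
  let ?M = "lborel_Pi (?c ` {..t})"
  let ?p = "\<lambda>y. 2 / fact t * (xi y ^ Suc (t + 2) * exp (- xi y) - 2 * real t * (xi y ^ Suc (t + 1) * exp (- xi y)) + (real t)\<^sup>2 * (xi y ^ Suc t * exp (- xi y)))"
  let ?v = "2 / fact t * (fact (t + 2) - 2 * real t * fact (t + 1) + (real t)\<^sup>2 * fact t) :: real"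
  have U: "?c t = U j t" using t by (simp add: side_coord_def)
  have "(\<integral>\<^sup>+u. ennreal ((xi (u (U j t)) - real t)\<^sup>2) * ennreal (F t u) \<partial>lborel_Pi (coords t))
    \<le> (\<integral>\<^sup>+u. ennreal ((xi (u (U j t)) - real t)\<^sup>2) * ennreal (top_weight ?c t u) * ennreal (exp (- xi (u (?c t))) / 2 ^ t) \<partial>?M)"
  proof (rule F_side_bound[OF t])
    fix I assume "?c ` {..t} \<subseteq> I"
    note [measurable] = side_chain_measurable(2)[OF this, unfolded U]
    show "(\<lambda>u. ennreal ((xi (u (U j t)) - real t)\<^sup>2)) \<in> borel_measurable (lborel_Pi I)"
      by measurable
  qed auto
  also have "\<dots> = (\<integral>\<^sup>+u. ennreal (top_weight ?c t u) * ennreal ((xi (u (?c t)) - real t)\<^sup>2 * (exp (- xi (u (?c t))) / 2 ^ t)) \<partial>?M)"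
  proof (intro nn_integral_cong)
    fix u :: "coord \<Rightarrow> real"
    have "ennreal ((xi (u (?c t)) - real t)\<^sup>2 * (exp (- xi (u (?c t))) / 2 ^ t))
      = ennreal ((xi (u (?c t)) - real t)\<^sup>2) * ennreal (exp (- xi (u (?c t))) / 2 ^ t)"
      by (rule ennreal_mult') simp
    then show "ennreal ((xi (u (U j t)) - real t)\<^sup>2) * ennreal (top_weight ?c t u) * ennreal (exp (- xi (u (?c t))) / 2 ^ t)
      = ennreal (top_weight ?c t u) * ennreal ((xi (u (?c t)) - real t)\<^sup>2 * (exp (- xi (u (?c t))) / 2 ^ t))"
      by (simp only: U mult_ac)
  qed
  also have "\<dots> = (\<integral>\<^sup>+y. ennreal (exp (- (real (Suc t) * y)) / fact t) * ennreal ((xi y - real t)\<^sup>2 * (exp (- xi y) / 2 ^ t)) \<partial>lborel)"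
    by (rule top_integral(1)[OF inj_side_coord, where \<phi> = "\<lambda>y. ennreal ((xi y - real t)\<^sup>2 * (exp (- xi y) / 2 ^ t))"]) measurable
  also have "\<dots> = (\<integral>\<^sup>+y. ennreal (?p y) \<partial>lborel)"
  proof (intro nn_integral_cong)
    fix y
    have "exp (- (real (Suc t) * y)) / fact t * ((xi y - real t)\<^sup>2 * (exp (- xi y) / 2 ^ t))
      = (exp (- (real (Suc t) * y)) / 2 ^ t) * (xi y - real t)\<^sup>2 * exp (- xi y) / fact t" by (simp add: mult_ac)
    also have "\<dots> = ?p y"
      unfolding exp_power_xi by (simp add: power2_eq_square field_simps)
    finally show "ennreal (exp (- (real (Suc t) * y)) / fact t) * ennreal ((xi y - real t)\<^sup>2 * (exp (- xi y) / 2 ^ t))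
      = ennreal (?p y)"
      by (subst ennreal_mult'[symmetric]) simp_all
  qed
  also have "\<dots> = ennreal (?v)"
  proof (rule nn_integral_eq_integral[THEN trans])
    have b: "has_bochner_integral lborel (\<lambda>y. ?p y)
       (?v)"
      by (intro has_bochner_integral_mult_right has_bochner_integral_add has_bochner_integral_diff xi_moment)
    then show "integrable lborel (\<lambda>y. ?p y)"
      by (rule integrable.intros)
    show "AE y in lborel. 0 \<le> ?p y"
    proof (intro always_eventually allI)
      fix y
      have "?p y
         = 2 / fact t * (xi y ^ Suc t * exp (- xi y) * (xi y - real t)\<^sup>2)"
        by (simp add: power2_eq_square algebra_simps)
      then show "0 \<le> ?p y"
        using xi_pos[of y] by simp
    qed
    show "ennreal (\<integral>y. ?p y \<partial>lborel)
      = ennreal (?v)"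
      using has_bochner_integral_integral_eq[OF b] by simp
  qed
  also have "?v = 2 * (real t + 2)"
  proof -
    have "fact (t + 2) = (real t + 2) * (real t + 1) * fact t" "fact (t + 1) = (real t + 1) * (fact t :: real)"
      by (simp_all add: algebra_simps)
    then have "fact (t + 2) - 2 * real t * fact (t + 1) + (real t)\<^sup>2 * fact t = (real t + 2) * fact t"
      by (simp add: power2_eq_square algebra_simps)
    then show ?thesis by simp
  qed
  finally show ?thesis .
qed

text \<open>The t weighted gaps have mean 1 each, and the majorant has mass 2.\<close>

lemma F_spread:
  assumes t: "0 < t"
  shows "(\<integral>\<^sup>+u. ennreal (spread (side_coord j) t u) * ennreal (F t u) \<partial>lborel_Pi (coords t)) \<le> ennreal (2 * real t)"
proof -
  let ?c = "side_coord j"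
  let ?M = "lborel_Pi (?c ` {..t})"
  have "(\<integral>\<^sup>+u. ennreal (spread ?c t u) * ennreal (F t u) \<partial>lborel_Pi (coords t))
    \<le> (\<integral>\<^sup>+u. ennreal (spread ?c t u) * ennreal (top_weight ?c t u) * ennreal (exp (- xi (u (?c t))) / 2 ^ t) \<partial>?M)"
  proof (rule F_side_bound[OF t])
    fix I assume "?c ` {..t} \<subseteq> I"
    note [measurable] = side_chain_measurable(3)[OF this]
    show "(\<lambda>u. ennreal (spread ?c t u)) \<in> borel_measurable (lborel_Pi I)"
      by measurable
  next
    fix u :: "coord \<Rightarrow> real" and j' k y assume "j' \<noteq> j" "1 \<le> (k::nat)"
    then have ne: "?c i \<noteq> U j' k" for i by (auto simp: side_coord_def)
    have "spread ?c t (u(U j' k := y)) = spread ?c t u"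
      by (rule spread_cong) (use ne in auto)
    then show "ennreal (spread ?c t (u(U j' k := y))) = ennreal (spread ?c t u)" by simp
  qed
  also have "\<dots> = (\<integral>\<^sup>+u. ennreal (top_weight ?c t u * spread ?c t u) * ennreal (exp (- xi (u (?c t))) / 2 ^ t) \<partial>?M)"
    unfolding ennreal_mult'[OF top_weight_nonneg] by (simp only: mult_ac)
  also have "\<dots> = (\<integral>\<^sup>+y. ennreal (real t * exp (- (real (Suc t) * y)) / fact t) * ennreal (exp (- xi y) / 2 ^ t) \<partial>lborel)"
    by (rule top_integral(2)[OF inj_side_coord, where \<phi> = "\<lambda>y. ennreal (exp (- xi y) / 2 ^ t)"]) measurable
  also have "\<dots> = (\<integral>\<^sup>+y. ennreal (2 * real t / fact t) * ennreal (xi y ^ Suc t * exp (- xi y)) \<partial>lborel)"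
  proof (intro nn_integral_cong)
    fix y
    have "real t * exp (- (real (Suc t) * y)) / fact t * (exp (- xi y) / 2 ^ t) = (exp (- (real (Suc t) * y)) / 2 ^ t) * (real t / fact t * exp (- xi y))" by (simp add: mult_ac)
    also have "\<dots> = 2 * real t / fact t * (xi y ^ Suc t * exp (- xi y))" unfolding exp_power_xi by simp
    finally show "ennreal (real t * exp (- (real (Suc t) * y)) / fact t) * ennreal (exp (- xi y) / 2 ^ t) = ennreal (2 * real t / fact t) * ennreal (xi y ^ Suc t * exp (- xi y))"
      by (subst (1 2) ennreal_mult'[symmetric]) simp_all
  qed
  also have "\<dots> = ennreal (2 * real t / fact t) * (\<integral>\<^sup>+y. ennreal (xi y ^ Suc t * exp (- xi y)) \<partial>lborel)"
    by (rule nn_integral_cmult) measurable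
  also have "\<dots> = ennreal (2 * real t)"
    unfolding nn_integral_gamma_xi by (subst ennreal_mult'[symmetric]) simp_all
  finally show ?thesis .
qed

section \<open>The measure with density \<open>F\<close> and its typical points\<close>

definition mu :: "nat \<Rightarrow> (coord \<Rightarrow> real) measure" where
  "mu t = density (lborel_Pi (coords t)) (\<lambda>u. ennreal (F t u))"

lemma U_mem_coords: "U0 \<in> coords t" "1 \<le> k \<Longrightarrow> k \<le> t \<Longrightarrow> U j k \<in> coords t"
  by (auto simp: coords_def)

lemma side_coord_sub_coords: "side_coord j ` {..t} \<subseteq> coords t"
  by (auto simp: side_coord_image coords_def)

lemma F_measurable: "0 < t \<Longrightarrow> F t \<in> borel_measurable (lborel_Pi (coords t))"
proof -
  assume t: "0 < t"
  note [measurable] = side_chain_measurable[OF side_coord_sub_coords] component_measurable[OF U_mem_coords(1)]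
  have U: "side_coord j t = U j t" for j using t by (simp add: side_coord_def)
  have "(\<lambda>u. exp (- u U0) * (chain_weight (side_coord L) t u * exp (- xi (u (side_coord L t)))) *
     (chain_weight (side_coord R) t u * exp (- xi (u (side_coord R t))))) \<in> borel_measurable (lborel_Pi (coords t))"
    by measurable
  also have "(\<lambda>u. exp (- u U0) * (chain_weight (side_coord L) t u * exp (- xi (u (side_coord L t)))) *
     (chain_weight (side_coord R) t u * exp (- xi (u (side_coord R t))))) = F t"
    by (rule ext) (simp add: F_eq[OF t] U)
  finally show ?thesis .
qed

lemma space_mu: "space (mu t) = PiE (coords t) (\<lambda>_. UNIV)"
  by (simp add: mu_def space_PiM)

lemma sets_mu: "sets (mu t) = sets (lborel_Pi (coords t))"
  by (simp add: mu_def)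

lemma prob_space_mu: "0 < t \<Longrightarrow> prob_space (mu t)"
proof (rule prob_spaceI)
  assume t: "0 < t"
  have "emeasure (mu t) (space (mu t)) = (\<integral>\<^sup>+u. ennreal (F t u) * indicator (space (lborel_Pi (coords t))) u \<partial>lborel_Pi (coords t))"
    unfolding mu_def using F_measurable[OF t] by (subst emeasure_density) auto
  also have "\<dots> = (\<integral>\<^sup>+u. ennreal (F t u) \<partial>lborel_Pi (coords t))"
    by (intro nn_integral_cong) simp
  finally show "emeasure (mu t) (space (mu t)) = 1" by (simp add: F_total[OF t])
qed

text \<open>What the comparison of densities needs: a peak bounded above, the t-th Poisson point
  within a multiple of its natural fluctuation sqrt t around t, and a spread of the order of its
  mean.\<close>

definition typical :: "real \<Rightarrow> nat \<Rightarrow> (coord \<Rightarrow> real) set" where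
  "typical K t = {u \<in> space (mu t). u U0 \<le> K \<and>
     (\<forall>j. \<bar>xi (u (U j t)) - real t\<bar> \<le> K * sqrt (real t) \<and> spread (side_coord j) t u \<le> K * real t)}"

lemma typical_sets: "0 < t \<Longrightarrow> typical K t \<in> sets (mu t)"
proof -
  assume t: "0 < t"
  have U: "side_coord j t = U j t" for j using t by (simp add: side_coord_def)
  note [measurable] = side_chain_measurable(2,3)[OF side_coord_sub_coords, of _ t, unfolded U] component_measurable[OF U_mem_coords(1), of t]
  have all: "(\<forall>j. Q j) \<longleftrightarrow> Q L \<and> Q R" for Q :: "side \<Rightarrow> bool"
    by (metis side.exhaust)
  have "{u \<in> space (lborel_Pi (coords t)). u U0 \<le> K \<and>
     (\<bar>xi (u (U L t)) - real t\<bar> \<le> K * sqrt (real t) \<and> spread (side_coord L) t u \<le> K * real t) \<and>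
     (\<bar>xi (u (U R t)) - real t\<bar> \<le> K * sqrt (real t) \<and> spread (side_coord R) t u \<le> K * real t)} \<in> sets (lborel_Pi (coords t))"
    by measurable
  then show ?thesis unfolding typical_def all by (simp add: mu_def)
qed

text \<open>A union bound: the Gumbel tail for the peak, Chebyshev's inequality for the deviations
  and Markov's for the spreads. The 12 comes from t + 2 \<le> 3 * t and two sides.\<close>

lemma atypical_measure:
  assumes t: "0 < t" and K: "0 < K"
  shows "measure (mu t) (space (mu t) - typical K t) \<le> exp (- K) + 12 / K\<^sup>2 + 4 / K"
proof -
  let ?N = "lborel_Pi (coords t)"
  have U: "side_coord j t = U j t" for j using t by (simp add: side_coord_def)
  note [measurable] = side_chain_measurable(2,3)[OF side_coord_sub_coords, of _ t, unfolded U] component_measurable[OF U_mem_coords(1), of t] F_measurable[OF t]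
  let ?c = "1 / (K\<^sup>2 * real t)" and ?d = "1 / (K * real t)"
  have c: "0 \<le> ?c" "0 \<le> ?d" using t K by auto
  \<comment> \<open>A pointwise majorant of the restricted density, so that the union bound becomes
    a sum of integrals already estimated.\<close>
  let ?g = "\<lambda>u. indicator {K..} (u U0) * ennreal (F t u)
      + (ennreal ?c * (ennreal ((xi (u (U L t)) - real t)\<^sup>2) * ennreal (F t u)) + ennreal ?d * (ennreal (spread (side_coord L) t u) * ennreal (F t u)))
      + (ennreal ?c * (ennreal ((xi (u (U R t)) - real t)\<^sup>2) * ennreal (F t u)) + ennreal ?d * (ennreal (spread (side_coord R) t u) * ennreal (F t u)))"
  have pos: "0 < K\<^sup>2 * real t" "0 < K * real t" using K t by auto
  have dev: "1 \<le> ennreal ?c * ennreal ((x - real t)\<^sup>2)" if "\<not> \<bar>x - real t\<bar> \<le> K * sqrt (real t)" for x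
  proof -
    have "(K * sqrt (real t))\<^sup>2 \<le> \<bar>x - real t\<bar>\<^sup>2" using that K by (intro power_mono) auto
    then have "K\<^sup>2 * real t \<le> (x - real t)\<^sup>2" using t by (simp add: power_mult_distrib)
    then have "1 \<le> ?c * (x - real t)\<^sup>2" using pos(1) by (simp add: pos_le_divide_eq)
    then have "ennreal 1 \<le> ennreal (?c * (x - real t)\<^sup>2)" by (rule ennreal_leI)
    then show ?thesis by (simp only: ennreal_mult'[OF c(1)] ennreal_1)
  qed
  have spr: "1 \<le> ennreal ?d * ennreal s" if "\<not> s \<le> K * real t" for s
  proof -
    have "1 \<le> ?d * s" using that pos(2) by (simp add: pos_le_divide_eq)
    then have "ennreal 1 \<le> ennreal (?d * s)" by (rule ennreal_leI)
    then show ?thesis by (simp only: ennreal_mult'[OF c(2)] ennreal_1)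
  qed
  have "emeasure (mu t) (space (mu t) - typical K t) = (\<integral>\<^sup>+u. ennreal (F t u) * indicator (space (mu t) - typical K t) u \<partial>?N)"
    using typical_sets[OF t, of K] unfolding mu_def by (subst emeasure_density) (auto simp: mu_def)
  also have "\<dots> \<le> (\<integral>\<^sup>+u. ?g u \<partial>?N)"
  proof (intro nn_integral_mono)
    fix u
    show "ennreal (F t u) * indicator (space (mu t) - typical K t) u \<le> ?g u"
    proof (cases "u \<in> space (mu t) - typical K t")
      case True
      have p: "x \<le> a + (x + y) + b" "y \<le> a + (x + y) + b" "x \<le> a + b + (x + y)" "y \<le> a + b + (x + y)" for a b x y :: ennreal
        by (metis add.assoc add.commute le_iff_add)+
      have *: "1 * ennreal (F t u) \<le> x * ennreal (F t u)" if "1 \<le> x" for x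
        using that by (rule mult_right_mono) simp
      from True obtain j where "K < u U0 \<or> \<not> \<bar>xi (u (U j t)) - real t\<bar> \<le> K * sqrt (real t) \<or> \<not> spread (side_coord j) t u \<le> K * real t"
        by (auto simp: typical_def)
      then consider "K < u U0" | "\<not> \<bar>xi (u (U j t)) - real t\<bar> \<le> K * sqrt (real t)" | "\<not> spread (side_coord j) t u \<le> K * real t" by blast
      then have "ennreal (F t u) \<le> ?g u"
      proof cases
        case 1
        then have "ennreal (F t u) = indicator {K..} (u U0) * ennreal (F t u)" by (simp add: indicator_def)
        then show ?thesis by (metis (no_types, lifting) add.assoc le_iff_add)
      next
        case 2
        from *[OF dev[OF 2]] have "ennreal (F t u) \<le> ennreal ?c * (ennreal ((xi (u (U j t)) - real t)\<^sup>2) * ennreal (F t u))"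
          by (simp only: mult_1_left mult.assoc)
        then show ?thesis by (cases j) (simp_all only:, (rule order_trans[OF _ p(1)] order_trans[OF _ p(3)], assumption)+)
      next
        case 3
        from *[OF spr[OF 3]] have "ennreal (F t u) \<le> ennreal ?d * (ennreal (spread (side_coord j) t u) * ennreal (F t u))"
          by (simp only: mult_1_left mult.assoc)
        then show ?thesis by (cases j) (simp_all only:, (rule order_trans[OF _ p(2)] order_trans[OF _ p(4)], assumption)+)
      qed
      then show ?thesis using True by simp
    qed simp
  qed
  also have "\<dots> = (\<integral>\<^sup>+u. indicator {K..} (u U0) * ennreal (F t u) \<partial>?N)
      + (ennreal ?c * (\<integral>\<^sup>+u. ennreal ((xi (u (U L t)) - real t)\<^sup>2) * ennreal (F t u) \<partial>?N) + ennreal ?d * (\<integral>\<^sup>+u. ennreal (spread (side_coord L) t u) * ennreal (F t u) \<partial>?N))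
      + (ennreal ?c * (\<integral>\<^sup>+u. ennreal ((xi (u (U R t)) - real t)\<^sup>2) * ennreal (F t u) \<partial>?N) + ennreal ?d * (\<integral>\<^sup>+u. ennreal (spread (side_coord R) t u) * ennreal (F t u) \<partial>?N))"
    by (simp add: nn_integral_add nn_integral_cmult)
  also have "\<dots> \<le> ennreal (exp (- K))
      + (ennreal ?c * ennreal (2 * (real t + 2)) + ennreal ?d * ennreal (2 * real t))
      + (ennreal ?c * ennreal (2 * (real t + 2)) + ennreal ?d * ennreal (2 * real t))"
    by (intro add_mono mult_left_mono F_peak_tail F_deviation F_spread t) auto
  also have "\<dots> = ennreal (exp (- K) + (?c * (2 * (real t + 2)) + ?d * (2 * real t)) + (?c * (2 * (real t + 2)) + ?d * (2 * real t)))"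
  proof -
    have A: "0 \<le> ?c * (2 * (real t + 2))" "0 \<le> ?d * (2 * real t)"
      by (intro mult_nonneg_nonneg c; simp)+
    show ?thesis
      by (simp only: ennreal_mult'[OF c(1), symmetric] ennreal_mult'[OF c(2), symmetric] ennreal_plus[symmetric] A add_nonneg_nonneg exp_ge_zero)
  qed
  also have "\<dots> \<le> ennreal (exp (- K) + 12 / K\<^sup>2 + 4 / K)"
  proof (rule ennreal_leI)
    have "?d * (2 * real t) = 2 / K" using t K by simp
    moreover have "?c * (2 * (real t + 2)) \<le> ?c * (6 * real t)" using c t by (intro mult_left_mono) auto
    moreover have "?c * (6 * real t) = 6 / K\<^sup>2" using t by simp
    ultimately have le: "?d * (2 * real t) = 2 / K" "?c * (2 * (real t + 2)) \<le> 6 / K\<^sup>2" by (simp_all only:)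
    have "12 / K\<^sup>2 = 6 / K\<^sup>2 + 6 / K\<^sup>2" "4 / K = 2 / K + 2 / K" by simp_all
    moreover have lin: "e + (A + D) + (A + D) \<le> e + (x + x) + (D + D)" if "A \<le> x" for e A D x :: real
      using that by simp
    ultimately show "exp (- K) + (?c * (2 * (real t + 2)) + ?d * (2 * real t)) + (?c * (2 * (real t + 2)) + ?d * (2 * real t)) \<le> exp (- K) + 12 / K\<^sup>2 + 4 / K"
      using lin[OF le(2), of "exp (- K)" "2 / K"] by (simp only: le(1))
  qed
  finally have "emeasure (mu t) (space (mu t) - typical K t) \<le> ennreal (exp (- K) + 12 / K\<^sup>2 + 4 / K)" .
  then show ?thesis unfolding measure_def using K by (intro enn2real_leI) auto
qed

definition orthant :: "nat \<Rightarrow> real \<Rightarrow> (side \<Rightarrow> nat \<Rightarrow> real) \<Rightarrow> (coord \<Rightarrow> real) set" where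
  "orthant t v0 v = (\<Pi>\<^sub>E i \<in> coords t. {..case i of U0 \<Rightarrow> v0 | U j k \<Rightarrow> v j k})"

lemma orthant_sets: "orthant t v0 v \<in> sets (mu t)"
  unfolding orthant_def sets_mu by (intro sets_PiM_I_finite finite_coords) auto

lemma F_integral_eq_measure:
  assumes t: "0 < t"
  shows "F_integral t v0 v = measure (mu t) (orthant t v0 v)"
proof -
  let ?N = "lborel_Pi (coords t)"
  have b: "orthant t v0 v \<in> sets ?N" using orthant_sets[of t v0 v] by (simp add: sets_mu)
  note [measurable] = F_measurable[OF t] b
  have "F_integral t v0 v = (LINT u|?N. indicator (orthant t v0 v) u * F t u)"
    by (simp add: F_integral_def set_lebesgue_integral_def orthant_def)
  also have "\<dots> = enn2real (\<integral>\<^sup>+u. ennreal (indicator (orthant t v0 v) u * F t u) \<partial>?N)"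
    by (rule integral_eq_nn_integral) (auto simp: F_nonneg)
  also have "(\<integral>\<^sup>+u. ennreal (indicator (orthant t v0 v) u * F t u) \<partial>?N) = (\<integral>\<^sup>+u. ennreal (F t u) * indicator (orthant t v0 v) u \<partial>?N)"
    by (intro nn_integral_cong) (auto simp: indicator_def)
  also have "\<dots> = emeasure (mu t) (orthant t v0 v)"
    unfolding mu_def by (subst emeasure_density) auto
  finally show ?thesis by (simp add: measure_def)
qed

section \<open>Comparison of fibres with the limiting density\<close>

text \<open>The inverse of \<open>rescale n\<close> when \<alpha> = \<open>scale n\<close>.\<close>

definition position :: "real \<Rightarrow> real \<Rightarrow> real" where
  "position \<alpha> x = (x + ln (2 / \<alpha>)) / \<alpha>"

text \<open>If the peak coordinate is at most K, the rounded parts are at most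
  \<open>height K \<alpha> / \<alpha>\<close>; the summand 1 absorbs the rounding.\<close>

definition height :: "real \<Rightarrow> real \<Rightarrow> real" where
  "height K \<alpha> = K + ln (2 / \<alpha>) + 1"

lemma position_mono: "0 < \<alpha> \<Longrightarrow> x \<le> y \<Longrightarrow> position \<alpha> x \<le> position \<alpha> y"
  by (simp add: position_def divide_right_mono)

lemma exp_position:
  assumes "0 < \<alpha>"
  shows "exp (- (\<alpha> * position \<alpha> x)) = \<alpha> * xi x"
proof -
  have "\<alpha> * position \<alpha> x = x + ln (2 / \<alpha>)" using assms by (simp add: position_def)
  then have "exp (- (\<alpha> * position \<alpha> x)) = exp (- x) * exp (- ln (2 / \<alpha>))" by (simp flip: exp_add)
  also have "exp (- ln (2 / \<alpha>)) = \<alpha> / 2" using assms by (simp add: exp_minus)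
  finally show ?thesis by (simp add: xi_def)
qed

lemma xi_le:
  assumes "1 \<le> t" "0 \<le> K" "\<bar>xi x - real t\<bar> \<le> K * sqrt (real t)"
  shows "xi x \<le> (1 + K) * real t"
proof -
  have "sqrt (real t) \<le> sqrt (real t) * sqrt (real t)"
    using assms(1) mult_left_mono[of 1 "sqrt (real t)" "sqrt (real t)"] by simp
  then have "sqrt (real t) \<le> real t" by simp
  then have "K * sqrt (real t) \<le> K * real t" using assms(2) by (rule mult_left_mono)
  then show ?thesis using assms(3) by (simp add: algebra_simps)
qed

text \<open>exp (- \<alpha> * position) equals \<alpha> * xi x, which is below exp (- 2) * sqrt
  \<alpha> when M * sqrt \<alpha> is small. Thus the prescribed parts lie above the cutoff even
  after rounding by 1.\<close>

lemma cutoff_le_position: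
  assumes \<alpha>: "0 < \<alpha>" "\<alpha> \<le> 1/2" and x: "xi x \<le> M" and cut: "M * sqrt \<alpha> \<le> exp (- 2)"
  shows "real (cutoff \<alpha>) + 1 \<le> position \<alpha> x"
proof -
  have "exp (- (\<alpha> * position \<alpha> x)) = (xi x * sqrt \<alpha>) * sqrt \<alpha>"
    unfolding exp_position[OF \<alpha>(1)] using \<alpha> by simp
  also have "\<dots> \<le> exp (- 2) * sqrt \<alpha>"
    using x cut \<alpha> by (intro mult_right_mono order_trans[OF mult_right_mono cut]) auto
  also note exp_minus_half_ln[OF \<alpha>(1), symmetric]
  finally have "2 + ln (1 / \<alpha>) / 2 \<le> \<alpha> * position \<alpha> x" by (simp flip: exp_add)
  then have "(2 + ln (1 / \<alpha>) / 2) / \<alpha> \<le> position \<alpha> x" using \<alpha> by (simp add: pos_divide_le_eq mult.commute)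
  moreover have "(2 + ln (1 / \<alpha>) / 2) / \<alpha> = 2 / \<alpha> + ln (1 / \<alpha>) / (2 * \<alpha>)"
    by (simp add: add_divide_distrib)
  moreover have "2 \<le> 2 / \<alpha>" using \<alpha> by (simp add: pos_le_divide_eq)
  moreover have "real (cutoff \<alpha>) \<le> ln (1 / \<alpha>) / (2 * \<alpha>) + 1"
  proof -
    have "0 \<le> ln (1 / \<alpha>) / (2 * \<alpha>)" using \<alpha> by (intro divide_nonneg_nonneg ln_ge_zero) auto
    then show ?thesis unfolding cutoff_def by linarith
  qed
  ultimately show ?thesis by linarith
qed

text \<open>In order: rounding of the parts; their spread above the t-th one; the fluctuation of the
  number of larger parts times the size of the t-th; the mean excess of order 1 / \<alpha> of each
  larger part; and the replacement of \<open>occ\<close> by exp (- \<alpha> * k) in the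
  tail.\<close>

definition side_error :: "real \<Rightarrow> real \<Rightarrow> real \<Rightarrow> real" where
  "side_error K \<alpha> t = 2 * t + K * t / \<alpha> + (K * sqrt t + 2 * \<alpha> * ((1 + K) * t)) * (height K \<alpha> / \<alpha>)
     + 4 * ((1 + K) * t) / \<alpha> + 4 * sqrt \<alpha> * ((1 + K) * t) * ((height K \<alpha> + 2) / \<alpha>)"

text \<open>The quotient is the sum of exp (- \<alpha> * k) over k > c, about the mean number of
  parts larger than c. Near the position of x it is xi x up to a factor 1 + O(\<alpha>).\<close>

lemma tail_factor_bounds:
  assumes \<alpha>: "0 < \<alpha>" "\<alpha> \<le> 1/2" and near: "\<bar>real c - position \<alpha> x\<bar> \<le> 1"
  shows "qpow \<alpha> (Suc c) / (1 - exp (- \<alpha>)) \<le> (1 + 2 * \<alpha>) * xi x"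
    and "(1 - 2 * \<alpha>) * xi x \<le> qpow \<alpha> (Suc c) / (1 - exp (- \<alpha>))"
    and "qpow \<alpha> c \<le> 2 * (\<alpha> * xi x)"
proof -
  have q: "exp (- \<alpha>) < 1" using \<alpha> by simp
  have x0: "0 < xi x" by (rule xi_pos)
  have ea: "exp \<alpha> \<le> 1 + 2 * \<alpha>"
  proof -
    have "exp \<alpha> \<le> 1 + \<alpha> + \<alpha>\<^sup>2" using \<alpha> by (intro exp_bound) auto
    also have "\<alpha>\<^sup>2 \<le> \<alpha> * 1" unfolding power2_eq_square using \<alpha> by (intro mult_left_mono) auto
    finally show ?thesis by simp
  qed
  have Suc: "qpow \<alpha> (Suc c) = qpow \<alpha> c * exp (- \<alpha>)" by (simp add: algebra_simps flip: exp_add)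
  have up: "qpow \<alpha> c \<le> exp \<alpha> * (\<alpha> * xi x)"
  proof -
    have "\<alpha> * (position \<alpha> x - 1) \<le> \<alpha> * real c" using near \<alpha> by (intro mult_left_mono) auto
    then have "qpow \<alpha> c \<le> exp (\<alpha> + - (\<alpha> * position \<alpha> x))" by (simp add: algebra_simps)
    then show ?thesis unfolding exp_add exp_position[OF \<alpha>(1)] .
  qed
  have lo: "exp (- \<alpha>) * (\<alpha> * xi x) \<le> qpow \<alpha> c"
  proof -
    have "\<alpha> * real c \<le> \<alpha> * (position \<alpha> x + 1)" using near \<alpha> by (intro mult_left_mono) auto
    then have "exp (- \<alpha> + - (\<alpha> * position \<alpha> x)) \<le> qpow \<alpha> c" by (simp add: algebra_simps)
    then show ?thesis unfolding exp_add exp_position[OF \<alpha>(1)] .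
  qed
  show "qpow \<alpha> c \<le> 2 * (\<alpha> * xi x)"
  proof -
    have "exp \<alpha> * (\<alpha> * xi x) \<le> 2 * (\<alpha> * xi x)" using ea \<alpha> x0 by (intro mult_right_mono) auto
    then show ?thesis using up by linarith
  qed
  have "qpow \<alpha> (Suc c) / (1 - exp (- \<alpha>)) = qpow \<alpha> c * (exp (- \<alpha>) / (1 - exp (- \<alpha>)))"
    unfolding Suc by simp
  also have "\<dots> \<le> (exp \<alpha> * (\<alpha> * xi x)) * (1 / \<alpha>)"
    using up inverse_one_minus_exp_bounds(2)[OF \<alpha>(1)] q \<alpha> x0 by (intro mult_mono) auto
  also have "\<dots> = exp \<alpha> * xi x" using \<alpha> by simp
  also have "\<dots> \<le> (1 + 2 * \<alpha>) * xi x" using ea x0 by (intro mult_right_mono) auto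
  finally show "qpow \<alpha> (Suc c) / (1 - exp (- \<alpha>)) \<le> (1 + 2 * \<alpha>) * xi x" .
  have "exp (- \<alpha>) / \<alpha> \<le> exp (- \<alpha>) / (1 - exp (- \<alpha>))"
    using exp_ge_add_one_self[of "- \<alpha>"] q \<alpha> by (intro divide_left_mono) auto
  have "(1 - 2 * \<alpha>) * xi x \<le> exp (- 2 * \<alpha>) * xi x"
    using exp_ge_add_one_self[of "- 2 * \<alpha>"] x0 by (intro mult_right_mono) auto
  also have "\<dots> = (exp (- \<alpha>) * (\<alpha> * xi x)) * (exp (- \<alpha>) / \<alpha>)"
    using \<alpha> by (simp flip: exp_add)
  also have "\<dots> \<le> qpow \<alpha> c * (exp (- \<alpha>) / (1 - exp (- \<alpha>)))"
    using lo \<open>exp (- \<alpha>) / \<alpha> \<le> _\<close> \<alpha> by (intro mult_mono) auto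
  also have "\<dots> = qpow \<alpha> (Suc c) / (1 - exp (- \<alpha>))" unfolding Suc by simp
  finally show "(1 - 2 * \<alpha>) * xi x \<le> qpow \<alpha> (Suc c) / (1 - exp (- \<alpha>))" .
qed

lemma decreasing_chain:
  fixes us :: "nat \<Rightarrow> real"
  assumes "\<And>i. i < t \<Longrightarrow> us (Suc i) \<le> us i" "i \<le> j" "j \<le> t"
  shows "us j \<le> us i"
  using assms(2,3) by (induction j rule: dec_induct) (auto intro: order_trans[OF assms(1)])

text \<open>Bounding the parts by c = \<open>xs t\<close> lowers the mean size by about X * (c + 1 /
  \<alpha>), where X is close to t. The prescribed parts sum to t * c plus their spread. The leading
  terms t * c cancel, which leaves errors of order t / \<alpha> and sqrt t * c.\<close>

lemma side_estimate:
  fixes \<alpha> K :: real and us :: "nat \<Rightarrow> real" and xs :: "nat \<Rightarrow> nat"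
  assumes \<alpha>4: "0 < \<alpha>" "\<alpha> \<le> 1/4" and K: "1 \<le> K" and t: "1 \<le> t"
    and chain: "\<And>i. i < t \<Longrightarrow> us (Suc i) \<le> us i"
    and near: "\<And>k. k \<le> t \<Longrightarrow> \<bar>real (xs k) - position \<alpha> (us k)\<bar> \<le> 1"
    and top: "us 0 \<le> K"
    and dev: "\<bar>xi (us t) - real t\<bar> \<le> K * sqrt (real t)"
    and spr: "(\<Sum>i<t. us i) - real t * us t \<le> K * real t"
    and cut: "cutoff \<alpha> \<le> xs t"
  shows "\<bar>total_mean \<alpha> - mean_upto \<alpha> (xs t) - real (\<Sum>k=1..t. xs k)\<bar> \<le> side_error K \<alpha> (real t)"
proof -
  have \<alpha>: "0 < \<alpha>" "\<alpha> \<le> 1/2" using \<alpha>4 by auto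
  define c where "c = xs t"
  define x where "x = xi (us t)"
  define M where "M = (1 + K) * real t"
  define \<Lambda> where "\<Lambda> = height K \<alpha>"
  have x: "0 < x" "x \<le> M" using xi_pos xi_le[OF t _ dev] K by (auto simp: x_def M_def)
  have M: "0 \<le> M" using K by (simp add: M_def)
  have near_c: "\<bar>real c - position \<alpha> (us t)\<bar> \<le> 1" using near[of t] by (simp add: c_def)
  have mono: "us t \<le> us i" if "i \<le> t" for i using decreasing_chain[of t us i t] chain that by auto
  have cL: "real c \<le> \<Lambda> / \<alpha>"
  proof -
    have "real c \<le> position \<alpha> (us t) + 1" using near_c by linarith
    also have "\<dots> \<le> position \<alpha> K + 1" using mono[of 0] top \<alpha> by (intro add_mono position_mono) auto
    also have "\<dots> \<le> \<Lambda> / \<alpha>" using \<alpha> unfolding position_def \<Lambda>_def height_def by (simp add: field_simps)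
    finally show ?thesis .
  qed
  have L0: "0 \<le> \<Lambda>" using cL \<alpha> by (metis divide_nonneg_pos le_cases of_nat_0_le_iff order_trans zero_le_divide_iff not_less)
  define X where "X = qpow \<alpha> (Suc c) / (1 - exp (- \<alpha>))"
  define g where "g = 1 / (1 - exp (- \<alpha>))"
  have g: "0 \<le> g" "g \<le> 2 / \<alpha>"
  proof -
    show "0 \<le> g" using \<alpha> by (simp add: g_def)
    have "g = 1 + exp (- \<alpha>) / (1 - exp (- \<alpha>))" using \<alpha> by (simp add: g_def field_simps)
    also have "\<dots> \<le> 1 / \<alpha> + 1 / \<alpha>"
      using inverse_one_minus_exp_bounds(2)[OF \<alpha>(1)] \<alpha> by (intro add_mono) (auto simp: pos_le_divide_eq)
    finally show "g \<le> 2 / \<alpha>" by simp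
  qed
  have X: "X \<le> (1 + 2 * \<alpha>) * x" "(1 - 2 * \<alpha>) * x \<le> X" and qc: "qpow \<alpha> c \<le> 2 * (\<alpha> * x)"
    using tail_factor_bounds[OF \<alpha> near_c] by (auto simp: X_def x_def)
  have Xx: "\<bar>X - x\<bar> \<le> 2 * \<alpha> * M"
  proof -
    have "\<bar>X - x\<bar> \<le> 2 * \<alpha> * x" using X by (simp add: abs_le_iff algebra_simps)
    also have "\<dots> \<le> 2 * \<alpha> * M" using x \<alpha> by (intro mult_left_mono) auto
    finally show ?thesis .
  qed
  have X0: "0 \<le> X" unfolding X_def using \<alpha> by (intro divide_nonneg_nonneg) auto
  have X2: "X \<le> 2 * M"
  proof -
    have "(1 + 2 * \<alpha>) * x \<le> 2 * M" using x \<alpha> by (intro mult_mono) auto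
    then show ?thesis using X by linarith
  qed
  define T where "T = tail_sum \<alpha> c"
  have T: "T = X * (real c + g)" by (simp add: T_def tail_sum_def X_def g_def)
  have qs: "qpow \<alpha> c \<le> sqrt \<alpha>"
  proof -
    have "qpow \<alpha> c \<le> qpow \<alpha> (cutoff \<alpha>)" using cut \<alpha> by (simp add: c_def)
    also have "\<dots> \<le> sqrt \<alpha>" by (rule cutoff_bounds[OF \<alpha>])
    finally show ?thesis .
  qed
  have q2: "qpow \<alpha> c \<le> 1/2"
  proof -
    have "sqrt \<alpha> \<le> sqrt ((1/2)\<^sup>2)" using \<alpha>4 by (intro real_sqrt_le_mono) (simp add: power2_eq_square)
    then show ?thesis using qs by simp
  qed
  have tb: "T \<le> total_mean \<alpha> - mean_upto \<alpha> c" "total_mean \<alpha> - mean_upto \<alpha> c \<le> (1 + 2 * qpow \<alpha> c) * T"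
    unfolding T_def by (rule mean_tail_bounds[OF \<alpha>(1) q2])+
  have Tle: "T \<le> 2 * M * ((\<Lambda> + 2) / \<alpha>)"
  proof -
    have "real c + g \<le> \<Lambda> / \<alpha> + 2 / \<alpha>" using cL g by (intro add_mono) auto
    then have "real c + g \<le> (\<Lambda> + 2) / \<alpha>" by (simp add: add_divide_distrib)
    then show ?thesis unfolding T using X0 X2 g M by (intro mult_mono) auto
  qed
  have T0: "0 \<le> T" unfolding T_def by (rule tail_sum_nonneg[OF \<alpha>(1)])
  \<comment> \<open>The mean tail exceeds \<open>tail_sum\<close> by a relative error of at most
    twice exp (- \<alpha> * c), which the cutoff makes O(sqrt \<alpha>).\<close>
  have e1: "\<bar>(total_mean \<alpha> - mean_upto \<alpha> c) - T\<bar> \<le> 4 * sqrt \<alpha> * M * ((\<Lambda> + 2) / \<alpha>)"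
  proof -
    have "2 * qpow \<alpha> c * T \<le> 2 * sqrt \<alpha> * (2 * M * ((\<Lambda> + 2) / \<alpha>))"
      using qs Tle T0 \<alpha> by (intro mult_mono) auto
    then show ?thesis using tb by (simp add: algebra_simps abs_le_iff)
  qed
  have e2: "\<bar>T - real t * real c\<bar> \<le> (K * sqrt (real t) + 2 * \<alpha> * M) * (\<Lambda> / \<alpha>) + 4 * M / \<alpha>"
  proof -
    have "\<bar>X - real t\<bar> \<le> K * sqrt (real t) + 2 * \<alpha> * M" using Xx dev unfolding x_def by linarith
    then have "\<bar>X - real t\<bar> * real c \<le> (K * sqrt (real t) + 2 * \<alpha> * M) * (\<Lambda> / \<alpha>)"
      using cL K \<alpha> M by (intro mult_mono) auto
    moreover have "X * g \<le> (2 * M) * (2 / \<alpha>)" using X2 g M by (intro mult_mono) auto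
    moreover have "T - real t * real c = (X - real t) * real c + X * g" unfolding T by (simp add: algebra_simps)
    moreover have "\<bar>(X - real t) * real c + X * g\<bar> \<le> \<bar>X - real t\<bar> * real c + X * g"
      using abs_triangle_ineq[of "(X - real t) * real c" "X * g"] X0 g by (simp add: abs_mult)
    ultimately show ?thesis by simp
  qed
  \<comment> \<open>Relative to the lowest position only the gaps remain. Their sum is controlled by
    \<open>spr\<close>, and rounding costs at most 2 per part, 1 for the part and 1 for c.\<close>
  have e3: "\<bar>real (\<Sum>k=1..t. xs k) - real t * real c\<bar> \<le> 2 * real t + K * real t / \<alpha>"
  proof -
    define d where "d k = position \<alpha> (us k) - position \<alpha> (us t)" for k
    have d_eq: "d k = (us k - us t) / \<alpha>" for k by (simp add: d_def position_def diff_divide_distrib[symmetric])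
    have d0: "0 \<le> d k" if "k \<le> t" for k using mono[OF that] \<alpha> by (simp add: d_eq)
    have dsum: "(\<Sum>k=1..t. d k) \<le> K * real t / \<alpha>"
    proof -
      have "(\<Sum>k=1..t. d k) \<le> (\<Sum>k\<in>{0..t}. d k)" by (intro sum_mono2) (auto intro: d0)
      also have "\<dots> = (\<Sum>k<t. d k)" by (simp add: d_eq atLeast0AtMost lessThan_Suc_atMost[symmetric])
      also have "\<dots> = ((\<Sum>k<t. us k) - real t * us t) / \<alpha>"
        by (simp add: d_eq sum_divide_distrib[symmetric] sum_subtractf)
      also have "\<dots> \<le> K * real t / \<alpha>" using spr \<alpha> by (intro divide_right_mono) auto
      finally show ?thesis .
    qed
    have dn: "0 \<le> (\<Sum>k=1..t. d k)" by (intro sum_nonneg d0) auto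
    have "real (\<Sum>k=1..t. xs k) - real t * real c = (\<Sum>k=1..t. (real (xs k) - real c - d k)) + (\<Sum>k=1..t. d k)"
      by (simp add: sum_subtractf sum.distrib)
    moreover have "\<bar>\<Sum>k=1..t. (real (xs k) - real c - d k)\<bar> \<le> (\<Sum>k=1..t. 2)"
    proof (rule order_trans[OF sum_abs sum_mono])
      fix k assume "k \<in> {1..t}"
      then have "\<bar>real (xs k) - position \<alpha> (us k)\<bar> \<le> 1" by (intro near) auto
      then show "\<bar>real (xs k) - real c - d k\<bar> \<le> 2" using near_c unfolding d_def by linarith
    qed
    ultimately show ?thesis using dsum dn by (simp add: abs_le_iff)
  qed
  have "\<bar>total_mean \<alpha> - mean_upto \<alpha> c - real (\<Sum>k=1..t. xs k)\<bar> \<le>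
     4 * sqrt \<alpha> * M * ((\<Lambda> + 2) / \<alpha>) + ((K * sqrt (real t) + 2 * \<alpha> * M) * (\<Lambda> / \<alpha>) + 4 * M / \<alpha>) + (2 * real t + K * real t / \<alpha>)"
    using e1 e2 e3 by linarith
  then show ?thesis unfolding side_error_def c_def[symmetric] M_def[symmetric] \<Lambda>_def[symmetric] by simp
qed

text \<open>The probability that no part exceeds c is close to exp (- xi x), the void probability of
  the Poisson limit. By ln (1 - q) \<ge> - q - 2 * q^2 the second-order loss is O(\<alpha> * M^2),
  small when M * sqrt \<alpha> is.\<close>

lemma Zinv_ratio_lower:
  assumes \<alpha>: "0 < \<alpha>" "\<alpha> \<le> 1/2" and near: "\<bar>real c - position \<alpha> x\<bar> \<le> 1" and x: "xi x \<le> M"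
    and q2: "qpow \<alpha> c \<le> 1/2" and cn: "c \<le> n"
  shows "exp (- xi x - 2 * \<alpha> * M - 8 * \<alpha> * M\<^sup>2) \<le> (\<Prod>k\<in>{c<..n}. 1 - qpow \<alpha> k)"
proof -
  let ?q = "\<lambda>k. qpow \<alpha> k"
  have q: "?q k \<le> ?q c" if "c < k" for k using that \<alpha> by simp
  have x0: "0 < xi x" by (rule xi_pos)
  have M: "0 < M" using x x0 by linarith
  define X where "X = ?q (Suc c) / (1 - exp (- \<alpha>))"
  have X: "X \<le> (1 + 2 * \<alpha>) * xi x" and qc: "?q c \<le> 2 * (\<alpha> * xi x)"
    using tail_factor_bounds[OF \<alpha> near] by (auto simp: X_def)
  have Xle: "X \<le> xi x + 2 * \<alpha> * M"
  proof -
    have "2 * \<alpha> * xi x \<le> 2 * \<alpha> * M" using x \<alpha> by (intro mult_left_mono) auto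
    then show ?thesis using X by (simp add: algebra_simps)
  qed
  have X2: "X \<le> 2 * M"
  proof -
    have "(1 + 2 * \<alpha>) * xi x \<le> 2 * M" using x x0 \<alpha> by (intro mult_mono) auto
    then show ?thesis using X by linarith
  qed
  have S: "(\<Sum>k\<in>{c<..n}. ?q k) \<le> X"
    unfolding sum_exp_interval[OF \<alpha>(1) cn] X_def using \<alpha> by (intro divide_right_mono) auto
  have S0: "0 \<le> (\<Sum>k\<in>{c<..n}. ?q k)" by (intro sum_nonneg) auto
  have "(\<Sum>k\<in>{c<..n}. ?q k + 2 * (?q k)\<^sup>2) \<le> (\<Sum>k\<in>{c<..n}. (1 + 2 * ?q c) * ?q k)"
    using q by (intro sum_mono) (auto simp: power2_eq_square distrib_right intro!: mult_right_mono)
  also have "\<dots> = (\<Sum>k\<in>{c<..n}. ?q k) + 2 * ?q c * (\<Sum>k\<in>{c<..n}. ?q k)"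
    by (simp add: sum_distrib_left distrib_right sum.distrib)
  also have "\<dots> \<le> (xi x + 2 * \<alpha> * M) + (2 * (2 * (\<alpha> * M))) * (2 * M)"
  proof -
    have b: "2 * ?q c \<le> 2 * (2 * (\<alpha> * M))" using qc x \<alpha> mult_left_mono[OF x, of \<alpha>] by linarith
    have "2 * ?q c * (\<Sum>k\<in>{c<..n}. ?q k) \<le> (2 * (2 * (\<alpha> * M))) * (2 * M)"
      by (rule mult_mono[OF b]) (use S S0 X2 M \<alpha> in auto)
    then show ?thesis using S Xle by linarith
  qed
  finally have "(\<Sum>k\<in>{c<..n}. ?q k + 2 * (?q k)\<^sup>2) \<le> xi x + 2 * \<alpha> * M + 8 * \<alpha> * M\<^sup>2"
    by (simp add: power2_eq_square)
  then have "exp (- xi x - 2 * \<alpha> * M - 8 * \<alpha> * M\<^sup>2) \<le> exp (\<Sum>k\<in>{c<..n}. - ?q k - 2 * (?q k)\<^sup>2)"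
    by (simp add: sum_negf sum_subtractf sum.distrib)
  also have "\<dots> = (\<Prod>k\<in>{c<..n}. exp (- ?q k - 2 * (?q k)\<^sup>2))" by (rule exp_sum) simp
  also have "\<dots> \<le> (\<Prod>k\<in>{c<..n}. 1 - ?q k)"
  proof (intro prod_mono conjI)
    fix k assume k: "k \<in> {c<..n}"
    have qk: "0 < ?q k" "?q k \<le> 1/2" using order_trans[OF q q2] k by auto
    show "exp (- ?q k - 2 * (?q k)\<^sup>2) \<le> 1 - ?q k"
    proof -
      have "exp (- ?q k - 2 * (?q k)\<^sup>2) \<le> exp (ln (1 - ?q k))"
        unfolding exp_le_cancel_iff by (rule ln_one_minus_pos_lower_bound) (use qk in auto)
      also have "\<dots> = 1 - ?q k" 
      proof (rule exp_ln)
        show "0 < 1 - ?q k" using qk by linarith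
      qed
      finally show ?thesis .
    qed
  qed auto
  finally show ?thesis .
qed

section \<open>The probability of one pattern of large parts\<close>

definition coord_val :: "peaked_seq \<Rightarrow> coord \<Rightarrow> nat" where
  "coord_val s i = (case i of U0 \<Rightarrow> PK s | U j k \<Rightarrow> Y j k s)"

lemma scale_size:
  assumes "0 < n" shows "real n = pi\<^sup>2 / 3 / (scale n)\<^sup>2"
proof -
  have "(scale n)\<^sup>2 = 1 / (B\<^sup>2 * real n)" by (simp add: scale_def power_divide power_mult_distrib)
  moreover have "B\<^sup>2 = 3 / pi\<^sup>2" by (simp add: B_def power_divide)
  ultimately show ?thesis using assms by simp
qed

text \<open>Bounds, in units of \<open>sdev\<close>, the distance between the size left for the two
  truncated partitions and its mean: the error of the total mean on two sides, the peak itself, and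
  \<open>side_error\<close> for each side.\<close>

definition deviation_bound :: "real \<Rightarrow> real \<Rightarrow> real \<Rightarrow> real" where
  "deviation_bound K \<alpha> t = (2 * (mean_const * \<alpha> powr (- (5/4))) + height K \<alpha> / \<alpha> + 2 * side_error K \<alpha> t) / sdev \<alpha>"

text \<open>All relative losses together: rounding 2t + 1 parts by at most 1,
  \<open>Zinv_ratio_lower\<close> on both sides, and the quotient of the lower and upper local limit
  bounds. When t * sqrt \<alpha> tends to 0, only the loss through \<epsilon> remains.\<close>

definition density_factor :: "real \<Rightarrow> real \<Rightarrow> nat \<Rightarrow> real \<Rightarrow> real" where
  "density_factor K \<alpha> t \<epsilon> =
     exp (- (\<alpha> * (2 * real t + 1)) - 4 * \<alpha> * ((1 + K) * real t) - 16 * \<alpha> * ((1 + K) * real t)\<^sup>2) *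
     ((sqrt (2 * pi) - 2 * deviation_bound K \<alpha> (real t) - \<epsilon>) / (sqrt (2 * pi) + \<epsilon>))"

text \<open>\<alpha>^(2t + 1) is the volume of a lattice cell. The 2t + 1 coordinates give a factor
  \<alpha> / 2 each, while \<open>F\<close> contains only 2t factors 1/2; the remaining 2 cancels
  the 1/2 in \<open>card_unimodal_seqs_asymp\<close>.\<close>

lemma rescaled_density:
  assumes \<alpha>: "0 < \<alpha>" and t: "0 < t" and nz: "F t u \<noteq> 0"
  shows "\<alpha> ^ (2 * t + 1) * F t u = 2 * exp (- (\<alpha> * (position \<alpha> (u U0) + (\<Sum>k=1..t. position \<alpha> (u (U L k)) + position \<alpha> (u (U R k)))))
     - xi (u (U L t)) - xi (u (U R t)))"
proof -
  define l where "l = ln (2 / \<alpha>)"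
  have el: "exp (- l) = \<alpha> / 2" using \<alpha> by (simp add: l_def exp_minus)
  have pos: "\<alpha> * position \<alpha> x = x + l" for x using \<alpha> by (simp add: position_def l_def)
  have "\<alpha> * (position \<alpha> (u U0) + (\<Sum>k=1..t. position \<alpha> (u (U L k)) + position \<alpha> (u (U R k))))
    = (u U0 + l) + (\<Sum>k=1..t. (u (U L k) + l) + (u (U R k) + l))"
    by (simp add: distrib_left sum_distrib_left pos)
  also have "\<dots> = u U0 + (\<Sum>k=1..t. u (U L k) + u (U R k)) + (2 * real t + 1) * l"
    by (simp add: sum.distrib algebra_simps)
  finally have S: "\<alpha> * (position \<alpha> (u U0) + (\<Sum>k=1..t. position \<alpha> (u (U L k)) + position \<alpha> (u (U R k))))
    = u U0 + (\<Sum>k=1..t. u (U L k) + u (U R k)) + (2 * real t + 1) * l" .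
  have "exp (- ((2 * real t + 1) * l)) = exp (- l) ^ (2 * t + 1)"
  proof -
    have "exp (real (2 * t + 1) * - l) = exp (- l) ^ (2 * t + 1)" by (rule exp_of_nat_mult)
    moreover have "real (2 * t + 1) * - l = - ((2 * real t + 1) * l)" by (simp add: algebra_simps)
    ultimately show ?thesis by (simp only:)
  qed
  also have "\<dots> = \<alpha> ^ (2 * t + 1) / 2 ^ (2 * t + 1)" unfolding el power_divide ..
  finally have e: "exp (- ((2 * real t + 1) * l)) = \<alpha> ^ (2 * t + 1) / 2 ^ (2 * t + 1)" .
  have "F t u = 1 / 2 ^ (2 * t) * exp (- u U0 - (\<Sum>k = 1..t. u (U L k) + u (U R k)) - exp (- u (U L t)) / 2 - exp (- u (U R t)) / 2)"
    using nz unfolding F_def by (auto split: if_splits)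
  also have "exp (- u U0 - (\<Sum>k = 1..t. u (U L k) + u (U R k)) - exp (- u (U L t)) / 2 - exp (- u (U R t)) / 2)
     = exp (- (u U0 + (\<Sum>k=1..t. u (U L k) + u (U R k))) - xi (u (U L t)) - xi (u (U R t)))"
    by (simp add: xi_def)
  finally have "\<alpha> ^ (2 * t + 1) * F t u = 2 * ((\<alpha> ^ (2 * t + 1) / 2 ^ (2 * t + 1)) *
      exp (- (u U0 + (\<Sum>k=1..t. u (U L k) + u (U R k))) - xi (u (U L t)) - xi (u (U R t))))"
    by simp
  also have "\<dots> = 2 * exp (- (u U0 + (\<Sum>k=1..t. u (U L k) + u (U R k)) + (2 * real t + 1) * l) - xi (u (U L t)) - xi (u (U R t)))"
    unfolding e[symmetric] exp_add[symmetric] by (simp add: algebra_simps)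
  finally show ?thesis unfolding S .
qed

text \<open>The fibre has at least \<open>num_pairs\<close> elements. Expressed through
  \<open>wt\<close> and \<open>Zinv\<close> and divided by the bound \<open>ub\<close>, this is a
  local limit factor times the Boltzmann weight of the prescribed parts times two void
  probabilities, which is compared with \<open>F\<close>. The vector \<open>a\<close> may be any
  monotone rounding of the positions, because two different roundings are needed later.\<close>

lemma fibre_lower:
  fixes n t :: nat and K \<epsilon> :: real and u :: "coord \<Rightarrow> real" and a :: "coord \<Rightarrow> int"
  defines "\<alpha> \<equiv> scale n" and "M \<equiv> (1 + K) * real t"
  assumes n: "0 < n" and \<alpha>4: "\<alpha> \<le> 1/4" and K: "1 \<le> K" and t: "1 \<le> t"
    and u: "u \<in> typical K t" and nz: "F t u \<noteq> 0"
    and near: "\<And>i. i \<in> coords t \<Longrightarrow> \<bar>real_of_int (a i) - position \<alpha> (u i)\<bar> \<le> 1"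
    and mono: "\<And>i j. i \<in> coords t \<Longrightarrow> j \<in> coords t \<Longrightarrow> u i \<le> u j \<Longrightarrow> a i \<le> a j"
    and cut: "M * sqrt \<alpha> \<le> exp (- 2)"
    and size: "(2 * real t + 1) * (height K \<alpha> / \<alpha>) \<le> real n"
    and llt: "\<And>a b. cutoff \<alpha> \<le> a \<Longrightarrow> cutoff \<alpha> \<le> b \<Longrightarrow> llt_err \<alpha> a b \<le> \<epsilon>"
    and c11: "11 \<le> \<alpha> * real (cutoff \<alpha>)"
    and ub: "2 * pi * sdev \<alpha> * (real (card (unimodal_seqs n)) * qpow \<alpha> n * (Zinv \<alpha> n)\<^sup>2) \<le> (sqrt (2 * pi) + \<epsilon>) / 2"
    and \<epsilon>: "0 < \<epsilon>" and pos: "0 \<le> sqrt (2 * pi) - 2 * deviation_bound K \<alpha> (real t) - \<epsilon>"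
  shows "density_factor K \<alpha> t \<epsilon> * (\<alpha> ^ (2 * t + 1) * F t u)
     \<le> real (card {s \<in> unimodal_seqs n. \<forall>i\<in>coords t. int (coord_val s i) = a i}) / real (card (unimodal_seqs n))"
proof -
  let ?fibre = "{s \<in> unimodal_seqs n. \<forall>i\<in>coords t. int (coord_val s i) = a i}"
  have \<alpha>: "0 < \<alpha>" "\<alpha> \<le> 1/2" using scale_pos[OF n] \<alpha>4 by (auto simp: \<alpha>_def)
  have t0: "0 < t" using t by simp
  define us where "us j k = u (side_coord j k)" for j k
  define x where "x j k = nat (a (side_coord j k))" for j k
  define p where "p = nat (a U0)"
  have mem: "side_coord j k \<in> coords t" if "k \<le> t" for j k
    using side_coord_sub_coords[of j t] that by auto
  have chain: "us j (Suc i) \<le> us j i" if "i < t" for j i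
  proof -
    have "chain_weight (side_coord j) t u \<noteq> 0" using nz F_eq[OF t0] by (cases j) auto
    then show ?thesis using that unfolding chain_weight_eq us_def by (auto split: if_splits)
  qed
  have usmono: "us j k' \<le> us j k" if "k \<le> k'" "k' \<le> t" for j k k'
    using decreasing_chain[of t "us j" k k'] chain that by auto
  have ut: "us j t = u (U j t)" for j using t by (simp add: us_def side_coord_def)
  have gd: "u U0 \<le> K" "\<bar>xi (us j t) - real t\<bar> \<le> K * sqrt (real t)" "spread (side_coord j) t u \<le> K * real t" for j
    using u by (auto simp: typical_def ut)
  have xiM: "xi (us j t) \<le> M" for j unfolding M_def using gd(2) K t by (intro xi_le) auto
  have cutp: "real (cutoff \<alpha>) + 1 \<le> position \<alpha> (us j k)" if "k \<le> t" for j k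
    using cutoff_le_position[OF \<alpha> xiM cut, of j] position_mono[OF \<alpha>(1) usmono[OF that order_refl, of j]] by linarith
  have xa: "int (x j k) = a (side_coord j k)" and nearx: "\<bar>real (x j k) - position \<alpha> (us j k)\<bar> \<le> 1" and xcut: "cutoff \<alpha> \<le> x j k"
    if "k \<le> t" for j k
  proof -
    have n1: "\<bar>real_of_int (a (side_coord j k)) - position \<alpha> (us j k)\<bar> \<le> 1"
      unfolding us_def by (rule near[OF mem[OF that]])
    then have "real (cutoff \<alpha>) \<le> real_of_int (a (side_coord j k))" using cutp[OF that, of j] by linarith
    then have c: "int (cutoff \<alpha>) \<le> a (side_coord j k)" by linarith
    then show e: "int (x j k) = a (side_coord j k)" by (simp add: x_def)
    show "cutoff \<alpha> \<le> x j k" using c e by linarith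
    have "real (x j k) = real_of_int (a (side_coord j k))" using e by (metis of_int_of_nat_eq)
    then show "\<bar>real (x j k) - position \<alpha> (us j k)\<bar> \<le> 1" using n1 by simp
  qed
  have x0: "x j 0 = p" for j by (simp add: x_def p_def)
  have cpos: "0 < cutoff \<alpha>" using c11 by (cases "cutoff \<alpha> = 0") auto
  have xle: "real (x j k) \<le> height K \<alpha> / \<alpha>" if "k \<le> t" for j k
  proof -
    have "real (x j k) \<le> position \<alpha> (us j k) + 1" using nearx[OF that, of j] by linarith
    also have "\<dots> \<le> position \<alpha> K + 1"
      using usmono[of 0 k j] that gd(1) \<alpha> by (intro add_mono position_mono) (auto simp: us_def)
    also have "\<dots> \<le> height K \<alpha> / \<alpha>" using \<alpha> unfolding position_def height_def by (simp add: field_simps)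
    finally show ?thesis .
  qed
  define S where "S = p + (\<Sum>k=1..t. x L k + x R k)"
  have "real S \<le> height K \<alpha> / \<alpha> + (\<Sum>k=1..t. height K \<alpha> / \<alpha> + height K \<alpha> / \<alpha>)"
    unfolding S_def of_nat_add of_nat_sum using xle[of 0 L] x0 by (intro add_mono sum_mono xle) auto
  also have "\<dots> = (2 * real t + 1) * (height K \<alpha> / \<alpha>)" by (simp add: algebra_simps)
  finally have Sn: "S \<le> n" using size by linarith
  define m where "m = n - S"
  have nm: "n = m + p + (\<Sum>k=1..t. x L k + x R k)" using Sn by (simp add: m_def S_def)
  have side: "\<bar>total_mean \<alpha> - mean_upto \<alpha> (x j t) - real (\<Sum>k=1..t. x j k)\<bar> \<le> side_error K \<alpha> (real t)" for j
  proof (rule side_estimate[of \<alpha> K t "us j" "x j"])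
    show "(\<Sum>i<t. us j i) - real t * us j t \<le> K * real t"
      using gd(3)[of j] by (simp add: spread_eq us_def)
  qed (use \<alpha> \<alpha>4 K t chain nearx gd xcut in \<open>auto simp: us_def[of _ 0]\<close>)
  define D where "D = real m - mean_upto \<alpha> (x L t) - mean_upto \<alpha> (x R t)"
  have "\<bar>D\<bar> \<le> 2 * (mean_const * \<alpha> powr (- (5/4))) + height K \<alpha> / \<alpha> + 2 * side_error K \<alpha> (real t)"
  proof -
    have "real n = 2 * (pi\<^sup>2 / 6 / \<alpha>\<^sup>2)" using scale_size[OF n] by (simp add: \<alpha>_def)
    then have "\<bar>real n - 2 * total_mean \<alpha>\<bar> \<le> 2 * (mean_const * \<alpha> powr (- (5/4)))"
      using total_mean_approx[OF \<alpha>(1)] by linarith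
    moreover have "real p \<le> height K \<alpha> / \<alpha>" using xle[of 0 L] x0 by simp
    moreover have "D = (real n - 2 * total_mean \<alpha>) - real p + (total_mean \<alpha> - mean_upto \<alpha> (x L t) - real (\<Sum>k=1..t. x L k))
       + (total_mean \<alpha> - mean_upto \<alpha> (x R t) - real (\<Sum>k=1..t. x R k))"
    proof -
      have "real n = real (m + p + (\<Sum>k=1..t. x L k + x R k))" using nm by (rule arg_cong)
      then show ?thesis unfolding D_def by (simp add: sum.distrib)
    qed
    ultimately show ?thesis using side[of L] side[of R] by linarith
  qed
  then have Dle: "\<bar>D / sdev \<alpha>\<bar> \<le> deviation_bound K \<alpha> (real t)"
    using sdev_pos[OF \<alpha>] unfolding deviation_bound_def by (simp add: abs_divide divide_right_mono)
  define W where "W = 2 * pi * sdev \<alpha> * wt \<alpha> (x L t) (x R t) m"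
  define G where "G = sqrt (2 * pi) + \<epsilon>"
  have G: "0 < G" using \<epsilon> by (simp add: G_def add_nonneg_pos)
  define w0 where "w0 = sqrt (2 * pi) - 2 * deviation_bound K \<alpha> (real t) - \<epsilon>"
  have Ww: "w0 \<le> W"
  proof -
    have "\<alpha> * real (cutoff \<alpha>) \<le> \<alpha> * real (x L t)" using xcut[of t L] \<alpha> by (intro mult_left_mono) auto
    then have "11 \<le> \<alpha> * real (x L t)" using c11 by linarith
    from wt_gauss(2)[OF \<alpha> this, of m "x R t"] show ?thesis
      using Dle llt[OF xcut[of t L] xcut[of t R]] unfolding W_def w0_def D_def by linarith
  qed
  have xn: "x j t \<le> n" for j
  proof -
    have "x j t \<le> (\<Sum>k=1..t. x j k)" using t by (intro member_le_sum) auto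
    also have "\<dots> \<le> (\<Sum>k=1..t. x L k + x R k)" by (cases j) (auto intro!: sum_mono)
    finally show ?thesis using nm by linarith
  qed
  define Rr where "Rr j = (\<Prod>k\<in>{x j t<..n}. 1 - qpow \<alpha> k)" for j
  have R0: "0 < Rr j" for j unfolding Rr_def using \<alpha> by (intro prod_pos) auto
  have ZR: "Zinv \<alpha> n = Zinv \<alpha> (x j t) * Rr j" for j unfolding Rr_def by (rule Zinv_split[OF xn])
  let ?r = "\<lambda>j. exp (- xi (us j t) - 2 * \<alpha> * M - 8 * \<alpha> * M\<^sup>2)"
  have Rl: "exp (- xi (us j t) - 2 * \<alpha> * M - 8 * \<alpha> * M\<^sup>2) \<le> Rr j" for j
    unfolding Rr_def
  proof (rule Zinv_ratio_lower[OF \<alpha> nearx[OF order_refl] xiM _ xn])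
    have "qpow \<alpha> (x j t) \<le> qpow \<alpha> (cutoff \<alpha>)" using xcut[of t j] \<alpha> by simp
    also have "\<dots> \<le> sqrt \<alpha>" by (rule cutoff_bounds[OF \<alpha>])
    also have "\<dots> \<le> sqrt ((1/2)\<^sup>2)" using \<alpha>4 by (intro real_sqrt_le_mono) (simp add: power2_eq_square)
    finally show "qpow \<alpha> (x j t) \<le> 1/2" by simp
  qed
  define Q where "Q = position \<alpha> (u U0) + (\<Sum>k=1..t. position \<alpha> (u (U L k)) + position \<alpha> (u (U R k)))"
  have SQ: "real S \<le> Q + (2 * real t + 1)"
  proof -
    have *: "real (x j k) \<le> position \<alpha> (u (U j k)) + 1" if "k \<in> {1..t}" for j k
      using nearx[of k j] that by (auto simp: us_def side_coord_def split: if_splits)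
    have "real S \<le> (position \<alpha> (u U0) + 1) + (\<Sum>k=1..t. (position \<alpha> (u (U L k)) + 1) + (position \<alpha> (u (U R k)) + 1))"
      unfolding S_def of_nat_add of_nat_sum using nearx[of 0 L] x0[of L]
      by (intro add_mono sum_mono *) (auto simp: us_def abs_le_iff)
    also have "\<dots> = Q + (2 * real t + 1)" by (simp add: Q_def sum.distrib)
    finally show ?thesis .
  qed
  have dens: "\<alpha> ^ (2 * t + 1) * F t u = 2 * exp (- (\<alpha> * Q) - xi (us L t) - xi (us R t))"
    unfolding Q_def ut by (rule rescaled_density[OF \<alpha>(1) t0 nz])
  \<comment> \<open>Turns the density into the factors that occur in the count: \<open>W\<close> for
    the local limit, \<open>qpow \<alpha> S\<close> for the prescribed parts and \<open>Rr\<close>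
    for the absence of further large parts.\<close>
  have step1: "density_factor K \<alpha> t \<epsilon> * (\<alpha> ^ (2 * t + 1) * F t u) \<le> 2 * (W / G) * qpow \<alpha> S * (Rr L * Rr R)"
  proof -
    have "density_factor K \<alpha> t \<epsilon> * (\<alpha> ^ (2 * t + 1) * F t u) =
      2 * (w0 / G) * (exp (- (\<alpha> * (2 * real t + 1)) - 4 * \<alpha> * M - 16 * \<alpha> * M\<^sup>2) * exp (- (\<alpha> * Q) - xi (us L t) - xi (us R t)))"
      unfolding density_factor_def dens w0_def[symmetric] G_def[symmetric] M_def[symmetric] by simp
    also have "exp (- (\<alpha> * (2 * real t + 1)) - 4 * \<alpha> * M - 16 * \<alpha> * M\<^sup>2) * exp (- (\<alpha> * Q) - xi (us L t) - xi (us R t))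
       = exp (- (\<alpha> * (Q + (2 * real t + 1)))) * (?r L * ?r R)"
      unfolding exp_add[symmetric] by (simp add: algebra_simps)
    also have "2 * (w0 / G) * \<dots> \<le> 2 * (W / G) * (qpow \<alpha> S * (Rr L * Rr R))"
    proof (rule mult_mono)
      show "2 * (w0 / G) \<le> 2 * (W / G)" using Ww G by (simp add: divide_right_mono)
      show "exp (- (\<alpha> * (Q + (2 * real t + 1)))) * (?r L * ?r R)
         \<le> qpow \<alpha> S * (Rr L * Rr R)"
      proof (rule mult_mono)
        show "exp (- (\<alpha> * (Q + (2 * real t + 1)))) \<le> qpow \<alpha> S"
          using mult_left_mono[OF SQ, of \<alpha>] \<alpha> by simp
        show "?r L * ?r R \<le> Rr L * Rr R"
          using Rl less_imp_le[OF R0] by (intro mult_mono) auto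
      qed auto
      show "0 \<le> 2 * (W / G)" using Ww pos G unfolding w0_def by simp
    qed auto
    finally show ?thesis by (simp only: mult.assoc)
  qed
  define U where "U = real (card (unimodal_seqs n))"
  have U: "0 < U" unfolding U_def using finite_unimodal_seqs[of n] unimodal_seqs_nonempty[OF n] by (simp add: card_gt_0_iff)
  have \<sigma>: "0 < sdev \<alpha>" by (rule sdev_pos[OF \<alpha>])
  have Z0: "0 < Zinv \<alpha> k" for k by (rule Zinv_pos[OF \<alpha>(1)])
  \<comment> \<open>The Boltzmann weights are undone: they combine to exactly those of
    \<open>ub\<close>, whose bound G / 2 cancels 2 / G.\<close>
  have step2: "2 * (W / G) * qpow \<alpha> S * (Rr L * Rr R) * U \<le> real (num_pairs (x L t) (x R t) m)"
  proof -
    have em: "qpow \<alpha> n = qpow \<alpha> m * qpow \<alpha> S"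
      using Sn by (simp add: m_def of_nat_diff algebra_simps flip: exp_add)
    define C where "C = real (num_pairs (x L t) (x R t) m)"
    have C0: "0 \<le> C" by (simp add: C_def)
    have WC: "W = 2 * pi * sdev \<alpha> * (C * qpow \<alpha> m * Zinv \<alpha> (x L t) * Zinv \<alpha> (x R t))"
      by (simp add: W_def wt_def C_def)
    have Z2: "(Zinv \<alpha> n)\<^sup>2 = Zinv \<alpha> (x L t) * Zinv \<alpha> (x R t) * (Rr L * Rr R)"
      unfolding power2_eq_square by (subst ZR[of L], subst ZR[of R]) (simp only: mult_ac)
    have "2 * (W / G) * qpow \<alpha> S * (Rr L * Rr R) * U
       = C * (2 / G * (2 * pi * sdev \<alpha> * (U * qpow \<alpha> n * (Zinv \<alpha> n)\<^sup>2)))"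
      unfolding WC Z2 em by (simp add: mult_ac)
    also have "\<dots> \<le> C * (2 / G * (G / 2))"
      using ub C0 G unfolding U_def G_def[symmetric] by (intro mult_left_mono) auto
    also have "\<dots> = C" using G by simp
    finally show ?thesis by (simp add: C_def)
  qed
  have "num_pairs (x L t) (x R t) m \<le> card {s \<in> unimodal_seqs n. PK s = p \<and> (\<forall>k\<in>{1..t}. Y L k s = x L k \<and> Y R k s = x R k)}"
  proof (rule num_pairs_le_card_fibre[OF t0 _ _ _ _ _ _ nm])
    show "0 < x L t" "0 < x R t" using xcut[of t L] xcut[of t R] cpos by auto
    have xm: "x j k' \<le> x j k" if "k \<le> k'" "k' \<le> t" for j k k'
      unfolding x_def using mono[OF mem mem, of k' k j j] usmono[OF that, of j] that by (auto simp: us_def intro!: nat_mono)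
    show "x L j \<le> x L i" "x R j \<le> x R i" if "1 \<le> i" "i \<le> j" "j \<le> t" for i j using xm that by auto
    show "x L 1 \<le> p" "x R 1 \<le> p" using xm[of 0 1 L] xm[of 0 1 R] t x0[of L] x0[of R] by simp_all
  qed
  also have "\<dots> \<le> card ?fibre"
  proof (rule card_mono)
    show "{s \<in> unimodal_seqs n. PK s = p \<and> (\<forall>k\<in>{1..t}. Y L k s = x L k \<and> Y R k s = x R k)}
      \<subseteq> ?fibre"
    proof safe
      fix s i assume s: "\<forall>k\<in>{1..t}. Y L k s = x L k \<and> Y R k s = x R k" "p = PK s" and i: "i \<in> coords t"
      show "int (coord_val s i) = a i"
      proof (cases i)
        case U0
        then show ?thesis using xa[of 0 L] x0[of L] s by (simp add: coord_val_def)
      next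
        case (U j k)
        then have k: "k \<in> {1..t}" using i by (auto simp: coords_def)
        then have "Y j k s = x j k" using s by (cases j) auto
        then show ?thesis using U xa[of k j] k by (simp add: coord_val_def side_coord_def)
      qed
    qed
  qed (simp add: finite_unimodal_seqs)
  finally have "real (num_pairs (x L t) (x R t) m) \<le> real (card ?fibre)"
    by simp
  then have "2 * (W / G) * qpow \<alpha> S * (Rr L * Rr R) * U \<le> real (card ?fibre)"
    using step2 by linarith
  then have "2 * (W / G) * qpow \<alpha> S * (Rr L * Rr R) \<le> real (card ?fibre) / U"
    using U by (simp add: pos_le_divide_eq)
  then show ?thesis using step1 unfolding U_def by linarith
qed

section \<open>Total variation comparison\<close>

text \<open>
  If \<open>s\<close> lies outside the event in question, then its cell for \<open>\<theta> = 1\<close> is disjoint from the region of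
  integration; if \<open>s\<close> lies in the event, then its cell for \<open>\<theta> = 0\<close> is contained in that region. So no
  boundary terms arise in either of the two lower bounds in the main proof.
\<close>
definition cell :: "nat \<Rightarrow> nat \<Rightarrow> int \<Rightarrow> peaked_seq \<Rightarrow> (coord \<Rightarrow> real) set" where
  "cell n t \<theta> s = (\<Pi>\<^sub>E i \<in> coords t.
     {rescale n (real_of_int (int (coord_val s i) + \<theta> - 1)) <.. rescale n (real_of_int (int (coord_val s i) + \<theta>))})"

lemma rescale_eq:
  assumes "0 < n" shows "rescale n y = scale n * y - ln (2 / scale n)"
proof -
  have "B * sqrt (real n) \<noteq> 0" using assms B_pos by simp
  then show ?thesis by (simp add: rescale_def scale_def diff_divide_distrib mult.assoc)
qed

lemma rescale_position:
  assumes "0 < n"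
  shows "rescale n y < x \<longleftrightarrow> y < position (scale n) x" "x \<le> rescale n y \<longleftrightarrow> position (scale n) x \<le> y"
  using scale_pos[OF assms] unfolding rescale_eq[OF assms] position_def
  by (simp_all add: pos_less_divide_eq pos_divide_le_eq algebra_simps)

text \<open>Cells are half-open, so a point lies in the cells of exactly those sequences whose
  values are one fixed rounding of its positions: the ceiling for \<theta> = 0, one less for
  \<theta> = 1.\<close>

lemma cell_iff:
  assumes "0 < n" "u \<in> space (mu t)"
  shows "u \<in> cell n t \<theta> s \<longleftrightarrow> (\<forall>i\<in>coords t. int (coord_val s i) = \<lceil>position (scale n) (u i)\<rceil> - \<theta>)"
proof -
  have "u \<in> cell n t \<theta> s \<longleftrightarrow> (\<forall>i\<in>coords t. rescale n (real_of_int (int (coord_val s i) + \<theta> - 1)) < u i \<and> u i \<le> rescale n (real_of_int (int (coord_val s i) + \<theta>)))"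
    using assms(2) by (auto simp: cell_def space_mu PiE_def Pi_def)
  also have "\<dots> \<longleftrightarrow> (\<forall>i\<in>coords t. \<lceil>position (scale n) (u i)\<rceil> = int (coord_val s i) + \<theta>)"
    unfolding rescale_position[OF assms(1)] by (simp add: ceiling_eq_iff)
  also have "\<dots> \<longleftrightarrow> (\<forall>i\<in>coords t. int (coord_val s i) = \<lceil>position (scale n) (u i)\<rceil> - \<theta>)"
    by (intro ball_cong) auto
  finally show ?thesis .
qed

lemma cell_sets: "cell n t \<theta> s \<in> sets (lborel_Pi (coords t))"
  unfolding cell_def by (intro sets_PiM_I_finite finite_coords) auto

lemma emeasure_cell:
  assumes "0 < n"
  shows "emeasure (lborel_Pi (coords t)) (cell n t \<theta> s) = ennreal (scale n ^ (2 * t + 1))"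
proof -
  have "emeasure (lborel_Pi (coords t)) (cell n t \<theta> s) =
     (\<Prod>i\<in>coords t. emeasure lborel {rescale n (real_of_int (int (coord_val s i) + \<theta> - 1)) <.. rescale n (real_of_int (int (coord_val s i) + \<theta>))})"
    unfolding cell_def by (rule lborel_prod.emeasure_PiM) (auto simp: finite_coords)
  also have "\<dots> = (\<Prod>i\<in>coords t. ennreal (scale n))"
  proof (rule prod.cong[OF refl])
    fix i
    have "rescale n (real_of_int (int (coord_val s i) + \<theta>)) - rescale n (real_of_int (int (coord_val s i) + \<theta> - 1)) = scale n"
      unfolding rescale_eq[OF assms] by (simp add: algebra_simps)
    then show "emeasure lborel {rescale n (real_of_int (int (coord_val s i) + \<theta> - 1)) <.. rescale n (real_of_int (int (coord_val s i) + \<theta>))} = ennreal (scale n)"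
      using scale_pos[OF assms] by (subst emeasure_lborel_Ioc) auto
  qed
  also have "\<dots> = ennreal (scale n ^ (2 * t + 1))"
    using scale_pos[OF assms] by (simp only: prod_constant card_coords ennreal_power less_imp_le)
  finally show ?thesis .
qed

text \<open>The density bound is integrated over \<open>H\<close>. The number of sequences whose
  cell contains u is a sum of cell indicators, restricted to \<open>T\<close> by \<open>sep\<close>;
  each integrates to the cell volume, which cancels the power of \<open>scale n\<close>.\<close>

lemma prob_lower:
  assumes n: "0 < n" and t: "0 < t" and H: "H \<in> sets (mu t)" and \<rho>: "0 \<le> \<rho>"
    and dens: "\<And>u. u \<in> H \<Longrightarrow> \<rho> * (scale n ^ (2 * t + 1) * F t u)
       \<le> real (card {s \<in> unimodal_seqs n. u \<in> cell n t \<theta> s}) / real (card (unimodal_seqs n))"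
    and sep: "\<And>u s. u \<in> H \<Longrightarrow> s \<in> unimodal_seqs n \<Longrightarrow> u \<in> cell n t \<theta> s \<Longrightarrow> s \<in> T"
  shows "\<rho> * measure (mu t) H \<le> measure_pmf.prob (P n) T"
proof -
  let ?N = "lborel_Pi (coords t)"
  interpret mu: prob_space "mu t" by (rule prob_space_mu[OF t])
  define d where "d = scale n ^ (2 * t + 1)"
  have d: "0 < d" using scale_pos[OF n] by (simp add: d_def)
  define c where "c = real (card (unimodal_seqs n))"
  have c: "0 < c" unfolding c_def using finite_unimodal_seqs[of n] unimodal_seqs_nonempty[OF n] by (simp add: card_gt_0_iff)
  let ?S = "unimodal_seqs n \<inter> T"
  have fin: "finite ?S" using finite_unimodal_seqs by simp
  have HN: "H \<in> sets ?N" using H by (simp add: sets_mu)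
  note [measurable] = F_measurable[OF t] HN cell_sets
  have "ennreal (\<rho> * d) * emeasure (mu t) H = (\<integral>\<^sup>+u. ennreal (\<rho> * d) * (ennreal (F t u) * indicator H u) \<partial>?N)"
    unfolding mu_def by (subst emeasure_density, measurable) (rule nn_integral_cmult[symmetric], measurable)
  also have "\<dots> \<le> (\<integral>\<^sup>+u. (\<Sum>s\<in>?S. ennreal (1 / c) * indicator (cell n t \<theta> s) u) \<partial>?N)"
  proof (rule nn_integral_mono)
    fix u
    show "ennreal (\<rho> * d) * (ennreal (F t u) * indicator H u) \<le> (\<Sum>s\<in>?S. ennreal (1 / c) * indicator (cell n t \<theta> s) u)"
    proof (cases "u \<in> H")
      case True
      have eq: "{s \<in> unimodal_seqs n. u \<in> cell n t \<theta> s} = ?S \<inter> {s. u \<in> cell n t \<theta> s}"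
        using sep[OF True] by auto
      have "ennreal (\<rho> * d) * (ennreal (F t u) * indicator H u) = ennreal (\<rho> * (d * F t u))"
        using True \<rho> d by (simp add: ennreal_mult'[symmetric] mult.assoc)
      also have "\<dots> \<le> ennreal (real (card (?S \<inter> {s. u \<in> cell n t \<theta> s})) / c)"
        using dens[OF True] unfolding eq c_def d_def by (rule ennreal_leI)
      also have "\<dots> = ennreal (1 / c) * (\<Sum>s\<in>?S. indicator (cell n t \<theta> s) u)"
      proof -
        have "(\<Sum>s\<in>?S. indicator (cell n t \<theta> s) u :: ennreal) = (\<Sum>s\<in>?S. indicator {s. u \<in> cell n t \<theta> s} s)"
          by (intro sum.cong) (auto simp: indicator_def)
        also have "\<dots> = of_nat (card (?S \<inter> {s. u \<in> cell n t \<theta> s}))"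
          unfolding indicator_def of_bool_def by (simp add: sum.If_cases[OF fin])
        also have "\<dots> = ennreal (real (card (?S \<inter> {s. u \<in> cell n t \<theta> s})))"
          by (simp add: ennreal_of_nat_eq_real_of_nat)
        finally show ?thesis using c by (simp add: ennreal_mult'[symmetric])
      qed
      finally show ?thesis by (simp add: sum_distrib_left)
    qed simp
  qed
  also have "\<dots> = (\<Sum>s\<in>?S. \<integral>\<^sup>+u. ennreal (1 / c) * indicator (cell n t \<theta> s) u \<partial>?N)"
    by (rule nn_integral_sum) measurable
  also have "\<dots> = (\<Sum>s\<in>?S. ennreal (1 / c) * ennreal d)"
    by (intro sum.cong refl) (simp add: nn_integral_cmult_indicator cell_sets emeasure_cell[OF n] d_def)
  also have "\<dots> = ennreal (real (card ?S) * (1 / c * d))"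
    using c d by (simp add: ennreal_mult'[symmetric] ennreal_of_nat_eq_real_of_nat)
  finally have "ennreal (\<rho> * d * measure (mu t) H) \<le> ennreal (real (card ?S) * (1 / c * d))"
    unfolding mu.emeasure_eq_measure using \<rho> d by (simp add: ennreal_mult'[symmetric])
  then have "\<rho> * d * measure (mu t) H \<le> real (card ?S) * (1 / c * d)"
    using c d by (subst (asm) ennreal_le_iff) auto
  then have "d * (\<rho> * measure (mu t) H) \<le> d * (real (card ?S) / c)" by (simp add: mult_ac)
  then have "\<rho> * measure (mu t) H \<le> real (card ?S) / c"
    by (simp only: mult_le_cancel_left_pos[OF d])
  also have "\<dots> = measure_pmf.prob (P n) T"
    unfolding P_def c_def using measure_pmf_of_set[OF unimodal_seqs_nonempty[OF n] finite_unimodal_seqs] by simp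
  finally show ?thesis .
qed

text \<open>Since \<open>sdev\<close> is at least exp (- 1) * \<alpha>^(-3/2), the numerator times
  \<alpha>^(3/2) has to vanish. Each of its terms then carries t * sqrt \<alpha> or a power of
  \<alpha> that beats the logarithm in \<open>height\<close>.\<close>

lemma deviation_bound_tendsto:
  assumes \<delta>: "(\<lambda>n. real (t n) * sqrt (scale n)) \<longlonglongrightarrow> 0" and K: "0 \<le> K"
  shows "(\<lambda>n. deviation_bound K (scale n) (real (t n))) \<longlonglongrightarrow> 0"
proof -
  define \<delta>' where "\<delta>' n = real (t n) * sqrt (scale n)" for n
  define r where "r n = sqrt (sqrt (scale n))" for n
  define \<Lambda> where "\<Lambda> n = height K (scale n)" for n
  have s0: "(\<lambda>n. sqrt (scale n)) \<longlonglongrightarrow> 0" using tendsto_real_sqrt[OF scale_tendsto] by simp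
  have r0: "r \<longlonglongrightarrow> 0" unfolding r_def using tendsto_real_sqrt[OF s0] by simp
  have "((\<lambda>x::real. height K x * sqrt x) \<longlongrightarrow> 0) (at_right 0)" "((\<lambda>x::real. height K x * sqrt (sqrt x)) \<longlongrightarrow> 0) (at_right 0)"
    "((\<lambda>x::real. height K x * x) \<longlongrightarrow> 0) (at_right 0)"
    unfolding height_def by real_asymp+
  note L0 = this[THEN filterlim_compose, OF scale_at_right, folded \<Lambda>_def r_def]
  \<comment> \<open>The numerator times \<alpha>^(3/2), in terms of \<open>\<delta>'\<close> = t *
    sqrt \<alpha> and \<open>r\<close> = \<alpha>^(1/4); in particular sqrt t * sqrt \<alpha> is
    sqrt \<open>\<delta>'\<close> times \<open>r\<close>.\<close>
  define H where "H n = 2 * mean_const * r n + \<Lambda> n * sqrt (scale n) + 2 * (2 * \<delta>' n * scale n + K * \<delta>' n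
     + (K * sqrt (\<delta>' n) * (\<Lambda> n * r n) + 2 * (1 + K) * \<delta>' n * (\<Lambda> n * scale n)) + 4 * (1 + K) * \<delta>' n
     + 4 * (1 + K) * \<delta>' n * (\<Lambda> n * sqrt (scale n) + 2 * sqrt (scale n)))" for n
  have d0: "\<delta>' \<longlonglongrightarrow> 0" using \<delta> by (simp add: \<delta>'_def[abs_def])
  have "H \<longlonglongrightarrow> 2 * mean_const * 0 + 0 + 2 * (2 * 0 * 0 + K * 0 + (K * sqrt 0 * 0 + 2 * (1 + K) * 0 * 0) + 4 * (1 + K) * 0
     + 4 * (1 + K) * 0 * (0 + 2 * 0))"
    unfolding H_def[abs_def] by (intro tendsto_add tendsto_mult tendsto_const tendsto_real_sqrt[OF d0] d0 r0 s0 L0 scale_tendsto)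
  then have H0: "(\<lambda>n. exp 1 * H n) \<longlonglongrightarrow> 0" using tendsto_mult[OF tendsto_const, of H 0 sequentially "exp 1"] by simp
  have mc: "0 \<le> mean_const" unfolding mean_const_def
  proof (rule suminf_nonneg)
    have "summable (\<lambda>j. real j powr (- (5/4)))" by (simp add: summable_real_powr_iff)
    then show "summable (\<lambda>j. real (Suc j) powr (- (5/4)))" by (subst summable_Suc_iff)
  qed simp
  have ev2: "\<forall>\<^sub>F n in sequentially. scale n < 1/2" by (rule order_tendstoD(2)[OF scale_tendsto]) simp
  have both: "\<forall>\<^sub>F n in sequentially. 0 \<le> deviation_bound K (scale n) (real (t n)) \<and> deviation_bound K (scale n) (real (t n)) \<le> exp 1 * H n"
    using eventually_scale_pos ev2
  proof eventually_elim
    case (elim n)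
    define \<alpha> where "\<alpha> = scale n"
    define s where "s = sqrt \<alpha>"
    have \<alpha>: "0 < \<alpha>" "\<alpha> \<le> 1/2" using elim by (auto simp: \<alpha>_def)
    have s: "0 < s" "\<alpha> = s * s" using \<alpha> by (auto simp: s_def)
    have h0: "0 \<le> height K \<alpha>" unfolding height_def using \<alpha> K by (intro add_nonneg_nonneg ln_ge_zero) (auto simp: pos_le_divide_eq)
    define D where "D = 2 * (mean_const * \<alpha> powr (- (5/4))) + height K \<alpha> / \<alpha> + 2 * side_error K \<alpha> (real (t n))"
    have D0: "0 \<le> D" unfolding D_def side_error_def using \<alpha> K h0 mc by (intro add_nonneg_nonneg mult_nonneg_nonneg divide_nonneg_nonneg) auto
    have \<sigma>: "0 < sdev \<alpha>" by (rule sdev_pos[OF \<alpha>])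
    have \<sigma>l: "exp (- 1) / (\<alpha> * s) \<le> sdev \<alpha>"
    proof (rule power2_le_imp_le)
      have "(exp (- 1) / (\<alpha> * s))\<^sup>2 = exp (- 2) / \<alpha> ^ 3"
        using s by (simp add: power_divide power_mult_distrib power2_eq_square power3_eq_cube flip: exp_add)
      also have "\<dots> \<le> (sdev \<alpha>)\<^sup>2" by (rule sdev_lower[OF \<alpha>])
      finally show "(exp (- 1) / (\<alpha> * s))\<^sup>2 \<le> (sdev \<alpha>)\<^sup>2" .
    qed (use \<sigma> in simp)
    have rs: "r n * r n = s" "0 < r n" using s by (auto simp: r_def s_def \<alpha>_def)
    have DH: "D * (\<alpha> * s) = H n"
    proof -
      have p: "\<alpha> powr (- (5/4)) * (\<alpha> * s) = r n"
      proof -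
        have "s = \<alpha> powr (1/2)" using \<alpha> by (simp add: s_def powr_half_sqrt)
        moreover have "r n = \<alpha> powr (1/4)" using \<alpha> by (simp add: r_def \<alpha>_def[symmetric] powr_half_sqrt[symmetric] powr_powr)
        ultimately show ?thesis using \<alpha> powr_add[of \<alpha> 1 "1/2"] powr_add[of \<alpha> "- (5/4)" "1 + 1/2"] by simp
      qed
      have q: "sqrt (real (t n)) * s = sqrt (\<delta>' n) * r n"
        unfolding \<delta>'_def real_sqrt_mult r_def[symmetric] mult.assoc rs ..
      have T: "real (t n) * s = \<delta>' n" by (simp add: \<delta>'_def s_def \<alpha>_def)
      have \<Lambda>: "height K \<alpha> = \<Lambda> n" by (simp add: \<Lambda>_def \<alpha>_def)
      have "D * (\<alpha> * s) = 2 * mean_const * (\<alpha> powr (- (5/4)) * (\<alpha> * s)) + height K \<alpha> * s +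
         2 * (2 * (real (t n) * s) * \<alpha> + K * (real (t n) * s) + (K * height K \<alpha> * (sqrt (real (t n)) * s) + 2 * (1 + K) * (real (t n) * s) * (height K \<alpha> * \<alpha>))
          + 4 * (1 + K) * (real (t n) * s) + 4 * (1 + K) * (real (t n) * s) * (height K \<alpha> * s + 2 * s))"
        unfolding D_def side_error_def s_def[symmetric] using \<alpha>(1) by (simp add: field_simps)
      also have "\<dots> = H n" unfolding p q T \<Lambda> H_def \<alpha>_def[symmetric] s_def[symmetric] by (simp add: mult_ac)
      finally show ?thesis .
    qed
    have "D / sdev \<alpha> \<le> D / (exp (- 1) / (\<alpha> * s))"
      using \<sigma>l D0 \<sigma> s \<alpha> by (intro divide_left_mono) auto
    also have "\<dots> = exp 1 * H n" unfolding DH[symmetric] by (simp add: exp_minus field_simps)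
    finally show ?case using D0 \<sigma> unfolding deviation_bound_def D_def[symmetric] \<alpha>_def[symmetric] by simp
  qed
  show ?thesis
    by (rule tendsto_sandwich[OF _ _ tendsto_const H0]) (use both in \<open>auto elim: eventually_mono\<close>)
qed

theorem theorem1p4:
  fixes t :: "nat \<Rightarrow> nat"
    and v0 :: "nat \<Rightarrow> real"
    and v :: "nat \<Rightarrow> side \<Rightarrow> nat \<Rightarrow> real"
  assumes "\<And>n. 0 < t n"
    and "(\<lambda>n. real (t n)) \<in> o(\<lambda>n. real n powr (1 / 4))"
  shows "(\<lambda>n. measure_pmf.prob (P n)
            {s. rescale n (real (PK s)) \<le> v0 n \<and>
                (\<forall>j. \<forall>k \<in> {1..t n}. rescale n (real (Y j k s)) \<le> v n j k)}
          - F_integral (t n) (v0 n) (v n)) \<longlonglongrightarrow> 0"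
proof -
  define E where "E n = {s. rescale n (real (PK s)) \<le> v0 n \<and>
                (\<forall>j. \<forall>k \<in> {1..t n}. rescale n (real (Y j k s)) \<le> v n j k)}" for n
  \<comment> \<open>The growth assumption on t enters only through this null sequence.\<close>
  define \<delta> where "\<delta> n = real (t n) * sqrt (scale n)" for n
  have \<delta>: "\<delta> \<longlonglongrightarrow> 0"
  proof -
    have "(\<lambda>n. real (t n) / real n powr (1/4)) \<longlonglongrightarrow> 0" by (rule smalloD_tendsto[OF assms(2)])
    then have "(\<lambda>n. real (t n) / real n powr (1/4) * sqrt (1 / B)) \<longlonglongrightarrow> 0 * sqrt (1 / B)"
      by (intro tendsto_mult tendsto_const)
    moreover have "\<delta> n = real (t n) / real n powr (1/4) * sqrt (1 / B)" for n
    proof -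
      have "real n powr (1/4) = sqrt (sqrt (real n))"
        by (simp add: powr_half_sqrt[symmetric] powr_powr)
      then show ?thesis by (simp add: \<delta>_def scale_def real_sqrt_divide real_sqrt_mult)
    qed
    then have "\<delta> = (\<lambda>n. real (t n) / real n powr (1/4) * sqrt (1 / B))" by (rule ext)
    ultimately show ?thesis by simp
  qed
  have main: "\<forall>\<^sub>F n in sequentially. \<bar>measure_pmf.prob (P n) (E n) - F_integral (t n) (v0 n) (v n)\<bar> < e" if e: "0 < e" "e < 1" for e
  proof -
    \<comment> \<open>The final estimate is 2 * \<eta>, half of e.\<close>
    define \<eta> where "\<eta> = e / 4"
    have \<eta>: "0 < \<eta>" "\<eta> < 1/4" using e by (auto simp: \<eta>_def)
    have "((\<lambda>K::real. exp (- K) + 12 / K\<^sup>2 + 4 / K) \<longlongrightarrow> 0) at_top" by real_asymp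
    then have "\<forall>\<^sub>F K::real in at_top. exp (- K) + 12 / K\<^sup>2 + 4 / K < \<eta>" by (rule order_tendstoD) (use \<eta> in simp)
    then obtain K :: real where K: "1 \<le> K" "exp (- K) + 12 / K\<^sup>2 + 4 / K < \<eta>"
      using eventually_conj[OF eventually_ge_at_top[of "1::real"]] eventually_happens[of _ "at_top :: real filter"] by (metis (mono_tags, lifting) trivial_limit_at_top_linorder)
    \<comment> \<open>2 * \<epsilon> = \<eta> together with sqrt (2 * pi) > 2 makes the quotient of
      the two local limit bounds exceed 1 - \<eta>.\<close>
    define \<epsilon> where "\<epsilon> = \<eta> / 2"
    have \<epsilon>: "0 < \<epsilon>" "\<epsilon> < 1" using \<eta> by (auto simp: \<epsilon>_def)
    have s0: "(\<lambda>n. sqrt (scale n)) \<longlonglongrightarrow> 0" using tendsto_real_sqrt[OF scale_tendsto] by simp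
    have dev0: "(\<lambda>n. deviation_bound K (scale n) (real (t n))) \<longlonglongrightarrow> 0"
      using deviation_bound_tendsto[of t K] \<delta> K by (simp add: \<delta>_def[abs_def])
    have s2: "2 < sqrt (2 * pi)" using pi_gt3 by (intro real_less_rsqrt) simp
    have ev1: "\<forall>\<^sub>F n in sequentially. scale n < 1/4" by (rule order_tendstoD(2)[OF scale_tendsto]) simp
    have ev2: "\<forall>\<^sub>F n in sequentially. (1 + K) * \<delta> n < exp (- 2)"
      using tendsto_mult[OF tendsto_const \<delta>, of "1 + K"] by (intro order_tendstoD(2)) auto
    \<comment> \<open>The condition that the prescribed parts fit into the size n, multiplied by
      \<alpha>^2 * B^2 = 1 / n.\<close>
    have ev3: "\<forall>\<^sub>F n in sequentially. (2 * \<delta> n * sqrt (scale n) + scale n) * height K (scale n) * B\<^sup>2 < 1"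
    proof -
      have "((\<lambda>x::real. height K x * sqrt x) \<longlongrightarrow> 0) (at_right 0)" "((\<lambda>x::real. height K x * x) \<longlongrightarrow> 0) (at_right 0)"
        unfolding height_def by real_asymp+
      note L0 = this[THEN filterlim_compose, OF scale_at_right]
      have "(\<lambda>n. (2 * \<delta> n * (height K (scale n) * sqrt (scale n)) + height K (scale n) * scale n) * B\<^sup>2) \<longlonglongrightarrow> (2 * 0 * 0 + 0) * B\<^sup>2"
        by (intro tendsto_mult tendsto_add tendsto_const \<delta> L0)
      then have "(\<lambda>n. (2 * \<delta> n * sqrt (scale n) + scale n) * height K (scale n) * B\<^sup>2) \<longlonglongrightarrow> 0"
        by (simp add: algebra_simps)
      then show ?thesis by (rule order_tendstoD) simp
    qed
    have ev4: "\<forall>\<^sub>F n in sequentially. \<forall>a\<ge>cutoff (scale n). \<forall>b\<ge>cutoff (scale n). llt_err (scale n) a b < \<epsilon>"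
      by (rule llt_err_uniform[OF scale_tendsto eventually_scale_pos cutoff_at_top[OF scale_tendsto eventually_scale_pos] \<epsilon>(1)])
    have ev5: "\<forall>\<^sub>F n in sequentially. 11 \<le> scale n * real (cutoff (scale n))"
      using cutoff_at_top[OF scale_tendsto eventually_scale_pos] unfolding filterlim_at_top by blast
    note ev6 = card_unimodal_seqs_asymp[OF \<epsilon>(1)]
    have ev7: "\<forall>\<^sub>F n in sequentially. deviation_bound K (scale n) (real (t n)) < 1/4"
      by (rule order_tendstoD(2)[OF dev0]) simp
    have ev8: "\<forall>\<^sub>F n in sequentially. 1 - \<eta> < density_factor K (scale n) (t n) \<epsilon>"
    proof -
      have "(\<lambda>n. exp (- (2 * (\<delta> n * sqrt (scale n)) + scale n) - 4 * (1 + K) * (\<delta> n * sqrt (scale n)) - 16 * (1 + K)\<^sup>2 * (\<delta> n)\<^sup>2) *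
        ((sqrt (2 * pi) - 2 * deviation_bound K (scale n) (real (t n)) - \<epsilon>) / (sqrt (2 * pi) + \<epsilon>)))
        \<longlonglongrightarrow> exp (- (2 * (0 * 0) + 0) - 4 * (1 + K) * (0 * 0) - 16 * (1 + K)\<^sup>2 * 0\<^sup>2) * ((sqrt (2 * pi) - 2 * 0 - \<epsilon>) / (sqrt (2 * pi) + \<epsilon>))"
        using s2 \<epsilon> by (intro tendsto_mult tendsto_exp tendsto_diff tendsto_minus tendsto_add tendsto_divide tendsto_power tendsto_const \<delta> s0 scale_tendsto dev0) simp
      then have lim: "(\<lambda>n. exp (- (2 * (\<delta> n * sqrt (scale n)) + scale n) - 4 * (1 + K) * (\<delta> n * sqrt (scale n)) - 16 * (1 + K)\<^sup>2 * (\<delta> n)\<^sup>2) *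
        ((sqrt (2 * pi) - 2 * deviation_bound K (scale n) (real (t n)) - \<epsilon>) / (sqrt (2 * pi) + \<epsilon>)))
        \<longlonglongrightarrow> (sqrt (2 * pi) - \<epsilon>) / (sqrt (2 * pi) + \<epsilon>)" by simp
      have "(1 - \<eta>) * (sqrt (2 * pi) + \<epsilon>) < sqrt (2 * pi) - \<epsilon>"
      proof -
        have "\<eta> * 2 < \<eta> * sqrt (2 * pi)" using s2 \<eta> by simp
        moreover have "0 < \<eta> * \<epsilon>" using \<eta> \<epsilon> by simp
        moreover have "(1 - \<eta>) * (sqrt (2 * pi) + \<epsilon>) = sqrt (2 * pi) + \<epsilon> - \<eta> * sqrt (2 * pi) - \<eta> * \<epsilon>"
          by (simp add: algebra_simps)
        moreover have "\<eta> = 2 * \<epsilon>" by (simp add: \<epsilon>_def)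
        ultimately show ?thesis using \<eta>(1) by linarith
      qed
      then have "1 - \<eta> < (sqrt (2 * pi) - \<epsilon>) / (sqrt (2 * pi) + \<epsilon>)" using s2 \<epsilon> by (simp add: pos_less_divide_eq)
      from order_tendstoD(1)[OF lim this] eventually_scale_pos show ?thesis
      proof eventually_elim
        case (elim n)
        have ss: "sqrt (scale n) * sqrt (scale n) = scale n" using elim by simp
        have a: "\<delta> n * sqrt (scale n) = scale n * real (t n)" unfolding \<delta>_def mult.assoc ss by (rule mult.commute)
        have b: "(\<delta> n)\<^sup>2 = scale n * (real (t n))\<^sup>2" using elim by (simp add: \<delta>_def power_mult_distrib)
        have ex: "- (2 * (scale n * real (t n)) + scale n) - 4 * (1 + K) * (scale n * real (t n)) - 16 * (1 + K)\<^sup>2 * (scale n * (real (t n))\<^sup>2)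
          = - (scale n * (2 * real (t n) + 1)) - 4 * scale n * ((1 + K) * real (t n)) - 16 * scale n * ((1 + K) * real (t n))\<^sup>2"
          unfolding power_mult_distrib by (simp add: algebra_simps)
        show ?case using elim(1) unfolding a b ex density_factor_def .
      qed
    qed
    show ?thesis
      using eventually_gt_at_top[of 0] ev1 ev2 ev3 ev4 ev5 ev6 ev7 ev8
    proof eventually_elim
      case (elim n)
      note n = elim(1)
      let ?m = "measure (mu (t n))" and ?\<Omega> = "space (mu (t n))" and ?pos = "position (scale n)"
      let ?F = "\<lambda>u. scale n ^ (2 * t n + 1) * F (t n) u"
      let ?N = "\<lambda>\<theta> u. real (card {s \<in> unimodal_seqs n. u \<in> cell n (t n) \<theta> s}) / real (card (unimodal_seqs n))"
      have t: "0 < t n" "1 \<le> t n" using assms(1)[of n] by auto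
      have \<alpha>: "0 < scale n" by (rule scale_pos[OF n])
      interpret mu: prob_space "mu (t n)" by (rule prob_space_mu[OF t(1)])
      \<comment> \<open>The ceiling minus \<theta> is within 1 of the position and monotone for both
        values of \<theta>, so one density bound serves both roundings.\<close>
      have dens: "(1 - \<eta>) * (?F u)
         \<le> ?N \<theta> u"
        if u: "u \<in> typical K (t n)" and \<theta>: "\<theta> = 0 \<or> \<theta> = 1" for u \<theta>
      proof (cases "F (t n) u = 0")
        case False
        have "density_factor K (scale n) (t n) \<epsilon> * (?F u)
           \<le> real (card {s \<in> unimodal_seqs n. \<forall>i\<in>coords (t n). int (coord_val s i) = \<lceil>?pos (u i)\<rceil> - \<theta>}) / real (card (unimodal_seqs n))"
        proof (rule fibre_lower[OF n _ K(1) t(2) u False])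
          show "\<bar>real_of_int (\<lceil>?pos (u i)\<rceil> - \<theta>) - ?pos (u i)\<bar> \<le> 1" for i
            using \<theta> by (auto simp: abs_le_iff) linarith+
          show "\<lceil>?pos (u i)\<rceil> - \<theta> \<le> \<lceil>?pos (u j)\<rceil> - \<theta>" if "u i \<le> u j" for i j
            using ceiling_mono[OF position_mono[OF \<alpha> that]] by simp
          show "(1 + K) * real (t n) * sqrt (scale n) \<le> exp (- 2)" using elim(3) by (simp add: \<delta>_def mult.assoc)
          show "(2 * real (t n) + 1) * (height K (scale n) / scale n) \<le> real n"
          proof -
            have nB: "real n = 1 / ((scale n)\<^sup>2 * B\<^sup>2)"
              using n B_pos by (simp add: scale_def power_divide power_mult_distrib)
            have ss: "\<delta> n * sqrt (scale n) = real (t n) * scale n" using \<alpha> by (simp add: \<delta>_def)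
            have "(2 * (real (t n) * scale n) + scale n) * height K (scale n) * B\<^sup>2 \<le> 1"
              using elim(4) ss by (simp add: mult.assoc)
            then have "(2 * real (t n) + 1) * height K (scale n) * scale n * B\<^sup>2 \<le> 1" by (simp add: algebra_simps)
            then have "((2 * real (t n) + 1) * height K (scale n) * scale n * B\<^sup>2) / ((scale n)\<^sup>2 * B\<^sup>2) \<le> 1 / ((scale n)\<^sup>2 * B\<^sup>2)"
              by (rule divide_right_mono) simp
            moreover have "((2 * real (t n) + 1) * height K (scale n) * scale n * B\<^sup>2) / ((scale n)\<^sup>2 * B\<^sup>2) = (2 * real (t n) + 1) * (height K (scale n) / scale n)"
              using \<alpha> B_pos by (simp add: power2_eq_square)
            ultimately show ?thesis unfolding nB by simp
          qed
          show "0 \<le> sqrt (2 * pi) - 2 * deviation_bound K (scale n) (real (t n)) - \<epsilon>"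
            using elim(8) s2 \<epsilon> by linarith
        qed (use elim \<epsilon> in \<open>auto simp: less_imp_le\<close>)
        moreover have "(1 - \<eta>) * (?F u) \<le> density_factor K (scale n) (t n) \<epsilon> * (?F u)"
          using elim(9) F_nonneg[of "t n" u] \<alpha> by (intro mult_right_mono) auto
        moreover have "u \<in> ?\<Omega>" using u by (simp add: typical_def)
        ultimately show ?thesis unfolding cell_iff[OF n \<open>u \<in> ?\<Omega>\<close>] by linarith
      qed simp
      let ?orthant = "orthant (t n) (v0 n) (v n)" and ?typical = "typical K (t n)"
      have bs: "?orthant \<in> sets (mu (t n))" by (rule orthant_sets)
      have gs: "?typical \<in> sets (mu (t n))" by (rule typical_sets[OF t(1)])
      have bad: "?m (?\<Omega> - ?typical) < \<eta>"
        using atypical_measure[OF t(1), of K] K by linarith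
      have \<eta>1: "0 \<le> 1 - \<eta>" using \<eta> by simp
      have lower: "(1 - \<eta>) * ?m (?orthant \<inter> ?typical) \<le> measure_pmf.prob (P n) (E n)"
      proof (rule prob_lower[OF n t(1) _ \<eta>1])
        show "?orthant \<inter> ?typical \<in> sets (mu (t n))" using bs gs by blast
        show "(1 - \<eta>) * (?F u)
         \<le> ?N 1 u" if "u \<in> ?orthant \<inter> ?typical" for u
          using that by (intro dens) auto
        show "s \<in> E n" if u: "u \<in> ?orthant \<inter> ?typical" and c: "u \<in> cell n (t n) 1 s" for u s
        proof -
          have "rescale n (real (coord_val s i)) \<le> (case i of U0 \<Rightarrow> v0 n | U j k \<Rightarrow> v n j k)" if "i \<in> coords (t n)" for i
          proof -
            have "rescale n (real (coord_val s i)) < u i" using PiE_mem[OF c[unfolded cell_def] that] by simp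
            moreover have "u i \<le> (case i of U0 \<Rightarrow> v0 n | U j k \<Rightarrow> v n j k)"
              using u that by (auto simp: orthant_def dest!: PiE_mem)
            ultimately show ?thesis by simp
          qed
          from this[of U0] this[of "U j k" for j k] show ?thesis
            by (auto simp: E_def coord_val_def coords_def)
        qed
      qed
      have upper: "(1 - \<eta>) * ?m ((?\<Omega> - ?orthant) \<inter> ?typical) \<le> measure_pmf.prob (P n) (- E n)"
      proof (rule prob_lower[OF n t(1) _ \<eta>1])
        show "(?\<Omega> - ?orthant) \<inter> ?typical \<in> sets (mu (t n))" using bs gs by blast
        show "(1 - \<eta>) * (?F u)
         \<le> ?N 0 u" if "u \<in> (?\<Omega> - ?orthant) \<inter> ?typical" for u
          using that by (intro dens) auto
        show "s \<in> - E n" if u: "u \<in> (?\<Omega> - ?orthant) \<inter> ?typical" and c: "u \<in> cell n (t n) 0 s" for u s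
        proof -
          from u obtain i where i: "i \<in> coords (t n)" "\<not> u i \<le> (case i of U0 \<Rightarrow> v0 n | U j k \<Rightarrow> v n j k)"
            by (auto simp: orthant_def space_mu PiE_def Pi_def)
          have "u i \<le> rescale n (real (coord_val s i))" using PiE_mem[OF c[unfolded cell_def] i(1)] by simp
          then have "\<not> rescale n (real (coord_val s i)) \<le> (case i of U0 \<Rightarrow> v0 n | U j k \<Rightarrow> v n j k)" using i(2) by linarith
          then show ?thesis using i(1)
            by (cases i) (auto simp: E_def coord_val_def coords_def, meson atLeastAtMost_iff)
        qed
      qed
      define m where "m = ?m ?orthant"
      have m: "0 \<le> m" "m \<le> 1" by (auto simp: m_def)
      have sub: "?m A - \<eta> \<le> ?m (A \<inter> ?typical)" if A: "A \<in> sets (mu (t n))" for A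
      proof -
        have "?m A \<le> ?m ((A \<inter> ?typical) \<union> (?\<Omega> - ?typical))"
          using A gs sets.sets_into_space[OF A] by (intro mu.finite_measure_mono) auto
        also have "\<dots> \<le> ?m (A \<inter> ?typical) + ?m (?\<Omega> - ?typical)"
          using A gs by (intro measure_Un_le) auto
        finally show ?thesis using bad by linarith
      qed
      have l: "(1 - \<eta>) * (m - \<eta>) \<le> measure_pmf.prob (P n) (E n)"
        using mult_left_mono[OF sub[OF bs] \<eta>1] lower unfolding m_def by linarith
      have "1 - m = ?m (?\<Omega> - ?orthant)" using mu.prob_compl[OF bs] by (simp add: m_def)
      moreover have "?\<Omega> - ?orthant \<in> sets (mu (t n))" using bs by blast
      ultimately have u: "(1 - \<eta>) * (1 - m - \<eta>) \<le> measure_pmf.prob (P n) (- E n)"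
        using mult_left_mono[OF sub[of "?\<Omega> - ?orthant"] \<eta>1] upper by simp
      have "measure_pmf.prob (P n) (- E n) = 1 - measure_pmf.prob (P n) (E n)"
        using measure_pmf.prob_compl[of "E n" "P n"] by (simp add: Compl_eq_Diff_UNIV)
      \<comment> \<open>One \<eta> is lost through the density factor and one through the atypical
        points.\<close>
      moreover have lin: "x - 2 * \<eta> \<le> (1 - \<eta>) * (x - \<eta>)" if "x \<le> 1" for x
      proof -
        have "\<eta> * x \<le> \<eta> * 1" using that \<eta> by (intro mult_left_mono) auto
        moreover have "0 \<le> \<eta> * \<eta>" by simp
        moreover have "(1 - \<eta>) * (x - \<eta>) = x - \<eta> - \<eta> * x + \<eta> * \<eta>" by (simp add: algebra_simps)
        ultimately show ?thesis by linarith
      qed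
      ultimately have "\<bar>measure_pmf.prob (P n) (E n) - m\<bar> \<le> 2 * \<eta>"
        using l u lin[of m] lin[of "1 - m"] m by linarith
      then show ?case unfolding F_integral_eq_measure[OF t(1)] m_def[symmetric] using \<eta> by (simp add: \<eta>_def)
    qed
  qed
  have "(\<lambda>n. measure_pmf.prob (P n) (E n) - F_integral (t n) (v0 n) (v n)) \<longlonglongrightarrow> 0"
  proof (rule tendstoI)
    fix e :: real assume e: "0 < e"
    \<comment> \<open>\<open>main\<close> is stated for e < 1, so larger values are capped.\<close>
    have "\<forall>\<^sub>F n in sequentially. \<bar>measure_pmf.prob (P n) (E n) - F_integral (t n) (v0 n) (v n)\<bar> < min e (1/2)"
      using e by (intro main) auto
    then show "\<forall>\<^sub>F n in sequentially. dist (measure_pmf.prob (P n) (E n) - F_integral (t n) (v0 n) (v n)) 0 < e"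
      by (rule eventually_mono) (simp add: dist_real_def)
  qed
  then show ?thesis unfolding E_def .
qed

end
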